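(* Let $X$ be a proper $CAT(-1)$-space and let $\Gamma$ be a non-elementary discrete group of isometries of $X$, with quotient $Y=X/\Gamma$. Assume that (1) for all $x,x'\in X$ there exists $\xi\in\partial X$ such that $\alpha(\xi,x,x')=0$, where $\alpha$ is the generalized Busemann function of $X$; and (2) the non-wandering set $\Omega$ of the geodesic flow on $GY$ equals $GY$. Then the geodesic flow $\mathbb{R}\times GY\to GY$ on the quotient space $Y=X/\Gamma$ is topologically mixing.
   Context: A $CAT(-1)$-space is a geodesic metric space in which every geodesic triangle is at least as thin as its comparison triangle in the hyperbolic plane $\mathbb{H}^2$. A metric space is proper if its closed balls are compact. For a proper $CAT(-1)$-space $X$, $\partial X$ denotes its visual boundary (equivalence classes of asymptotic geodesic rays; two rays or geodesics $g_1,g_2$ are asymptotic if $d(g_1(t),g_2(t))$ is bounded for $t\ge 0$), and $X\cup\partial X$ carries its usual compact topology. A discrete group $\Gamma$ of isometries of $X$ is one acting properly discontinuously on $X$: for every compact $K\subset X$ the set $\{\gamma\in\Gamma : \gamma K\cap K\ne\emptyset\}$ is finite (the action need not be free). Its limit set is $\Lambda(\Gamma)=\overline{\Gamma x}\cap\partial X$ ($x\in X$ arbitrary, closure in $X\cup\partial X$), and $\Gamma$ is non-elementary if $\Lambda(\Gamma)$ has more than two points (equivalently, is infinite). $GX$ is the space of all geodesics, i.e. isometric maps $g:\mathbb{R}\to X$, with the topology of uniform convergence on compact sets. $\Gamma$ acts on $GX$ by composition, and $GY:=GX/\Gamma$ with the quotient topology; $p:GX\to GY$ is the projection. The geodesic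 flow on $GX$ is $(t\cdot g)(s)=g(s+t)$, and the geodesic flow on $GY$ is $t\cdot g=p(t\cdot\overline g)$ for any lift $\overline g\in GX$ of $g\in GY$. The geodesic flow on $GY$ is topologically mixing if for any nonempty open sets $\mathcal{O},\mathcal{U}\subset GY$ there is $t_0>0$ such that $t\cdot\mathcal{O}\cap\mathcal{U}\neq\emptyset$ for all $|t|\ge t_0$. A point $g\in GY$ belongs to the non-wandering set $\Omega$ if there exist sequences $\{g_n\}\subset GY$ and $\{t_n\}\subset\mathbb{R}$ with $t_n\to\infty$, $g_n\to g$ and $t_n\cdot g_n\to g$. The generalized Busemann function $\alpha:(X\cup\partial X)\times X\times X\to\mathbb{R}$ is the unique continuous extension of $\alpha(y,x,x')=d(x',y)-d(x,y)$, $(y,x,x')\in X\times X\times X$. *)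

theory Defs
  imports "HOL-Analysis.Analysis"
begin

text \<open>The space X is the universe of a type of class \<open>metric_space\<close>; hypotheses on X are
  predicates on \<open>TYPE('a)\<close>. An ideal point is an asymptoty class of rays, and a point of
  the compactification of X by its visual boundary is an element of
  \<open>'a + (real \<Rightarrow> 'a) set\<close>.\<close>

subsection \<open>Geodesics and CAT(-1)-spaces\<close>

definition geodesic_on :: "real set \<Rightarrow> (real \<Rightarrow> 'a::metric_space) \<Rightarrow> bool" where
  "geodesic_on I c \<longleftrightarrow> (\<forall>s\<in>I. \<forall>t\<in>I. dist (c s) (c t) = \<bar>s - t\<bar>)"

definition geodesic_from_to :: "(real \<Rightarrow> 'a::metric_space) \<Rightarrow> 'a \<Rightarrow> 'a \<Rightarrow> bool" where
  "geodesic_from_to c x y \<longleftrightarrow>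
     geodesic_on {0..dist x y} c \<and> c 0 = x \<and> c (dist x y) = y"

definition geodesic_space :: "'a::metric_space itself \<Rightarrow> bool" where
  "geodesic_space _ \<longleftrightarrow> (\<forall>x y :: 'a. \<exists>c. geodesic_from_to c x y)"

definition proper_space :: "'a::metric_space itself \<Rightarrow> bool" where
  "proper_space _ \<longleftrightarrow> (\<forall>(x::'a) r. compact (cball x r))"

text \<open>The hyperbolic plane (curvature -1) in the upper half-plane model.\<close>

definition hyperbolic_plane :: "complex set" where
  "hyperbolic_plane = {z. Im z > 0}"

definition hyp_dist :: "complex \<Rightarrow> complex \<Rightarrow> real" where
  "hyp_dist z w = arcosh (1 + (cmod (z - w))\<^sup>2 / (2 * Im z * Im w))"

definition hyp_geodesic_from_to :: "(real \<Rightarrow> complex) \<Rightarrow> complex \<Rightarrow> complex \<Rightarrow> bool" where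
  "hyp_geodesic_from_to c z w \<longleftrightarrow>
     c ` {0..hyp_dist z w} \<subseteq> hyperbolic_plane \<and>
     (\<forall>s\<in>{0..hyp_dist z w}. \<forall>t\<in>{0..hyp_dist z w}. hyp_dist (c s) (c t) = \<bar>s - t\<bar>) \<and>
     c 0 = z \<and> c (hyp_dist z w) = w"

text \<open>The comparison triangle of a geodesic triangle exists and is unique up to isometry of the
  hyperbolic plane. Since \<open>p, q, r\<close> are arbitrary and segments can be reversed, the thinness
  condition need only be stated for the two sides issuing from \<open>p\<close>; for two points on one
  and the same side it is an equality.\<close>

definition CAT_minus1_space :: "'a::metric_space itself \<Rightarrow> bool" where
  "CAT_minus1_space X \<longleftrightarrow> geodesic_space X \<and>
     (\<forall>(p::'a) q r \<sigma> \<tau> \<rho>.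
        geodesic_from_to \<sigma> p q \<and> geodesic_from_to \<tau> p r \<and> geodesic_from_to \<rho> q r \<longrightarrow>
        (\<exists>p' q' r' \<sigma>' \<tau>'.
           {p', q', r'} \<subseteq> hyperbolic_plane \<and>
           hyp_dist p' q' = dist p q \<and> hyp_dist p' r' = dist p r \<and> hyp_dist q' r' = dist q r \<and>
           hyp_geodesic_from_to \<sigma>' p' q' \<and> hyp_geodesic_from_to \<tau>' p' r' \<and>
           (\<forall>s\<in>{0..dist p q}. \<forall>t\<in>{0..dist p r}.
              dist (\<sigma> s) (\<tau> t) \<le> hyp_dist (\<sigma>' s) (\<tau>' t))))"

subsection \<open>The visual boundary and the compactification\<close>

text \<open>A ray is a function on all of \<open>real\<close> of which only the restriction to \<open>t \<ge> 0\<close> matters.\<close>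

definition geodesic_rays :: "(real \<Rightarrow> 'a::metric_space) set" where
  "geodesic_rays = {c. geodesic_on {0..} c}"

definition asymptotic :: "((real \<Rightarrow> 'a::metric_space) \<times> (real \<Rightarrow> 'a)) set" where
  "asymptotic = {(c, c'). c \<in> geodesic_rays \<and> c' \<in> geodesic_rays \<and>
                   (\<exists>B. \<forall>t\<ge>0. dist (c t) (c' t) \<le> B)}"

definition visual_boundary :: "(real \<Rightarrow> 'a::metric_space) set set" where
  "visual_boundary = geodesic_rays // asymptotic"

text \<open>The standard neighbourhood of the endpoint of the ray \<open>c\<close>: the points outside the closed
  ball of radius \<open>r\<close> about \<open>c 0\<close> whose projection to that ball, i.e. the point at distance
  \<open>r\<close> on the geodesic from \<open>c 0\<close>, is \<open>e\<close>-close to \<open>c r\<close>.\<close>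

definition cone_nbhd ::
  "(real \<Rightarrow> 'a::metric_space) \<Rightarrow> real \<Rightarrow> real \<Rightarrow> ('a + (real \<Rightarrow> 'a) set) set" where
  "cone_nbhd c r e =
     Inl ` {x. dist (c 0) x > r \<and> (\<exists>\<sigma>. geodesic_from_to \<sigma> (c 0) x \<and> dist (\<sigma> r) (c r) < e)} \<union>
     Inr ` {\<xi> \<in> visual_boundary. \<exists>c'\<in>\<xi>. c' 0 = c 0 \<and> dist (c' r) (c r) < e}"

text \<open>The cone topology. Rays with arbitrary origin are admitted; for complete CAT(0)-spaces this
  yields the same topology as any fixed origin.\<close>

definition cone_topology :: "('a::metric_space + (real \<Rightarrow> 'a) set) topology" where
  "cone_topology = topology_generated_by
     ({Inl ` U | U. open U} \<union> {cone_nbhd c r e | c r e. c \<in> geodesic_rays \<and> r > 0 \<and> e > 0})"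

definition is_generalized_busemann ::
  "(('a::metric_space + (real \<Rightarrow> 'a) set) \<Rightarrow> 'a \<Rightarrow> 'a \<Rightarrow> real) \<Rightarrow> bool" where
  "is_generalized_busemann \<alpha> \<longleftrightarrow>
     continuous_map (prod_topology cone_topology (prod_topology euclidean euclidean)) euclideanreal
       (\<lambda>(\<eta>, x, x'). \<alpha> \<eta> x x') \<and>
     (\<forall>y x x'. \<alpha> (Inl y) x x' = dist x' y - dist x y)"

subsection \<open>Discrete groups of isometries\<close>

definition isometry_group :: "('a::metric_space \<Rightarrow> 'a) set \<Rightarrow> bool" where
  "isometry_group \<Gamma> \<longleftrightarrow>
     (\<forall>\<gamma>\<in>\<Gamma>. bij \<gamma> \<and> (\<forall>x y. dist (\<gamma> x) (\<gamma> y) = dist x y)) \<and>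
     id \<in> \<Gamma> \<and> (\<forall>\<gamma>\<in>\<Gamma>. \<forall>\<delta>\<in>\<Gamma>. \<gamma> \<circ> \<delta> \<in> \<Gamma>) \<and> (\<forall>\<gamma>\<in>\<Gamma>. inv \<gamma> \<in> \<Gamma>)"

definition discrete_isometry_group :: "('a::metric_space \<Rightarrow> 'a) set \<Rightarrow> bool" where
  "discrete_isometry_group \<Gamma> \<longleftrightarrow> isometry_group \<Gamma> \<and>
     (\<forall>K. compact K \<longrightarrow> finite {\<gamma> \<in> \<Gamma>. \<gamma> ` K \<inter> K \<noteq> {}})"

definition limit_set :: "('a::metric_space \<Rightarrow> 'a) set \<Rightarrow> 'a \<Rightarrow> (real \<Rightarrow> 'a) set set" where
  "limit_set \<Gamma> x =
     {\<xi> \<in> visual_boundary. Inr \<xi> \<in> cone_topology closure_of (Inl ` (\<lambda>\<gamma>. \<gamma> x) ` \<Gamma>)}"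

text \<open>The limit set does not depend on the base point, so the existential quantifier below could
  equally be a universal one.\<close>

definition non_elementary :: "('a::metric_space \<Rightarrow> 'a) set \<Rightarrow> bool" where
  "non_elementary \<Gamma> \<longleftrightarrow> (\<exists>x. infinite (limit_set \<Gamma> x) \<or> card (limit_set \<Gamma> x) > 2)"

subsection \<open>The space of geodesics, its quotient, and the geodesic flow\<close>

definition GX :: "(real \<Rightarrow> 'a::metric_space) set" where
  "GX = {g. geodesic_on UNIV g}"

definition GX_topology :: "(real \<Rightarrow> 'a::metric_space) topology" where
  "GX_topology = topology (\<lambda>U. U \<subseteq> GX \<and>
     (\<forall>g\<in>U. \<exists>K e. compact K \<and> e > 0 \<and> {h \<in> GX. \<forall>t\<in>K. dist (h t) (g t) < e} \<subseteq> U))"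

definition proj_GY :: "('a \<Rightarrow> 'a) set \<Rightarrow> (real \<Rightarrow> 'a) \<Rightarrow> (real \<Rightarrow> 'a) set" where
  "proj_GY \<Gamma> g = (\<lambda>\<gamma>. \<gamma> \<circ> g) ` \<Gamma>"

definition GY :: "('a::metric_space \<Rightarrow> 'a) set \<Rightarrow> (real \<Rightarrow> 'a) set set" where
  "GY \<Gamma> = proj_GY \<Gamma> ` GX"

definition GY_topology :: "('a::metric_space \<Rightarrow> 'a) set \<Rightarrow> (real \<Rightarrow> 'a) set topology" where
  "GY_topology \<Gamma> = topology (\<lambda>U. U \<subseteq> GY \<Gamma> \<and> openin GX_topology {g \<in> GX. proj_GY \<Gamma> g \<in> U})"

definition flow_GX :: "real \<Rightarrow> (real \<Rightarrow> 'a) \<Rightarrow> (real \<Rightarrow> 'a)" where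
  "flow_GX t g = (\<lambda>s. g (s + t))"

definition flow_GY ::
  "('a::metric_space \<Rightarrow> 'a) set \<Rightarrow> real \<Rightarrow> (real \<Rightarrow> 'a) set \<Rightarrow> (real \<Rightarrow> 'a) set" where
  "flow_GY \<Gamma> t y = proj_GY \<Gamma> (flow_GX t (SOME g. g \<in> GX \<and> proj_GY \<Gamma> g = y))"

definition non_wandering_set :: "('a::metric_space \<Rightarrow> 'a) set \<Rightarrow> (real \<Rightarrow> 'a) set set" where
  "non_wandering_set \<Gamma> = {y \<in> GY \<Gamma>. \<exists>(ys :: nat \<Rightarrow> (real \<Rightarrow> 'a) set) (ts :: nat \<Rightarrow> real).
     range ys \<subseteq> GY \<Gamma> \<and> filterlim ts at_top sequentially \<and>
     limitin (GY_topology \<Gamma>) ys y sequentially \<and>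
     limitin (GY_topology \<Gamma>) (\<lambda>n. flow_GY \<Gamma> (ts n) (ys n)) y sequentially}"

definition topologically_mixing_flow :: "('a::metric_space \<Rightarrow> 'a) set \<Rightarrow> bool" where
  "topologically_mixing_flow \<Gamma> \<longleftrightarrow>
     (\<forall>A B. openin (GY_topology \<Gamma>) A \<and> A \<noteq> {} \<and> openin (GY_topology \<Gamma>) B \<and> B \<noteq> {} \<longrightarrow>
        (\<exists>t0>0. \<forall>t. \<bar>t\<bar> \<ge> t0 \<longrightarrow> flow_GY \<Gamma> t ` A \<inter> B \<noteq> {}))"

subsection \<open>Well-definedness\<close>

lemma equiv_asymptotic:
  "equiv geodesic_rays (asymptotic :: ((real \<Rightarrow> 'a::metric_space) \<times> (real \<Rightarrow> 'a)) set)"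
proof (rule equivI)
  show "asymptotic \<subseteq> geodesic_rays \<times> geodesic_rays"
    by (auto simp: asymptotic_def)
  show "refl_on geodesic_rays asymptotic"
    by (auto simp: refl_on_def asymptotic_def)
  show "sym asymptotic"
    by (auto simp: sym_def asymptotic_def dist_commute)
  show "trans (asymptotic :: ((real \<Rightarrow> 'a) \<times> (real \<Rightarrow> 'a)) set)"
  proof (rule transI)
    fix x y z :: "real \<Rightarrow> 'a"
    assume ab: "(x, y) \<in> asymptotic" and bc: "(y, z) \<in> asymptotic"
    then obtain B C where "\<forall>t\<ge>0. dist (x t) (y t) \<le> B" "\<forall>t\<ge>0. dist (y t) (z t) \<le> C"
      by (auto simp: asymptotic_def)
    then have "\<forall>t\<ge>0. dist (x t) (z t) \<le> B + C"
      by (meson add_mono dist_triangle order_trans)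
    with ab bc show "(x, z) \<in> asymptotic"
      by (auto simp: asymptotic_def)
  qed
qed

lemma topspace_cone_topology:
  "topspace cone_topology = range Inl \<union> Inr ` (visual_boundary :: (real \<Rightarrow> 'a::metric_space) set set)"
proof -
  have "Inr \<xi> \<in> \<Union> {cone_nbhd c r e | c r e. c \<in> geodesic_rays \<and> r > 0 \<and> e > 0}"
    if xi: "\<xi> \<in> visual_boundary" for \<xi> :: "(real \<Rightarrow> 'a) set"
  proof -
    obtain c where c: "c \<in> geodesic_rays" "\<xi> = asymptotic `` {c}"
      using xi unfolding visual_boundary_def by (auto elim: quotientE)
    then have "c \<in> \<xi>"
      using equiv_class_self[OF equiv_asymptotic] by blast
    then have "\<exists>c'\<in>\<xi>. c' 0 = c 0 \<and> dist (c' 1) (c 1) < 1"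
      by (intro bexI[of _ c]) auto
    with xi have "Inr \<xi> \<in> cone_nbhd c 1 1"
      unfolding cone_nbhd_def by blast
    moreover have "cone_nbhd c 1 1 \<in> {cone_nbhd c r e | c r e. c \<in> geodesic_rays \<and> r > 0 \<and> e > 0}"
      using c(1) zero_less_one by blast
    ultimately show ?thesis
      by blast
  qed
  then have "Inr ` visual_boundary \<subseteq>
      \<Union> {cone_nbhd c r e | (c :: real \<Rightarrow> 'a) r e. c \<in> geodesic_rays \<and> r > 0 \<and> e > 0}"
    by blast
  moreover have "range Inl \<in> ({Inl ` U | U. open (U :: 'a set)} :: ('a + (real \<Rightarrow> 'a) set) set set)"
    using open_UNIV by blast
  then have "range Inl \<subseteq> \<Union> ({Inl ` U | U. open (U :: 'a set)} :: ('a + (real \<Rightarrow> 'a) set) set set)"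
    by (rule Union_upper)
  moreover have "\<Union> ({Inl ` U | U. open (U :: 'a set)} :: ('a + (real \<Rightarrow> 'a) set) set set) \<subseteq> range Inl"
    by blast
  moreover have "cone_nbhd c r e \<subseteq> range Inl \<union> Inr ` visual_boundary" for c :: "real \<Rightarrow> 'a" and r e
    unfolding cone_nbhd_def by (intro Un_mono image_mono) auto
  then have "\<Union> {cone_nbhd c r e | (c :: real \<Rightarrow> 'a) r e. c \<in> geodesic_rays \<and> r > 0 \<and> e > 0}
      \<subseteq> range Inl \<union> Inr ` visual_boundary"
    by blast
  moreover have "A \<union> B = I \<union> V"
    if "V \<subseteq> B" "I \<subseteq> A" "A \<subseteq> I" "B \<subseteq> I \<union> V"
    for A B I V :: "('a + (real \<Rightarrow> 'a) set) set"
    using that by blast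
  ultimately show ?thesis
    unfolding cone_topology_def topology_generated_by_topspace Union_Un_distrib
    by meson
qed

lemma openin_GX_topology:
  fixes U :: "(real \<Rightarrow> 'a::metric_space) set"
  shows
  "openin GX_topology U \<longleftrightarrow> U \<subseteq> GX \<and>
     (\<forall>g\<in>U. \<exists>K e. compact K \<and> e > 0 \<and> {h \<in> GX. \<forall>t\<in>K. dist (h t) (g t) < e} \<subseteq> U)"
proof -
  let ?P = "\<lambda>U :: (real \<Rightarrow> 'a) set. U \<subseteq> GX \<and>
     (\<forall>g\<in>U. \<exists>K e. compact K \<and> e > 0 \<and> {h \<in> GX. \<forall>t\<in>K. dist (h t) (g t) < e} \<subseteq> U)"
  have "istopology ?P"
    unfolding istopology_def
  proof (intro conjI allI impI)
    fix S T :: "(real \<Rightarrow> 'a) set"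
    assume S: "?P S" and T: "?P T"
    have "\<exists>K e. compact K \<and> e > 0 \<and> {h \<in> GX. \<forall>t\<in>K. dist (h t) (g t) < e} \<subseteq> S \<inter> T"
      if "g \<in> S \<inter> T" for g
    proof -
      from that S obtain K e where 1:
        "compact K" "e > 0" "{h \<in> GX. \<forall>t\<in>K. dist (h t) (g t) < e} \<subseteq> S"
        by (meson IntE)
      from that T obtain L d where 2:
        "compact L" "d > 0" "{h \<in> GX. \<forall>t\<in>L. dist (h t) (g t) < d} \<subseteq> T"
        by (meson IntE)
      show ?thesis
        using 1 2 by (intro exI[of _ "K \<union> L"] exI[of _ "min e d"]) auto
    qed
    then show "\<forall>g\<in>S \<inter> T. \<exists>K e. compact K \<and> e > 0 \<and>
         {h \<in> GX. \<forall>t\<in>K. dist (h t) (g t) < e} \<subseteq> S \<inter> T"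
      by blast
    show "S \<inter> T \<subseteq> GX"
      using S by blast
  next
    fix \<K> :: "(real \<Rightarrow> 'a) set set"
    assume *: "\<forall>S\<in>\<K>. ?P S"
    then show "\<Union>\<K> \<subseteq> GX" by blast
    show "\<forall>g\<in>\<Union>\<K>. \<exists>K e. compact K \<and> e > 0 \<and>
         {h \<in> GX. \<forall>t\<in>K. dist (h t) (g t) < e} \<subseteq> \<Union>\<K>"
    proof
      fix g assume "g \<in> \<Union>\<K>"
      then obtain S where S: "S \<in> \<K>" "g \<in> S" by blast
      with * obtain K e where
        "compact K" "e > 0" "{h \<in> GX. \<forall>t\<in>K. dist (h t) (g t) < e} \<subseteq> S"
        by meson
      with S show "\<exists>K e. compact K \<and> e > 0 \<and>
         {h \<in> GX. \<forall>t\<in>K. dist (h t) (g t) < e} \<subseteq> \<Union>\<K>"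
        by (intro exI[of _ K] exI[of _ e]) blast
    qed
  qed
  then show ?thesis
    unfolding GX_topology_def by (simp add: topology_inverse')
qed

lemma topspace_GX_topology: "topspace GX_topology = (GX :: (real \<Rightarrow> 'a::metric_space) set)"
proof -
  have "openin GX_topology (GX :: (real \<Rightarrow> 'a) set)"
    unfolding openin_GX_topology
    by (intro conjI ballI exI[of _ "{}"] exI[of _ 1]) auto
  then show ?thesis
    by (metis openin_GX_topology openin_subset openin_topspace subset_antisym)
qed

lemma openin_GY_topology:
  "openin (GY_topology \<Gamma>) U \<longleftrightarrow>
     U \<subseteq> GY \<Gamma> \<and> openin GX_topology {g \<in> GX. proj_GY \<Gamma> g \<in> U}"
proof -
  have "istopology (\<lambda>U. U \<subseteq> GY \<Gamma> \<and> openin GX_topology {g \<in> GX. proj_GY \<Gamma> g \<in> U})"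
    unfolding istopology_def
  proof (intro conjI allI impI)
    fix S T
    assume "S \<subseteq> GY \<Gamma> \<and> openin GX_topology {g \<in> GX. proj_GY \<Gamma> g \<in> S}"
      and "T \<subseteq> GY \<Gamma> \<and> openin GX_topology {g \<in> GX. proj_GY \<Gamma> g \<in> T}"
    moreover have "{g \<in> GX. proj_GY \<Gamma> g \<in> S \<inter> T} =
        {g \<in> GX. proj_GY \<Gamma> g \<in> S} \<inter> {g \<in> GX. proj_GY \<Gamma> g \<in> T}"
      by blast
    ultimately show "S \<inter> T \<subseteq> GY \<Gamma>" and "openin GX_topology {g \<in> GX. proj_GY \<Gamma> g \<in> S \<inter> T}"
      by auto
  next
    fix \<K>
    assume "\<forall>S\<in>\<K>. S \<subseteq> GY \<Gamma> \<and> openin GX_topology {g \<in> GX. proj_GY \<Gamma> g \<in> S}"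
    moreover have "{g \<in> GX. proj_GY \<Gamma> g \<in> \<Union>\<K>} = (\<Union>S\<in>\<K>. {g \<in> GX. proj_GY \<Gamma> g \<in> S})"
      by blast
    ultimately show "\<Union>\<K> \<subseteq> GY \<Gamma>" and "openin GX_topology {g \<in> GX. proj_GY \<Gamma> g \<in> \<Union>\<K>}"
      by auto
  qed
  then show ?thesis
    unfolding GY_topology_def by (simp add: topology_inverse')
qed

lemma topspace_GY_topology: "topspace (GY_topology \<Gamma>) = GY \<Gamma>"
proof -
  have "{g \<in> GX. proj_GY \<Gamma> g \<in> GY \<Gamma>} = topspace GX_topology"
    by (auto simp: topspace_GX_topology GY_def)
  then have "openin (GY_topology \<Gamma>) (GY \<Gamma>)"
    by (simp add: openin_GY_topology)
  then show ?thesis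
    by (metis openin_GY_topology openin_subset openin_topspace subset_antisym)
qed

lemma quotient_map_proj_GY: "quotient_map GX_topology (GY_topology \<Gamma>) (proj_GY \<Gamma>)"
  by (auto simp: quotient_map_def topspace_GX_topology topspace_GY_topology
      openin_GY_topology GY_def)

lemma flow_GY_proj:
  assumes "isometry_group \<Gamma>" and "g \<in> GX"
  shows "flow_GY \<Gamma> t (proj_GY \<Gamma> g) = proj_GY \<Gamma> (flow_GX t g)"
proof -
  define h where "h = (SOME h. h \<in> GX \<and> proj_GY \<Gamma> h = proj_GY \<Gamma> g)"
  have "h \<in> GX \<and> proj_GY \<Gamma> h = proj_GY \<Gamma> g"
    unfolding h_def by (rule someI[of _ g]) (use assms(2) in simp)
  then have h: "(\<lambda>\<gamma>. \<gamma> \<circ> h) ` \<Gamma> = (\<lambda>\<gamma>. \<gamma> \<circ> g) ` \<Gamma>"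
    by (simp add: proj_GY_def)
  have "proj_GY \<Gamma> (flow_GX t f) = flow_GX t ` (\<lambda>\<gamma>. \<gamma> \<circ> f) ` \<Gamma>" for f
    by (force simp: proj_GY_def flow_GX_def comp_def)
  with h show ?thesis
    by (simp add: flow_GY_def h_def)
qed

end

theory Submission
  imports Defs
begin

text \<open>
  \<^emph>\<open>Geometry.\<close> In the hyperbolic plane \<open>cosh\<close> of the distance to a fixed point solves
  \<open>u'' = u\<close> along geodesics; in a CAT(-1)-space it is a subsolution (\<open>stewart\<close>). The position
  of a point \<open>b\<close> relative to the segment from \<open>a\<close> to \<open>c\<close> is measured by its
  excess \<open>exc a b c\<close>, the defect in the triangle inequality: small excess means small distance
  to the segment (\<open>dist_segment_le_fat_exc\<close>), the excess decays along a geodesic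
  (\<open>exc_decay\<close>), and hence two bounded excesses at distant points force a small one in
  between (\<open>exc_local_to_global\<close>). Ideal points are represented by rays. For two rays \<open>e\<close>, \<open>r\<close>
  that are not asymptotic, the signed distance \<open>horo e r\<close> of the horospheres through \<open>e 0\<close> and
  \<open>r 0\<close> is exactly the time that the line from the end of \<open>e\<close> to the end of \<open>r\<close> takes from the
  first to the second (\<open>joining_line_converges\<close>).

  \<^emph>\<open>Mixing.\<close> As every geodesic is non-wandering, every geodesic is a limit of closed ones
  (\<open>closing\<close>), so it suffices to pass from a closed geodesic \<open>c\<close> of period \<open>\<omega>\<close> to a closed
  geodesic \<open>d\<close> of period \<open>\<omega>'\<close>, up to a small error, at every large time. The line from the origin
  of \<open>c\<close> to the endpoint of a translate \<open>\<delta> \<circ> d\<close> projects to a geodesic that winds around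
  \<open>c\<close> in the past and around \<open>d\<close> in the future. Following it over \<open>p\<close> turns of the former and
  \<open>q\<close> turns of the latter takes the time \<open>horo (past c) (\<delta> \<circ> d) + p \<omega> + q \<omega>'\<close>, where \<open>p\<close> and
  \<open>q\<close> may be any large numbers (\<open>heteroclinic\<close>). Mixing therefore follows if the numbers
  \<open>horo (past c) (\<delta> \<circ> d)\<close>, \<open>\<delta> \<in> \<Gamma>\<close>, are dense modulo \<open>\<omega>\<close>, because then finitely many
  \<open>\<delta>\<close> serve all times.

  \<^emph>\<open>Density.\<close> Winding \<open>n\<close> times around a translate of \<open>c\<close> on the way to a translate of \<open>d\<close> adds
  up two such numbers modulo \<open>\<omega>\<close>, one for \<open>c\<close> and one for \<open>d\<close>, as \<open>n\<close> grows
  (\<open>horo_along_axis\<close>). For \<open>d = c\<close> their closure is thus a closed subsemigroup of a circle, hence a group. This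
  group contains the cross ratios \<open>horo a x + horo b y - horo a y - horo b x\<close> where \<open>a\<close>, \<open>b\<close> are
  translates of the origin and \<open>x\<close>, \<open>y\<close> translates of the endpoint of \<open>c\<close>. The orbit of any ideal
  point accumulates at every ideal point (\<open>approximate_end\<close>), so by continuity the group contains
  all cross ratios in which \<open>a\<close>, \<open>b\<close> are the origin and the endpoint of \<open>c\<close> itself and \<open>x\<close>, \<open>y\<close>
  are arbitrary other ideal points. Finally the zeros of the Busemann function provide ideal points lying
  over points arbitrarily near to any given point of \<open>c\<close> (\<open>end_over_point\<close>), so these cross ratios are dense in
  the real numbers and the group is everything. Translating one transit time from \<open>c\<close> to \<open>d\<close> by this
  group gives the density for arbitrary \<open>d\<close>.
\<close>

section \<open>Stewart's relation in the hyperbolic plane\<close>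

definition cosh_hyp :: "complex \<Rightarrow> complex \<Rightarrow> real" where
  "cosh_hyp z w = ((Re z - Re w)\<^sup>2 + (Im z)\<^sup>2 + (Im w)\<^sup>2) / (2 * Im z * Im w)"

lemma cosh_hyp_dist:
  assumes "Im z > 0" "Im w > 0"
  shows "cosh (hyp_dist z w) = cosh_hyp z w"
proof -
  have "1 + (cmod (z - w))\<^sup>2 / (2 * Im z * Im w) \<ge> 1"
    using assms by simp
  then have "cosh (hyp_dist z w) = 1 + (cmod (z - w))\<^sup>2 / (2 * Im z * Im w)"
    unfolding hyp_dist_def by (rule cosh_arcosh_real)
  also have "(cmod (z - w))\<^sup>2 = (Re z - Re w)\<^sup>2 + (Im z - Im w)\<^sup>2"
    by (simp add: cmod_power2)
  also have "1 + ((Re z - Re w)\<^sup>2 + (Im z - Im w)\<^sup>2) / (2 * Im z * Im w) = cosh_hyp z w"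
    using assms unfolding cosh_hyp_def
    by (simp add: field_simps power2_eq_square)
  finally show ?thesis .
qed

text \<open>The form \<open>A B - C\<^sup>2\<close> is the Lorentz form in three dimensions: a lightlike vector orthogonal to
  a timelike one vanishes.\<close>

lemma isotropic_orthogonal_to_timelike:
  fixes A B C A' B' C' :: real
  assumes "A * B = C\<^sup>2" "A * B' + A' * B = 2 * (C * C')" "A' * B' - C'\<^sup>2 = 1" "B' > 0"
  shows "A = 0 \<and> B = 0 \<and> C = 0"
proof -
  have pos: "A' > 0"
    using assms(3,4) by (smt (verit) zero_le_power2 mult_nonpos_nonneg)
  have "(A * B' - A' * B)\<^sup>2 = (A * B' + A' * B)\<^sup>2 - 4 * (A * B) * (A' * B')"
    by algebra
  also have "\<dots> = 4 * (C\<^sup>2 * C'\<^sup>2) - 4 * C\<^sup>2 * (1 + C'\<^sup>2)"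
    using assms by (simp add: power_mult_distrib)
  also have "\<dots> = - 4 * C\<^sup>2"
    by algebra
  finally have eq: "(A * B' - A' * B)\<^sup>2 = - 4 * C\<^sup>2" .
  have C: "C = 0"
    using eq by (smt (verit) zero_le_power2 zero_eq_power2)
  with eq have "A * B' = A' * B"
    by simp
  moreover from C assms(1) have "A = 0 \<or> B = 0"
    by simp
  ultimately show ?thesis
    using C pos assms(4) by auto
qed

text \<open>In the hyperboloid model the point \<open>m\<close> is the linear combination of \<open>z\<close> and \<open>w\<close> with
  coefficients \<open>sinh t / sinh (s + t)\<close> and \<open>sinh s / sinh (s + t)\<close>, because the difference of the two sides
  is lightlike and orthogonal to \<open>m\<close>; and \<open>cosh_hyp _ r\<close> is linear there.\<close>

lemma hyperbolic_stewart:
  assumes im: "Im z > 0" "Im w > 0" "Im m > 0" "Im r > 0"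
    and zm: "cosh_hyp z m = cosh s" and mw: "cosh_hyp m w = cosh t"
    and zw: "cosh_hyp z w = cosh (s + t)"
  shows "cosh_hyp m r * sinh (s + t) = cosh_hyp z r * sinh t + cosh_hyp w r * sinh s"
proof -
  define p q S where "p = sinh t" and "q = sinh s" and "S = sinh (s + t)"
  define c d where "c = cosh s" and "d = cosh t"
  \<comment> \<open>lightlike coordinates of the hyperboloid\<close>
  define F :: "complex \<Rightarrow> real" where "F = (\<lambda>z. ((Re z)\<^sup>2 + (Im z)\<^sup>2) / Im z)"
  define G :: "complex \<Rightarrow> real" where "G = (\<lambda>z. 1 / Im z)"
  define H :: "complex \<Rightarrow> real" where "H = (\<lambda>z. Re z / Im z)"
  have form: "cosh_hyp u v = (F u * G v + F v * G u) / 2 - H u * H v"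
    if "Im u > 0" "Im v > 0" for u v
    using that unfolding cosh_hyp_def F_def G_def H_def
    by (simp add: field_simps power2_eq_square)
  have norm: "F u * G u - (H u)\<^sup>2 = 1" if "Im u > 0" for u
    using that unfolding F_def G_def H_def by (simp add: field_simps power2_eq_square)
  have S: "S = q * d + c * p"
    unfolding S_def p_def q_def c_def d_def by (simp add: sinh_add)
  have c2: "c\<^sup>2 = 1 + q\<^sup>2" and d2: "d\<^sup>2 = 1 + p\<^sup>2"
    unfolding c_def d_def p_def q_def by (simp_all add: cosh_square_eq)
  have zm': "F z * G m + F m * G z = 2 * c + 2 * (H z * H m)"
    using zm form[OF im(1) im(3)] by (simp add: c_def field_simps)
  have mw': "F m * G w + F w * G m = 2 * d + 2 * (H m * H w)"
    using mw form[OF im(3) im(2)] by (simp add: d_def field_simps)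
  have zw': "F z * G w + F w * G z = 2 * (c * d + q * p) + 2 * (H z * H w)"
    using zw form[OF im(1) im(2)] by (simp add: c_def d_def p_def q_def cosh_add field_simps)
  have nz: "F z * G z = 1 + (H z)\<^sup>2" and nw: "F w * G w = 1 + (H w)\<^sup>2"
    and nm: "F m * G m = 1 + (H m)\<^sup>2"
    using norm im by (metis add.commute diff_eq_eq)+
  define A B C where "A = S * F m - p * F z - q * F w"
    and "B = S * G m - p * G z - q * G w"
    and "C = S * H m - p * H z - q * H w"
  have "A * B - C\<^sup>2 = S\<^sup>2 * (F m * G m - (H m)\<^sup>2) + p\<^sup>2 * (F z * G z - (H z)\<^sup>2)
      + q\<^sup>2 * (F w * G w - (H w)\<^sup>2)
      - S * p * ((F z * G m + F m * G z) - 2 * (H z * H m))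
      - S * q * ((F m * G w + F w * G m) - 2 * (H m * H w))
      + p * q * ((F z * G w + F w * G z) - 2 * (H z * H w))"
    unfolding A_def B_def C_def by algebra
  also have "\<dots> = S\<^sup>2 + p\<^sup>2 + q\<^sup>2 - 2 * S * p * c - 2 * S * q * d + 2 * p * q * (c * d + q * p)"
    unfolding zm' mw' zw' nz nw nm by algebra
  also have "\<dots> = 0"
    unfolding S using c2 d2 by algebra
  finally have 1: "A * B = C\<^sup>2"
    by simp
  have "A * G m + F m * B - 2 * (C * H m) = 2 * S * (F m * G m - (H m)\<^sup>2)
      - p * ((F z * G m + F m * G z) - 2 * (H z * H m))
      - q * ((F m * G w + F w * G m) - 2 * (H m * H w))"
    unfolding A_def B_def C_def by algebra
  also have "\<dots> = 2 * S - 2 * p * c - 2 * q * d"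
    unfolding zm' mw' nm by algebra
  also have "\<dots> = 0"
    unfolding S by algebra
  finally have 2: "A * G m + F m * B = 2 * (C * H m)"
    by simp
  have "A = 0 \<and> B = 0 \<and> C = 0"
    by (rule isotropic_orthogonal_to_timelike[OF 1 2])
      (use norm[OF im(3)] im(3) in \<open>auto simp: G_def\<close>)
  then have lin: "S * F m = p * F z + q * F w" "S * G m = p * G z + q * G w"
      "S * H m = p * H z + q * H w"
    unfolding A_def B_def C_def by auto
  have "cosh_hyp m r * S = ((S * F m) * G r + F r * (S * G m)) / 2 - (S * H m) * H r"
    unfolding form[OF im(3) im(4)] by algebra
  also have "\<dots> = p * ((F z * G r + F r * G z) / 2 - H z * H r)
      + q * ((F w * G r + F r * G w) / 2 - H w * H r)"
    unfolding lin by (simp add: field_simps)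
  also have "\<dots> = cosh_hyp z r * p + cosh_hyp w r * q"
    using form im by simp
  finally show ?thesis
    unfolding S_def p_def q_def by simp
qed

section \<open>Thin triangles via Gromov products\<close>

definition btw :: "'a::metric_space \<Rightarrow> 'a \<Rightarrow> 'a \<Rightarrow> bool" where
  "btw p m q \<longleftrightarrow> dist p m + dist m q = dist p q"

text \<open>Twice the Gromov product of \<open>p\<close> and \<open>q\<close> seen from \<open>m\<close>.\<close>

definition exc :: "'a::metric_space \<Rightarrow> 'a \<Rightarrow> 'a \<Rightarrow> real" where
  "exc p m q = dist p m + dist m q - dist p q"

lemma btw_sym: "btw p m q \<longleftrightarrow> btw q m p"
  unfolding btw_def by (auto simp: dist_commute)

lemma exc_sym: "exc p m q = exc q m p"
  unfolding exc_def by (auto simp: dist_commute)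

lemma exc_nonneg: "exc p m q \<ge> 0"
  unfolding exc_def by (smt (verit) dist_triangle)

lemma exc_split:
  assumes "btw p m q"
  shows "exc y p q = exc y p m + exc y m q"
  using assms unfolding btw_def exc_def by simp

lemma exc_perturb:
  assumes "dist p p' \<le> a" "dist m m' \<le> b" "dist q q' \<le> c"
  shows "exc p' m' q' \<le> exc p m q + 2 * (a + b + c)"
proof -
  have "dist p' m' \<le> dist p m + a + b"
    using assms dist_triangle[of p' m' p] dist_triangle[of p m' m] by (simp add: dist_commute)
  moreover have "dist m' q' \<le> dist m q + b + c"
    using assms dist_triangle[of m' q' m] dist_triangle[of m q' q] by (simp add: dist_commute)
  moreover have "dist p q \<le> dist p' q' + a + c"
    using assms dist_triangle[of p q p'] dist_triangle[of p' q q'] by (simp add: dist_commute)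
  ultimately show ?thesis
    unfolding exc_def by simp
qed

locale cat_minus1 =
  fixes X :: "'a::metric_space itself"
  assumes CAT: "CAT_minus1_space X" and proper: "proper_space X"
begin

lemma segment_ex: "\<exists>c. geodesic_from_to c x (y::'a)"
  using CAT unfolding CAT_minus1_space_def geodesic_space_def by blast

lemma point_at_distance:
  fixes x y :: 'a
  assumes "0 \<le> s" "s \<le> dist x y"
  shows "\<exists>m. btw x m y \<and> dist x m = s"
proof -
  obtain c where c: "geodesic_from_to c x y"
    using segment_ex by blast
  have "dist (c 0) (c s) = \<bar>0 - s\<bar>" "dist (c s) (c (dist x y)) = \<bar>s - dist x y\<bar>"
    using c assms unfolding geodesic_from_to_def geodesic_on_def by (meson atLeastAtMost_iff order_refl order_trans)+
  then show ?thesis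
    using c assms unfolding geodesic_from_to_def btw_def by (intro exI[of _ "c s"]) auto
qed

lemma segment_through:
  fixes p m q :: 'a
  assumes "btw p m q"
  shows "\<exists>c. geodesic_from_to c p q \<and> c (dist p m) = m"
proof -
  obtain c1 where c1: "geodesic_from_to c1 p m"
    using segment_ex by blast
  obtain c2 where c2: "geodesic_from_to c2 m q"
    using segment_ex by blast
  define l l' where "l = dist p m" and "l' = dist m q"
  have L: "dist p q = l + l'" "l \<ge> 0" "l' \<ge> 0"
    using assms unfolding btw_def l_def l'_def by auto
  have g1: "dist (c1 s) (c1 t) = \<bar>s - t\<bar>" if "0 \<le> s" "s \<le> l" "0 \<le> t" "t \<le> l" for s t
    using c1 that unfolding geodesic_from_to_def geodesic_on_def l_def by auto
  have g2: "dist (c2 s) (c2 t) = \<bar>s - t\<bar>" if "0 \<le> s" "s \<le> l'" "0 \<le> t" "t \<le> l'" for s t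
    using c2 that unfolding geodesic_from_to_def geodesic_on_def l'_def by auto
  have e: "c1 0 = p" "c1 l = m" "c2 0 = m" "c2 l' = q"
    using c1 c2 unfolding geodesic_from_to_def l_def l'_def by auto
  define c where "c s = (if s \<le> l then c1 s else c2 (s - l))" for s
  have mixed: "dist (c1 s) (c2 (t - l)) = t - s"
    if "0 \<le> s" "s \<le> l" "l \<le> t" "t \<le> l + l'" for s t
  proof -
    have "dist (c1 s) (c2 (t - l)) \<le> dist (c1 s) m + dist m (c2 (t - l))"
      by (rule dist_triangle)
    also have "\<dots> = t - s"
      using g1[of s l] g2[of 0 "t - l"] that e L by auto
    finally have "dist (c1 s) (c2 (t - l)) \<le> t - s" .
    moreover have "dist p q \<le> dist p (c1 s) + dist (c1 s) (c2 (t - l)) + dist (c2 (t - l)) q"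
      using dist_triangle[of p q "c1 s"] dist_triangle[of "c1 s" q "c2 (t - l)"] by simp
    moreover have "dist p (c1 s) = s" "dist (c2 (t - l)) q = l + l' - t"
      using g1[of 0 s] g2[of "t - l" l'] that e L by auto
    ultimately show ?thesis
      using L by simp
  qed
  have "dist (c s) (c t) = \<bar>s - t\<bar>" if "0 \<le> s" "s \<le> l + l'" "0 \<le> t" "t \<le> l + l'" for s t
    unfolding c_def using g1[of s t] g2[of "s - l" "t - l"] mixed[of s t] mixed[of t s] that
    by (auto simp: dist_commute)
  moreover have "c 0 = p" "c (l + l') = q" "c l = m"
    unfolding c_def using e L by auto
  ultimately show ?thesis
    unfolding geodesic_from_to_def geodesic_on_def L(1) l_def[symmetric]
    by (intro exI[of _ c]) auto
qed

text \<open>Comparison with the hyperbolic triangle turns Stewart's relation into an inequality. This is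
  the form in which the curvature bound is used from here on.\<close>

lemma stewart:
  fixes p m q x :: 'a
  assumes "btw p m q"
  shows "cosh (dist x m) * sinh (dist p q)
      \<le> sinh (dist m q) * cosh (dist x p) + sinh (dist p m) * cosh (dist x q)"
proof -
  obtain \<sigma> where \<sigma>: "geodesic_from_to \<sigma> p q" "\<sigma> (dist p m) = m"
    using segment_through[OF assms] by blast
  obtain \<tau> where \<tau>: "geodesic_from_to \<tau> p x"
    using segment_ex by blast
  obtain \<rho> where \<rho>: "geodesic_from_to \<rho> q x"
    using segment_ex by blast
  obtain p' q' r' \<sigma>' \<tau>' where H: "{p', q', r'} \<subseteq> hyperbolic_plane"
      "hyp_dist p' q' = dist p q" "hyp_dist p' r' = dist p x" "hyp_dist q' r' = dist q x"
      "hyp_geodesic_from_to \<sigma>' p' q'" "hyp_geodesic_from_to \<tau>' p' r'"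
      "\<forall>s\<in>{0..dist p q}. \<forall>t\<in>{0..dist p x}. dist (\<sigma> s) (\<tau> t) \<le> hyp_dist (\<sigma>' s) (\<tau>' t)"
    using CAT \<sigma>(1) \<tau> \<rho> unfolding CAT_minus1_space_def by (metis (no_types, lifting))
  define s t where "s = dist p m" and "t = dist m q"
  have st: "dist p q = s + t" "s \<ge> 0" "t \<ge> 0"
    using assms unfolding btw_def s_def t_def by auto
  define m' where "m' = \<sigma>' s"
  have "m' \<in> hyperbolic_plane"
    using H(2,5) st unfolding hyp_geodesic_from_to_def m'_def by auto
  then have im: "Im p' > 0" "Im q' > 0" "Im r' > 0" "Im m' > 0"
    using H(1) unfolding hyperbolic_plane_def by auto
  have d: "hyp_dist p' m' = s" "hyp_dist m' q' = t"
  proof -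
    have 0: "\<forall>u\<in>{0..s + t}. \<forall>v\<in>{0..s + t}. hyp_dist (\<sigma>' u) (\<sigma>' v) = \<bar>u - v\<bar>"
      "\<sigma>' 0 = p'" "\<sigma>' (s + t) = q'"
      using H(2,5) st unfolding hyp_geodesic_from_to_def by auto
    then have "hyp_dist (\<sigma>' 0) (\<sigma>' s) = \<bar>0 - s\<bar>" "hyp_dist (\<sigma>' s) (\<sigma>' (s + t)) = \<bar>s - (s + t)\<bar>"
      using st by auto
    with 0 show "hyp_dist p' m' = s" "hyp_dist m' q' = t"
      using st unfolding m'_def by auto
  qed
  have \<tau>r: "\<tau>' (dist p x) = r'" "\<tau> (dist p x) = x"
    using H(3,6) \<tau> unfolding hyp_geodesic_from_to_def geodesic_from_to_def by auto
  have "dist (\<sigma> s) (\<tau> (dist p x)) \<le> hyp_dist (\<sigma>' s) (\<tau>' (dist p x))"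
    using H(7) st by auto
  then have "dist x m \<le> hyp_dist m' r'"
    using \<tau>r \<sigma>(2) unfolding m'_def s_def by (simp add: dist_commute)
  then have "cosh (dist x m) \<le> cosh (hyp_dist m' r')"
    using cosh_real_nonneg_le_iff by (meson order_trans zero_le_dist)
  also have "\<dots> = cosh_hyp m' r'"
    using cosh_hyp_dist im by blast
  finally have "cosh (dist x m) * sinh (s + t) \<le> cosh_hyp m' r' * sinh (s + t)"
    using st by (intro mult_right_mono) auto
  also have "\<dots> = cosh_hyp p' r' * sinh t + cosh_hyp q' r' * sinh s"
    by (rule hyperbolic_stewart)
      (use im d H(2) st in \<open>auto simp flip: cosh_hyp_dist\<close>)
  also have "\<dots> = sinh t * cosh (dist x p) + sinh s * cosh (dist x q)"
    using im H(3,4) by (simp flip: cosh_hyp_dist add: dist_commute)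
  finally show ?thesis
    unfolding st(1) s_def t_def .
qed

end

text \<open>If the distance from a point grows at almost unit speed along a segment of length \<open>l\<close>, then
  convexity in the sense of \<open>u'' \<ge> u\<close> makes it keep growing, up to an error that is exponentially small
  in \<open>l\<close>: the solution of \<open>u'' = u\<close> with the same values at the ends of the first segment is dominated by its
  growing exponential.\<close>

lemma cosh_growth:
  fixes M l l' A Q k \<epsilon> :: real
  assumes st: "cosh M * sinh (l + l') \<le> sinh l' * cosh A + sinh l * cosh Q"
    and nn: "0 \<le> A" "0 \<le> Q" "0 \<le> l'" "0 \<le> k" "0 < \<epsilon>"
    and A: "A \<le> M - l + k" and l: "k + 1 \<le> l" "exp k / (1 - exp (- \<epsilon>)) < l"
  shows "M + l' - \<epsilon> \<le> Q"
proof (rule ccontr)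
  assume "\<not> M + l' - \<epsilon> \<le> Q"
  then have Q: "Q \<le> M + l' - \<epsilon>"
    by simp
  define u \<delta> where "u = M + l'" and "\<delta> = 1 - exp (- \<epsilon>)"
  have \<delta>: "\<delta> > 0" "\<delta> < 1"
    using nn unfolding \<delta>_def by auto
  have u: "u \<ge> 1" "u - \<epsilon> \<ge> 0"
    using A nn l Q unfolding u_def by auto
  have sl: "sinh l > 0" and sl': "sinh l' \<ge> 0"
    using l nn by auto
  have id: "cosh M * sinh (l + l') = sinh l' * cosh (M - l) + sinh l * cosh (M + l')"
    by (simp add: sinh_add cosh_add cosh_diff) (simp add: algebra_simps)
  have cA: "cosh A \<le> cosh (M - l + k)"
    using A nn by (subst cosh_real_nonneg_le_iff) auto
  have cQ: "cosh Q \<le> cosh (u - \<epsilon>)"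
    using Q nn u unfolding u_def by (subst cosh_real_nonneg_le_iff) auto
  have main: "sinh l * (cosh u - cosh (u - \<epsilon>)) \<le> sinh l' * (cosh (M - l + k) - cosh (M - l))"
    using st mult_left_mono[OF cA sl'] mult_left_mono[OF cQ less_imp_le[OF sl]]
    unfolding id u_def by (simp add: algebra_simps)
  have "exp u \<ge> 2"
    using exp_ge_add_one_self[of u] u by linarith
  have e: "exp (u - \<epsilon>) = exp u * exp (- \<epsilon>)" "exp (- u) = exp (\<epsilon> - u) * exp (- \<epsilon>)"
    by (simp_all flip: exp_add)
  have "cosh u - cosh (u - \<epsilon>) = \<delta> * (exp u - exp (\<epsilon> - u)) / 2"
    unfolding \<delta>_def cosh_def minus_diff_eq e by (simp add: algebra_simps)
  moreover have "exp (\<epsilon> - u) \<le> 1"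
    using u by simp
  then have "exp u - exp (\<epsilon> - u) \<ge> exp u / 2"
    using \<open>exp u \<ge> 2\<close> by linarith
  then have "\<delta> * (exp u / 2) \<le> \<delta> * (exp u - exp (\<epsilon> - u))"
    using \<delta> by (intro mult_left_mono) auto
  ultimately have 1: "\<delta> * exp u / 4 \<le> cosh u - cosh (u - \<epsilon>)"
    by simp
  have "sinh l' \<le> exp l' / 2"
    unfolding sinh_def by simp
  moreover have "cosh (M - l + k) - cosh (M - l) \<le> exp (M - l + k) / 2"
  proof -
    have "exp (- (M - l + k)) \<le> exp (- (M - l))"
      using nn by simp
    moreover have "(x + a) / 2 - (c + b) / 2 \<le> x / 2" if "a \<le> b" "0 < c" for a b c x :: real
      using that by (simp add: field_simps)
    ultimately show ?thesis
      unfolding cosh_field_def using exp_gt_zero by blast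
  qed
  ultimately have "sinh l' * (cosh (M - l + k) - cosh (M - l)) \<le> exp l' / 2 * (exp (M - l + k) / 2)"
    using sl' by (meson exp_ge_zero divide_nonneg_pos mult_left_mono mult_right_mono order_trans zero_less_numeral)
  also have "\<dots> = exp (u - l + k) / 4"
    unfolding u_def by (simp add: algebra_simps flip: exp_add)
  finally have 2: "sinh l * (cosh u - cosh (u - \<epsilon>)) \<le> exp (u - l + k) / 4"
    using main by simp
  have "sinh l * (\<delta> * exp u / 4) \<le> sinh l * (cosh u - cosh (u - \<epsilon>))"
    using 1 sl by (intro mult_left_mono) auto
  with 2 have "sinh l * \<delta> * exp u \<le> exp (u - l + k)"
    by simp
  then have "sinh l * \<delta> * exp u * exp (l - u) \<le> exp (u - l + k) * exp (l - u)"
    by (intro mult_right_mono) auto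
  then have 3: "sinh l * exp l * \<delta> \<le> exp k"
    by (simp add: mult.assoc flip: exp_add) (simp add: algebra_simps)
  have "sinh l * exp l = (exp (2 * l) - 1) / 2"
    unfolding sinh_def by (simp add: field_simps flip: exp_add)
  moreover have "l \<le> x" if "x = (y - 1) / 2" "1 + 2 * l \<le> y" for x y :: real
    using that by simp
  ultimately have "sinh l * exp l \<ge> l"
    using exp_ge_add_one_self[of "2 * l"] by blast
  then have "l * \<delta> \<le> exp k"
    using 3 \<delta> by (meson mult_right_mono less_imp_le order_trans)
  with l(2) \<delta> show False
    unfolding \<delta>_def[symmetric] by (simp add: field_simps)
qed

text \<open>A bound for the distance from a segment, of length at least 1, of a point whose distances to the
  endpoints exceed those of a point of the segment by at most \<open>k\<close>.\<close>

definition fat :: "real \<Rightarrow> real" where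
  "fat k = arcosh (cosh k + 2 * sinh k)"

lemma cosh_fat:
  assumes "k \<ge> 0"
  shows "cosh (fat k) = cosh k + 2 * sinh k" and fat_nonneg: "fat k \<ge> 0"
proof -
  have 1: "cosh k + 2 * sinh k \<ge> 1"
    using assms cosh_real_ge_1[of k] by (smt (verit) sinh_real_nonneg_iff)
  then show "cosh (fat k) = cosh k + 2 * sinh k" "fat k \<ge> 0"
    unfolding fat_def by (auto simp: cosh_arcosh_real)
qed

lemma fat_small:
  assumes "\<epsilon> > 0"
  shows "\<exists>k>0. fat k \<le> \<epsilon>"
proof -
  have "((\<lambda>k::real. cosh k + 2 * sinh k) \<longlongrightarrow> cosh 0 + 2 * sinh 0) (at_right 0)"
    by (intro tendsto_intros)
  moreover have "cosh 0 + 2 * sinh 0 < cosh \<epsilon>"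
    using assms cosh_real_strict_mono[of 0 \<epsilon>] by simp
  ultimately have "eventually (\<lambda>k::real. cosh k + 2 * sinh k < cosh \<epsilon>) (at_right 0)"
    by (rule order_tendstoD)
  then have "eventually (\<lambda>k::real. cosh k + 2 * sinh k < cosh \<epsilon> \<and> k > 0) (at_right 0)"
    using eventually_at_right_less by eventually_elim auto
  then obtain k :: real where k: "cosh k + 2 * sinh k < cosh \<epsilon>" "k > 0"
    using eventually_happens' trivial_limit_at_right_real by blast
  then have "cosh (fat k) \<le> cosh \<epsilon>" "fat k \<ge> 0"
    using cosh_fat[of k] by auto
  then show ?thesis
    using k assms cosh_real_nonneg_le_iff[of "fat k" \<epsilon>] by auto
qed

context cat_minus1
begin

lemma exc_decay:
  assumes "k \<ge> 0" "\<epsilon> > 0"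
  obtains R where "R > 0"
    "\<And>y p m q::'a. btw p m q \<Longrightarrow> exc y p m \<le> k \<Longrightarrow> dist p m \<ge> R \<Longrightarrow> exc y m q \<le> \<epsilon>"
proof -
  define R where "R = max (k + 1) (exp k / (1 - exp (- \<epsilon>)) + 1)"
  have "exc y m q \<le> \<epsilon>" if "btw p m q" "exc y p m \<le> k" "dist p m \<ge> R" for y p m q :: 'a
  proof -
    have "dist y m + dist m q - \<epsilon> \<le> dist y q"
    proof (rule cosh_growth)
      show "cosh (dist y m) * sinh (dist p m + dist m q)
          \<le> sinh (dist m q) * cosh (dist y p) + sinh (dist p m) * cosh (dist y q)"
        using stewart[OF that(1), of y] that(1) unfolding btw_def by simp
      show "dist y p \<le> dist y m - dist p m + k"
        using that unfolding exc_def by simp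
    qed (use that assms in \<open>auto simp: R_def\<close>)
    then show ?thesis
      unfolding exc_def by simp
  qed
  then show thesis
    using that[of R] assms unfolding R_def by auto
qed

lemma dist_segment_le_fat:
  fixes x y m z :: 'a
  assumes "btw y m z" "dist y z \<ge> 1" "k \<ge> 0"
    and "dist x y \<le> dist y m + k" "dist x z \<le> dist m z + k"
  shows "dist x m \<le> fat k"
proof -
  define s t a where "s = dist y m" and "t = dist m z" and "a = dist y z"
  have st: "a = s + t" "s \<ge> 0" "t \<ge> 0" "a \<ge> 1"
    using assms unfolding btw_def s_def t_def a_def by auto
  have c1: "cosh (dist x y) \<le> cosh (s + k)" and c2: "cosh (dist x z) \<le> cosh (t + k)"
    using assms st unfolding s_def t_def by (subst cosh_real_nonneg_le_iff; auto)+
  have "cosh (dist x m) * sinh a \<le> sinh t * cosh (dist x y) + sinh s * cosh (dist x z)"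
    using stewart[OF assms(1), of x] unfolding s_def t_def a_def .
  also have "\<dots> \<le> sinh t * cosh (s + k) + sinh s * cosh (t + k)"
    using c1 c2 st by (intro add_mono mult_left_mono) auto
  also have "\<dots> = sinh (a + k) - cosh (s - t) * sinh k"
    unfolding st(1) by (simp add: sinh_add cosh_add cosh_diff)
      (simp add: algebra_simps)
  also have "\<dots> \<le> sinh (a + k)"
    using assms by (simp add: cosh_real_nonneg)
  also have "\<dots> = sinh a * cosh k + cosh a * sinh k"
    by (simp add: sinh_add)
  also have "\<dots> \<le> sinh a * cosh k + (2 * sinh a) * sinh k"
  proof -
    have "exp a \<ge> 2"
      using exp_ge_add_one_self[of a] st by linarith
    moreover have "exp (- a) \<le> 1 / 2"
      using \<open>exp a \<ge> 2\<close> by (simp add: exp_minus field_simps)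
    ultimately have "cosh a \<le> 2 * sinh a"
      unfolding cosh_def sinh_def by simp
    then show ?thesis
      using assms by (intro add_left_mono mult_right_mono) auto
  qed
  also have "\<dots> = (cosh k + 2 * sinh k) * sinh a"
    by algebra
  finally have "cosh (dist x m) * sinh a \<le> (cosh k + 2 * sinh k) * sinh a" .
  then have "cosh (dist x m) \<le> cosh (fat k)"
    using st cosh_fat[OF assms(3)] by simp
  then show ?thesis
    using cosh_real_nonneg_le_iff[of "dist x m" "fat k"] cosh_fat[OF assms(3)] by auto
qed

lemma dist_segment_le_fat_exc:
  fixes x y m z :: 'a
  assumes "btw y m z" "dist y z \<ge> 1" "exc y x z \<le> k" "\<bar>dist y m - dist y x\<bar> \<le> k"
  shows "dist x m \<le> fat (2 * k)"
proof (rule dist_segment_le_fat[OF assms(1,2)])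
  show "dist x z \<le> dist m z + 2 * k"
    using assms unfolding btw_def exc_def by (auto simp: dist_commute)
qed (use assms exc_nonneg[of y x z] in \<open>auto simp: dist_commute\<close>)

text \<open>The excess at \<open>m\<close> with respect to \<open>y\<close> and \<open>q\<close> is small by \<open>exc_decay\<close>. The same lemma, seen from
  \<open>z\<close>, shows that the segments from \<open>m\<close> to \<open>q\<close> and to \<open>z\<close> are close to each other half way
  to \<open>q\<close>, and once more it carries the estimate along the segment to \<open>z\<close>.\<close>

lemma exc_local_to_global:
  assumes k: "k \<ge> 0" and "\<epsilon> > 0"
  obtains R where "R > 0"
    "\<And>y p m q z::'a. btw p m q \<Longrightarrow> exc y p m \<le> k \<Longrightarrow> exc m q z \<le> k \<Longrightarrow>
       dist p m \<ge> R \<Longrightarrow> dist m q \<ge> R \<Longrightarrow> exc y m z \<le> \<epsilon>"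
proof -
  define \<eta> where "\<eta> = min (\<epsilon> / 8) (1 / 8)"
  have \<eta>: "\<eta> > 0" "8 * \<eta> \<le> \<epsilon>" "8 * \<eta> \<le> 1"
    using assms unfolding \<eta>_def by auto
  obtain \<kappa> where \<kappa>: "\<kappa> > 0" "fat \<kappa> \<le> \<eta>"
    using fat_small \<eta> by blast
  define \<theta> where "\<theta> = min (\<kappa> / 2) \<eta>"
  have \<theta>: "\<theta> > 0" "2 * \<theta> \<le> \<kappa>" "\<theta> \<le> \<eta>"
    using \<kappa> \<eta> unfolding \<theta>_def by auto
  obtain R1 where R1: "R1 > 0"
    "\<And>y p m q::'a. btw p m q \<Longrightarrow> exc y p m \<le> k \<Longrightarrow> dist p m \<ge> R1 \<Longrightarrow> exc y m q \<le> \<theta>"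
    using exc_decay[OF k \<theta>(1)] by blast
  obtain R2 where R2: "R2 > 0"
    "\<And>y p m q::'a. btw p m q \<Longrightarrow> exc y p m \<le> 1 \<Longrightarrow> dist p m \<ge> R2 \<Longrightarrow> exc y m q \<le> \<eta>"
    using exc_decay[of 1 \<eta>] \<eta> by auto
  define R where "R = 2 * (R1 + R2 + k + 1)"
  have "exc y m z \<le> \<epsilon>"
    if h: "btw p m q" "exc y p m \<le> k" "exc m q z \<le> k" "dist p m \<ge> R" "dist m q \<ge> R"
    for y p m q z :: 'a
  proof -
    define l where "l = dist m q / 2"
    have l: "l \<ge> R1" "l \<ge> R2" "l \<ge> k + 1" "dist m q = 2 * l" "dist p m \<ge> R1"
      using h(4,5) R1(1) R2(1) k unfolding l_def R_def by (simp_all add: algebra_simps)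
    \<comment> \<open>\<open>q1\<close> is half way to \<open>q\<close>, and \<open>q2\<close> is the corresponding point on the way to \<open>z\<close>\<close>
    obtain q1 where q1: "btw m q1 q" "dist m q1 = l"
      using point_at_distance[of l m q] l k by auto
    have q1q: "dist q1 q = l"
      using q1 l unfolding btw_def by simp
    have mz: "dist m z \<ge> 2 * l - k"
      using h(3) l unfolding exc_def by (smt (verit) zero_le_dist)
    obtain q2 where q2: "btw m q2 z" "dist m q2 = l"
      using point_at_distance[of l m z] l mz k by auto
    have "exc z q q1 \<le> k"
      using exc_split[of q q1 m z] q1(1) h(3) exc_nonneg[of z q1 m]
      by (simp add: btw_sym exc_sym)
    then have "exc z q1 m \<le> \<theta>"
      using R1(2)[of q q1 m z] q1 q1q l by (simp add: btw_sym dist_commute)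
    then have "exc m q1 z \<le> \<theta>"
      by (simp add: exc_sym)
    then have "dist q1 q2 \<le> fat (2 * (\<kappa> / 2))"
      using \<theta> \<kappa> q1 q2 mz l k by (intro dist_segment_le_fat_exc[of m q2 z q1]) auto
    then have qq: "dist q1 q2 \<le> \<eta>"
      using \<kappa> by simp
    have "exc y m q \<le> \<theta>"
      using R1(2)[OF h(1,2)] l by simp
    then have "exc y m q1 \<le> \<theta>"
      using exc_split[OF q1(1), of y] exc_nonneg[of y q1 q] by simp
    then have e1: "exc y m q2 \<le> 3 * \<eta>"
      using exc_perturb[of y y 0 m m 0 q1 q2 \<eta>] qq \<theta> by simp
    then have "exc y q2 z \<le> \<eta>"
      using R2(2)[OF q2(1), of y] q2(2) l \<eta> by simp
    then have "exc y m z \<le> 4 * \<eta>"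
      using exc_split[OF q2(1), of y] e1 by simp
    then show ?thesis
      using \<eta> by simp
  qed
  moreover have "R > 0"
    using R1 R2 k unfolding R_def by simp
  ultimately show thesis
    using that by blast
qed

end

section \<open>Rays, Busemann functions and horospherical distance\<close>

definition past :: "(real \<Rightarrow> 'a) \<Rightarrow> real \<Rightarrow> 'a" where
  "past g = (\<lambda>t. g (- t))"

lemma past_apply: "past g t = g (- t)"
  unfolding past_def ..

lemma ray_dist: "r \<in> geodesic_rays \<Longrightarrow> 0 \<le> s \<Longrightarrow> 0 \<le> t \<Longrightarrow> dist (r s) (r t) = \<bar>s - t\<bar>"
  unfolding geodesic_rays_def geodesic_on_def by auto

lemma line_dist: "g \<in> GX \<Longrightarrow> dist (g s) (g t) = \<bar>s - t\<bar>"
  unfolding GX_def geodesic_on_def by auto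

lemma GX_I: "(\<And>s t. dist (g s) (g t) = \<bar>s - t\<bar>) \<Longrightarrow> g \<in> GX"
  unfolding GX_def geodesic_on_def by auto

lemma line_ray: "g \<in> GX \<Longrightarrow> g \<in> geodesic_rays"
  unfolding GX_def geodesic_rays_def geodesic_on_def by auto

lemma past_line: "g \<in> GX \<Longrightarrow> past g \<in> GX"
  by (rule GX_I) (simp add: past_apply line_dist)

lemma flow_line: "g \<in> GX \<Longrightarrow> flow_GX t g \<in> GX"
  by (rule GX_I) (simp add: flow_GX_def line_dist)

lemma isometry_line: "g \<in> GX \<Longrightarrow> (\<And>x y. dist (\<gamma> x) (\<gamma> y) = dist x y) \<Longrightarrow> \<gamma> \<circ> g \<in> GX"
  by (rule GX_I) (simp add: line_dist)

lemma isometry_ray: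
  "r \<in> geodesic_rays \<Longrightarrow> (\<And>x y. dist (\<gamma> x) (\<gamma> y) = dist x y) \<Longrightarrow> \<gamma> \<circ> r \<in> geodesic_rays"
  unfolding geodesic_rays_def geodesic_on_def by auto

lemma ray_btw:
  "r \<in> geodesic_rays \<Longrightarrow> 0 \<le> s \<Longrightarrow> s \<le> t \<Longrightarrow> t \<le> u \<Longrightarrow> btw (r s) (r t) (r u)"
  unfolding btw_def by (simp add: ray_dist)

lemma line_btw: "g \<in> GX \<Longrightarrow> s \<le> t \<Longrightarrow> t \<le> u \<Longrightarrow> btw (g s) (g t) (g u)"
  unfolding btw_def by (simp add: line_dist)

lemma exc_le_dist: "exc p m q \<le> 2 * dist p m"
  unfolding exc_def using dist_triangle[of m q p] by (simp add: dist_commute)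

text \<open>The function under the infimum is nonincreasing for a ray \<open>r\<close>, so this is its limit as
  \<open>t\<close> tends to infinity; it vanishes at \<open>r 0\<close>.\<close>

definition busemann :: "(real \<Rightarrow> 'a::metric_space) \<Rightarrow> 'a \<Rightarrow> real" where
  "busemann r x = Inf ((\<lambda>t. dist x (r t) - t) ` {0..})"

lemma busemann_antimono:
  "r \<in> geodesic_rays \<Longrightarrow> 0 \<le> s \<Longrightarrow> s \<le> t \<Longrightarrow> dist x (r t) - t \<le> dist x (r s) - s"
  using dist_triangle[of x "r t" "r s"] by (simp add: ray_dist)

lemma busemann_bdd_below:
  assumes "r \<in> geodesic_rays"
  shows "bdd_below ((\<lambda>t. dist x (r t) - t) ` {0..})"
proof (rule bdd_belowI2)
  fix t :: real assume "t \<in> {0..}"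
  then show "- dist x (r 0) \<le> dist x (r t) - t"
    using dist_triangle[of "r 0" "r t" x] by (simp add: ray_dist[OF assms] dist_commute)
qed

lemma busemann_le:
  "r \<in> geodesic_rays \<Longrightarrow> 0 \<le> t \<Longrightarrow> busemann r x \<le> dist x (r t) - t"
  unfolding busemann_def by (rule cINF_lower) (auto intro: busemann_bdd_below)

lemma busemann_approx:
  assumes r: "r \<in> geodesic_rays" and "\<epsilon> > 0"
  obtains T where "T \<ge> 0" "\<And>t. t \<ge> T \<Longrightarrow> dist x (r t) - t \<le> busemann r x + \<epsilon>"
proof -
  have "\<exists>T\<in>{0..}. dist x (r T) - T < busemann r x + \<epsilon>"
    unfolding busemann_def
    by (subst cINF_less_iff[symmetric]) (use assms busemann_bdd_below[OF r] in auto)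
  then obtain T where "T \<ge> 0" "dist x (r T) - T < busemann r x + \<epsilon>"
    by auto
  then show thesis
    using that[of T] busemann_antimono[OF r] by (meson less_imp_le order_trans)
qed

lemma busemann_ge:
  assumes r: "r \<in> geodesic_rays" and c: "\<And>t. t \<ge> T \<Longrightarrow> c \<le> dist x (r t) - t"
  shows "c \<le> busemann r x"
  unfolding busemann_def
proof (rule cINF_greatest)
  fix t :: real assume "t \<in> {0..}"
  then show "c \<le> dist x (r t) - t"
    using c[of "max t T"] busemann_antimono[OF r, of t "max t T" x] by simp
qed simp

lemma busemann_lipschitz:
  assumes r: "r \<in> geodesic_rays"
  shows "busemann r x \<le> busemann r y + dist x y"
proof -
  have "busemann r x - dist x y \<le> busemann r y"
  proof (rule busemann_ge[OF r])
    fix t :: real assume "t \<ge> 0"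
    then show "busemann r x - dist x y \<le> dist y (r t) - t"
      using busemann_le[OF r, of t x] dist_triangle[of x "r t" y] by simp
  qed
  then show ?thesis by simp
qed

lemma busemann_line:
  assumes "g \<in> GX"
  shows "busemann g (g s) = - s"
proof (rule antisym)
  show "busemann g (g s) \<le> - s"
    using busemann_le[OF line_ray[OF assms], of "\<bar>s\<bar>" "g s"] by (simp add: line_dist[OF assms])
  show "- s \<le> busemann g (g s)"
    by (rule busemann_ge[OF line_ray[OF assms], of 0]) (simp add: line_dist[OF assms])
qed

lemma busemann_past: "g \<in> GX \<Longrightarrow> busemann (past g) (g s) = s"
  using busemann_line[OF past_line, of g "- s"] by (simp add: past_apply)

text \<open>The rays end in different ideal points. The bound \<open>K\<close> makes the horospherical distance below
  finite.\<close>

definition sep :: "(real \<Rightarrow> 'a::metric_space) \<Rightarrow> (real \<Rightarrow> 'a) \<Rightarrow> bool" where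
  "sep e r \<longleftrightarrow> (\<exists>K. \<forall>s\<ge>0. \<forall>t\<ge>0. s + t - K \<le> dist (e s) (r t))"

text \<open>The signed distance between the horosphere at the end of \<open>e\<close> through \<open>e 0\<close> and the horosphere at
  the end of \<open>r\<close> through \<open>r 0\<close>, negative if the horoballs overlap. As for Busemann functions,
  the infimum is a limit.\<close>

definition horo :: "(real \<Rightarrow> 'a::metric_space) \<Rightarrow> (real \<Rightarrow> 'a) \<Rightarrow> real" where
  "horo e r = Inf ((\<lambda>t. dist (e t) (r t) - 2 * t) ` {0..})"

lemma sep_sym: "sep e r \<longleftrightarrow> sep r e"
  unfolding sep_def by (metis add.commute dist_commute)

lemma horo_sym: "horo e r = horo r e"
  unfolding horo_def by (simp add: dist_commute)

lemma sep_isometry: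
  assumes "\<And>x y. dist (\<gamma> x) (\<gamma> y) = dist x y"
  shows "sep (\<gamma> \<circ> e) (\<gamma> \<circ> r) \<longleftrightarrow> sep e r" "horo (\<gamma> \<circ> e) (\<gamma> \<circ> r) = horo e r"
  unfolding sep_def horo_def using assms by simp_all

lemma horo_antimono:
  assumes "e \<in> geodesic_rays" "r \<in> geodesic_rays" "0 \<le> s" "s \<le> s'" "0 \<le> t" "t \<le> t'"
  shows "dist (e s') (r t') - s' - t' \<le> dist (e s) (r t) - s - t"
proof -
  have "dist (e s') (r t') \<le> dist (e s') (e s) + dist (e s) (r t) + dist (r t) (r t')"
    using dist_triangle[of "e s'" "r t'" "e s"] dist_triangle[of "e s" "r t'" "r t"] by simp
  then show ?thesis
    using assms by (simp add: ray_dist)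
qed

lemma horo_bdd_below:
  assumes "sep e r"
  shows "bdd_below ((\<lambda>t. dist (e t) (r t) - 2 * t) ` {0..})"
proof -
  obtain K where "\<And>s t. s \<ge> 0 \<Longrightarrow> t \<ge> 0 \<Longrightarrow> s + t - K \<le> dist (e s) (r t)"
    using assms unfolding sep_def by blast
  then show ?thesis
    by (intro bdd_belowI2[of _ "- K"]) (force simp: algebra_simps)
qed

lemma horo_le:
  assumes er: "e \<in> geodesic_rays" "r \<in> geodesic_rays" "sep e r" and st: "0 \<le> s" "0 \<le> t"
  shows "horo e r \<le> dist (e s) (r t) - s - t"
proof -
  define u where "u = max s t"
  have "horo e r \<le> dist (e u) (r u) - 2 * u"
    unfolding horo_def by (rule cINF_lower) (use st er horo_bdd_below in \<open>auto simp: u_def\<close>)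
  also have "\<dots> \<le> dist (e s) (r t) - s - t"
    using horo_antimono[of e r s u t u] er st unfolding u_def by simp
  finally show ?thesis .
qed

lemma horo_approx:
  assumes er: "e \<in> geodesic_rays" "r \<in> geodesic_rays" "sep e r" and "\<epsilon> > 0"
  obtains S where "S \<ge> 0" "\<And>s t. s \<ge> S \<Longrightarrow> t \<ge> S \<Longrightarrow> dist (e s) (r t) - s - t \<le> horo e r + \<epsilon>"
proof -
  have "\<exists>S\<in>{0..}. dist (e S) (r S) - 2 * S < horo e r + \<epsilon>"
    unfolding horo_def
    by (subst cINF_less_iff[symmetric]) (use assms horo_bdd_below[OF er(3)] in auto)
  then obtain S where S: "S \<ge> 0" "dist (e S) (r S) - 2 * S < horo e r + \<epsilon>"
    by auto
  have "dist (e s) (r t) - s - t \<le> horo e r + \<epsilon>" if "s \<ge> S" "t \<ge> S" for s t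
    using horo_antimono[OF er(1,2), of S s S t] that S by simp
  with S show thesis
    using that by blast
qed

lemma horo_ge:
  assumes er: "e \<in> geodesic_rays" "r \<in> geodesic_rays"
    and c: "\<And>t. t \<ge> S \<Longrightarrow> c \<le> dist (e t) (r t) - 2 * t"
  shows "c \<le> horo e r"
  unfolding horo_def
proof (rule cINF_greatest)
  fix t :: real assume "t \<in> {0..}"
  then show "c \<le> dist (e t) (r t) - 2 * t"
    using c[of "max t S"] horo_antimono[OF er, of t "max t S" t "max t S"] by simp
qed simp

lemma horo_le_busemann:
  assumes er: "e \<in> geodesic_rays" "r \<in> geodesic_rays" "sep e r"
  shows "horo e r \<le> busemann e x + busemann r x"
proof -
  have "horo e r - busemann r x \<le> busemann e x"
  proof (rule busemann_ge[OF er(1), of 0])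
    fix s :: real assume s: "s \<ge> 0"
    have "horo e r - (dist x (e s) - s) \<le> busemann r x"
    proof (rule busemann_ge[OF er(2), of 0])
      fix t :: real assume t: "t \<ge> 0"
      show "horo e r - (dist x (e s) - s) \<le> dist x (r t) - t"
        using horo_le[OF er s t] dist_triangle[of "e s" "r t" x] by (simp add: dist_commute)
    qed
    then show "horo e r - busemann r x \<le> dist x (e s) - s"
      by simp
  qed
  then show ?thesis by simp
qed

lemma sep_tail:
  assumes er: "e \<in> geodesic_rays" "r \<in> geodesic_rays" and S: "S \<ge> 0"
    and h: "\<And>s t. s \<ge> S \<Longrightarrow> t \<ge> S \<Longrightarrow> s + t - K \<le> dist (e s) (r t)"
  shows "sep e r"
  unfolding sep_def
proof (intro exI allI impI)
  fix s t :: real assume st: "0 \<le> s" "0 \<le> t"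
  show "s + t - K \<le> dist (e s) (r t)"
    using horo_antimono[OF er, of s "s + S" t "t + S"] h[of "s + S" "t + S"] st S by simp
qed

text \<open>If \<open>m\<close> almost lies on the geodesics between far points of \<open>l\<close> and \<open>h\<close>, the
  distance of the horospheres can be measured at \<open>m\<close>. In this way the horospherical distances
  of different pairs of ends are compared below.\<close>

lemma horo_split:
  assumes lh: "l \<in> geodesic_rays" "h \<in> geodesic_rays" and S: "S \<ge> 0"
    and ex: "\<And>s t. s \<ge> S \<Longrightarrow> t \<ge> S \<Longrightarrow> exc (l s) m (h t) \<le> \<epsilon>"
  shows "sep l h" "horo l h \<le> busemann l m + busemann h m"
    "busemann l m + busemann h m - \<epsilon> \<le> horo l h"
proof -
  have low: "busemann l m + busemann h m - \<epsilon> \<le> dist (l s) (h t) - s - t" if "s \<ge> S" "t \<ge> S" for s t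
    using ex[OF that] busemann_le[OF lh(1), of s m] busemann_le[OF lh(2), of t m] that S
    unfolding exc_def by (simp add: dist_commute)
  show "sep l h"
    by (rule sep_tail[OF lh S, of "- (busemann l m + busemann h m - \<epsilon>)"]) (use low in force)
  then show "horo l h \<le> busemann l m + busemann h m"
    by (rule horo_le_busemann[OF lh])
  show "busemann l m + busemann h m - \<epsilon> \<le> horo l h"
    by (rule horo_ge[OF lh, of S]) (use low in force)
qed

lemma exc_ray_le:
  assumes lh: "l \<in> geodesic_rays" "h \<in> geodesic_rays" "sep l h" and st: "s \<ge> 0" "t \<ge> 0"
  shows "exc (l s) (h 0) (h t) \<le> dist (l 0) (h 0) - horo l h"
  using horo_le[OF lh st] dist_triangle[of "l s" "h 0" "l 0"] ray_dist[OF lh(1) st(1), of 0]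
    ray_dist[OF lh(2) _ st(2), of 0] st
  unfolding exc_def by simp

lemma sep_line: "g \<in> GX \<Longrightarrow> sep (past g) g"
  unfolding sep_def by (intro exI[of _ 0]) (auto simp: past_apply line_dist)

lemma horo_line:
  assumes "g \<in> GX"
  shows "horo (past g) g = 0"
proof (rule antisym)
  show "horo (past g) g \<le> 0"
    using horo_le[OF line_ray[OF past_line[OF assms]] line_ray[OF assms] sep_line[OF assms], of 0 0]
    by (simp add: past_apply)
  show "0 \<le> horo (past g) g"
    by (rule horo_ge[OF line_ray[OF past_line[OF assms]] line_ray[OF assms], of 0])
      (simp add: past_apply line_dist[OF assms])
qed

lemma sep_asymptotic:
  assumes er: "e \<in> geodesic_rays" "r \<in> geodesic_rays" "e' \<in> geodesic_rays" and "sep e r"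
    and B: "\<And>t. t \<ge> T \<Longrightarrow> dist (e t) (e' t) \<le> B"
  shows "sep e' r"
proof -
  obtain K where K: "\<And>s t. s \<ge> 0 \<Longrightarrow> t \<ge> 0 \<Longrightarrow> s + t - K \<le> dist (e s) (r t)"
    using assms(4) unfolding sep_def by blast
  show ?thesis
  proof (rule sep_tail[OF er(3,2), of "max 0 T" "K + B"])
    fix s t assume "max 0 T \<le> s" "max 0 T \<le> t"
    then show "s + t - (K + B) \<le> dist (e' s) (r t)"
      using K[of s t] B[of s] dist_triangle[of "e s" "r t" "e' s"] by simp
  qed simp
qed

lemma horo_asymptotic:
  assumes er: "e \<in> geodesic_rays" "r \<in> geodesic_rays" "e' \<in> geodesic_rays" and "sep e r"
    and B: "\<And>\<epsilon>. \<epsilon> > 0 \<Longrightarrow> \<exists>T. \<forall>t\<ge>T. dist (e t) (e' t) \<le> \<epsilon>"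
  shows "horo e r \<le> horo e' r"
proof (rule field_le_epsilon)
  fix \<epsilon> :: real assume "\<epsilon> > 0"
  then obtain T where T: "\<And>t. t \<ge> T \<Longrightarrow> dist (e t) (e' t) \<le> \<epsilon>"
    using B by blast
  have "horo e r - \<epsilon> \<le> horo e' r"
  proof (rule horo_ge[OF er(3,2), of "max 0 T"])
    fix t assume t: "max 0 T \<le> t"
    then show "horo e r - \<epsilon> \<le> dist (e' t) (r t) - 2 * t"
      using horo_le[OF er(1,2) assms(4), of t t] T[of t] dist_triangle[of "e t" "r t" "e' t"]
      by simp
  qed
  then show "horo e r \<le> horo e' r + \<epsilon>"
    by simp
qed

text \<open>A weak form of asymptoty: bounded distance at a sequence of times suffices, and the times on
  both sides need not be synchronized.\<close>

definition asy :: "(real \<Rightarrow> 'a::metric_space) \<Rightarrow> (real \<Rightarrow> 'a) \<Rightarrow> bool" where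
  "asy r r' \<longleftrightarrow> (\<exists>C. \<forall>N. \<exists>s\<ge>N. \<exists>t\<ge>N. dist (r s) (r' t) \<le> C)"

context cat_minus1
begin

lemma exc_to_asymptotic:
  fixes r r' :: "real \<Rightarrow> 'a"
  assumes r: "r \<in> geodesic_rays" "r' \<in> geodesic_rays" and "asy r r'" and "0 \<le> u" "u \<le> t" "\<epsilon> > 0"
  shows "\<forall>N. \<exists>s\<ge>N. exc (r' u) (r' t) (r s) \<le> \<epsilon>"
proof
  fix N
  obtain C where C: "\<And>N. \<exists>s\<ge>N. \<exists>t\<ge>N. dist (r s) (r' t) \<le> C"
    using assms(3) unfolding asy_def by blast
  have C0: "2 * C \<ge> 0"
    using C[of 0] by (meson zero_le_dist order_trans mult_nonneg_nonneg zero_le_numeral)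
  obtain R where R: "R > 0"
    "\<And>y p m q::'a. btw p m q \<Longrightarrow> exc y p m \<le> 2 * C \<Longrightarrow> dist p m \<ge> R \<Longrightarrow> exc y m q \<le> \<epsilon>"
    using exc_decay[OF C0 assms(6)] by blast
  obtain s s' where s: "s \<ge> max N (t + R)" "s' \<ge> max N (t + R)" "dist (r s) (r' s') \<le> C"
    using C[of "max N (t + R)"] by blast
  have "exc (r s) (r' s') (r' t) \<le> 2 * C"
    using exc_le_dist[of "r s" "r' s'"] s(3) by (meson mult_left_mono order_trans zero_le_numeral)
  moreover have "btw (r' s') (r' t) (r' u)"
    using ray_btw[OF r(2), of u t s'] assms(4,5) s R by (simp add: btw_sym)
  moreover have "dist (r' s') (r' t) \<ge> R"
    using ray_dist[OF r(2), of s' t] s assms(4,5) R(1) by auto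
  ultimately have "exc (r s) (r' t) (r' u) \<le> \<epsilon>"
    using R(2) by blast
  then show "\<exists>s\<ge>N. exc (r' u) (r' t) (r s) \<le> \<epsilon>"
    using s(1) by (intro exI[of _ s]) (simp add: exc_sym)
qed

text \<open>Seen from a point of \<open>r\<close> near to a much later point of \<open>r'\<close>, the earlier points of \<open>r'\<close>
  are almost aligned.\<close>

lemma busemann_asymptotic:
  fixes r r' :: "real \<Rightarrow> 'a"
  assumes r: "r \<in> geodesic_rays" "r' \<in> geodesic_rays" and "asy r r'" and ut: "0 \<le> u" "u \<le> t"
  shows "busemann r (r' t) = busemann r (r' u) - (t - u)"
proof (rule antisym)
  show "busemann r (r' u) - (t - u) \<le> busemann r (r' t)"
    using busemann_lipschitz[OF r(1), of "r' u" "r' t"] ray_dist[OF r(2), of u t] ut by simp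
  show "busemann r (r' t) \<le> busemann r (r' u) - (t - u)"
  proof (rule field_le_epsilon)
    fix \<epsilon> :: real assume \<epsilon>: "\<epsilon> > 0"
    obtain T where T: "T \<ge> 0" "\<And>s. s \<ge> T \<Longrightarrow> dist (r' u) (r s) - s \<le> busemann r (r' u) + \<epsilon> / 2"
      using busemann_approx[OF r(1), of "\<epsilon> / 2" "r' u"] \<epsilon> by auto
    obtain s where s: "s \<ge> T" "exc (r' u) (r' t) (r s) \<le> \<epsilon> / 2"
      using exc_to_asymptotic[OF r assms(3) ut, of "\<epsilon> / 2"] \<epsilon> by auto
    show "busemann r (r' t) \<le> busemann r (r' u) - (t - u) + \<epsilon>"
      using T(2)[OF s(1)] s(2) busemann_le[OF r(1), of s "r' t"] ray_dist[OF r(2), of u t] T(1) s(1) ut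
      unfolding exc_def by simp
  qed
qed

text \<open>The case of a line, at negative times as well, follows by starting it earlier.\<close>

lemma busemann_asymptotic_line:
  fixes r f :: "real \<Rightarrow> 'a"
  assumes r: "r \<in> geodesic_rays" "f \<in> GX" and "asy r f"
  shows "busemann r (f t) = busemann r (f 0) - t"
proof -
  define S where "S = \<bar>t\<bar>"
  define h where "h = flow_GX (- S) f"
  have h: "h \<in> geodesic_rays"
    unfolding h_def using r flow_line line_ray by blast
  obtain C where C: "\<And>N. \<exists>s\<ge>N. \<exists>t\<ge>N. dist (r s) (f t) \<le> C"
    using assms(3) unfolding asy_def by blast
  have "\<exists>s\<ge>N. \<exists>t\<ge>N. dist (r s) (h t) \<le> C" for N
  proof -
    obtain s t where "s \<ge> N" "t \<ge> N" "dist (r s) (f t) \<le> C"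
      using C by blast
    then show ?thesis
      by (intro exI[of _ s] conjI exI[of _ "t + S"]) (auto simp: h_def flow_GX_def S_def)
  qed
  then have "asy r h"
    unfolding asy_def by blast
  then have "busemann r (h (t + S)) = busemann r (h 0) - (t + S)" "busemann r (h S) = busemann r (h 0) - S"
    using busemann_asymptotic[OF r(1) h, of 0 "t + S"] busemann_asymptotic[OF r(1) h, of 0 S]
    unfolding S_def by auto
  then show ?thesis
    unfolding h_def flow_GX_def by simp
qed

text \<open>A ray that runs down the Busemann function of \<open>r\<close> at unit speed, starting on the
  horosphere through \<open>r 0\<close>, converges to \<open>r\<close>: both are uniformly close to the segments
  issuing from \<open>g 0\<close> to far points of \<open>r\<close>.\<close>

lemma busemann_gradient_ray_converges:
  fixes r g :: "real \<Rightarrow> 'a"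
  assumes r: "r \<in> geodesic_rays" "g \<in> geodesic_rays"
    and b: "\<And>t. t \<ge> 0 \<Longrightarrow> busemann r (g t) = - t" and "\<epsilon> > 0"
  obtains T where "T \<ge> 0" "\<And>t. t \<ge> T \<Longrightarrow> dist (g t) (r t) \<le> \<epsilon>"
proof -
  obtain k where k: "k > 0" "fat k \<le> \<epsilon> / 2"
    using fat_small[of "\<epsilon> / 2"] assms(4) by auto
  have b0: "busemann r (g 0) = 0"
    using b[of 0] by simp
  obtain T where T: "T \<ge> 0" "\<And>t. t \<ge> T \<Longrightarrow> dist (g 0) (r t) - t \<le> k / 2"
    using busemann_approx[OF r(1), of "k / 2" "g 0"] k b0 by auto
  have "dist (g t) (r t) \<le> \<epsilon>" if t: "t \<ge> T" for t
  proof -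
    obtain T' where T': "T' \<ge> 0" "\<And>u. u \<ge> T' \<Longrightarrow> dist (g t) (r u) - u \<le> - t + k / 2"
      using busemann_approx[OF r(1), of "k / 2" "g t"] k b[of t] t T by auto
    define u where "u = max (max T' t) 1"
    have u: "u \<ge> T'" "u \<ge> t" "u \<ge> 1"
      unfolding u_def by auto
    have gu: "dist (g 0) (r u) \<ge> u" "dist (g 0) (r t) \<ge> t"
      using busemann_le[OF r(1), of u "g 0"] busemann_le[OF r(1), of t "g 0"] b0 u T t by auto
    obtain m where m: "btw (g 0) m (r u)" "dist (g 0) m = t"
      using point_at_distance[of t "g 0" "r u"] gu u t T by auto
    have "exc (g 0) (g t) (r u) \<le> k / 2"
      using T'(2)[OF u(1)] gu ray_dist[OF r(2), of 0 t] t T unfolding exc_def by simp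
    then have "dist (g t) m \<le> fat (2 * (k / 2))"
      using m gu u k ray_dist[OF r(2), of 0 t] t T by (intro dist_segment_le_fat_exc[OF m(1)]) auto
    moreover have "exc (g 0) (r t) (r u) \<le> k / 2"
      using T(2)[OF t] gu ray_dist[OF r(1), of t u] u t T(1) unfolding exc_def by simp
    then have "dist (r t) m \<le> fat (2 * (k / 2))"
      using m gu u k T(2)[OF t] by (intro dist_segment_le_fat_exc[OF m(1)]) auto
    ultimately show ?thesis
      using k dist_triangle2[of "g t" "r t" m] by simp
  qed
  with T show thesis
    using that by blast
qed

text \<open>The sum of the two Busemann functions is the excess with respect to the ends of \<open>f\<close>.\<close>

lemma line_eqI:
  fixes f :: "real \<Rightarrow> 'a"
  assumes f: "f \<in> GX" and z: "busemann (past f) x + busemann f x \<le> 0"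
  shows "x = f (busemann (past f) x)"
proof -
  define s where "s = busemann (past f) x"
  have "dist x (f s) \<le> \<epsilon>" if "\<epsilon> > 0" for \<epsilon>
  proof -
    obtain k where k: "k > 0" "fat k \<le> \<epsilon>"
      using fat_small \<open>\<epsilon> > 0\<close> by blast
    obtain T1 where T1: "\<And>t. t \<ge> T1 \<Longrightarrow> dist x (past f t) - t \<le> s + k"
      using busemann_approx[OF line_ray[OF past_line[OF f]] k(1), of x] unfolding s_def by metis
    obtain T2 where T2: "\<And>t. t \<ge> T2 \<Longrightarrow> dist x (f t) - t \<le> busemann f x + k"
      using busemann_approx[OF line_ray[OF f] k(1), of x] by metis
    define S where "S = max (max T1 T2) (\<bar>s\<bar> + 1)"
    have S: "S \<ge> T1" "S \<ge> T2" "S \<ge> \<bar>s\<bar> + 1"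
      unfolding S_def by auto
    have "dist x (f s) \<le> fat k"
    proof (rule dist_segment_le_fat)
      show "btw (f (- S)) (f s) (f S)"
        using S by (intro line_btw[OF f]) auto
      show "dist x (f (- S)) \<le> dist (f (- S)) (f s) + k"
        using T1[OF S(1)] S by (simp add: past_apply line_dist[OF f])
      show "dist x (f S) \<le> dist (f s) (f S) + k"
        using T2[OF S(2)] S z by (simp add: line_dist[OF f] s_def)
    qed (use S k in \<open>auto simp: line_dist[OF f]\<close>)
    with k show ?thesis by simp
  qed
  then have "dist x (f s) \<le> 0"
    using field_le_epsilon[of "dist x (f s)" 0] by simp
  then show ?thesis
    unfolding s_def by simp
qed

text \<open>There are no flat strips. Along \<open>f'\<close> the two Busemann functions of the ends of \<open>f\<close> have constant sum,
  and the sum is zero because \<open>f'\<close>, correctly parametrized, converges to \<open>f\<close>.\<close>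

lemma line_unique:
  fixes f f' :: "real \<Rightarrow> 'a"
  assumes f: "f \<in> GX" "f' \<in> GX" and a: "asy f f'" "asy (past f) (past f')"
  obtains \<tau> where "\<And>t. f' t = f (t + \<tau>)"
proof -
  define \<kappa> \<kappa>' where "\<kappa> = busemann f (f' 0)" and "\<kappa>' = busemann (past f) (f' 0)"
  have b: "busemann f (f' t) = \<kappa> - t" for t
    unfolding \<kappa>_def using busemann_asymptotic_line[OF line_ray[OF f(1)] f(2) a(1)] .
  have b': "busemann (past f) (f' t) = \<kappa>' + t" for t
    using busemann_asymptotic_line[OF line_ray[OF past_line[OF f(1)]] past_line[OF f(2)] a(2), of "- t"]
    unfolding \<kappa>'_def by (simp add: past_apply)
  have "\<kappa> + \<kappa>' \<le> 0"
  proof (rule field_le_epsilon)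
    fix \<epsilon> :: real assume "\<epsilon> > 0"
    have g: "flow_GX \<kappa> f' \<in> geodesic_rays"
      using f flow_line line_ray by blast
    have bb: "busemann f (flow_GX \<kappa> f' t) = - t" if "t \<ge> 0" for t
      using b unfolding flow_GX_def by simp
    obtain T where T: "\<And>t. t \<ge> T \<Longrightarrow> dist (flow_GX \<kappa> f' t) (f t) \<le> \<epsilon> / 2"
      using busemann_gradient_ray_converges[OF line_ray[OF f(1)] g bb half_gt_zero[OF \<open>\<epsilon> > 0\<close>]] by blast
    have d: "dist (f' (T + \<kappa>)) (f T) \<le> \<epsilon> / 2"
      using T[of T] unfolding flow_GX_def by simp
    have "\<kappa> + \<kappa>' = busemann f (f' (T + \<kappa>)) + busemann (past f) (f' (T + \<kappa>))"
      unfolding b b' by simp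
    also have "\<dots> \<le> busemann f (f T) + busemann (past f) (f T) + \<epsilon>"
      using d busemann_lipschitz[OF line_ray[OF f(1)], of "f' (T + \<kappa>)" "f T"]
        busemann_lipschitz[OF line_ray[OF past_line[OF f(1)]], of "f' (T + \<kappa>)" "f T"] by simp
    also have "\<dots> = \<epsilon>"
      using busemann_line[OF f(1)] busemann_past[OF f(1)] by simp
    finally show "\<kappa> + \<kappa>' \<le> 0 + \<epsilon>"
      by simp
  qed
  then have "f' t = f (t + \<kappa>')" for t
    using line_eqI[OF f(1), of "f' t"] unfolding b b' by (simp add: add.commute)
  then show thesis
    using that by blast
qed

text \<open>Two rays whose points come closer than the sum of the parameters by an arbitrarily large amount
  are asymptotic: Stewart's relation forces \<open>e u\<close> to be almost as far from \<open>r t\<close> as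
  \<open>r u\<close> is.\<close>

lemma not_sep_bounded:
  fixes e r :: "real \<Rightarrow> 'a"
  assumes er: "e \<in> geodesic_rays" "r \<in> geodesic_rays" and ns: "\<not> sep e r" and u: "u \<ge> 0"
  shows "dist (e u) (r u) \<le> fat (dist (e 0) (r 0) + 3)"
proof -
  define d where "d = dist (e 0) (r 0)"
  have d: "d \<ge> 0"
    unfolding d_def by simp
  \<comment> \<open>Then \<open>s\<close> and \<open>t\<close> exceed \<open>u\<close>, and \<open>2 * u \<le> K\<close> makes the contribution of \<open>e s\<close> to the
    estimate at \<open>e u\<close> no larger than that of \<open>e 0\<close>.\<close>
  define K where "K = 2 * u + d + 2"
  obtain s t where st: "s \<ge> 0" "t \<ge> 0" "dist (e s) (r t) < s + t - K"
    using ns unfolding sep_def by (metis not_le)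
  have su: "s \<ge> u + 1"
    using st dist_triangle[of "r 0" "r t" "e 0"] dist_triangle[of "e 0" "r t" "e s"]
      ray_dist[OF er(1), of 0 s] ray_dist[OF er(2), of 0 t]
    unfolding K_def d_def by (simp add: dist_commute)
  have tu: "t \<ge> u + 1"
    using st dist_triangle[of "e 0" "e s" "r 0"] dist_triangle[of "r 0" "e s" "r t"]
      ray_dist[OF er(1), of 0 s] ray_dist[OF er(2), of 0 t]
    unfolding K_def d_def by (simp add: dist_commute)
  define F where "F = dist (r t) (e u)"
  have F0: "dist (r t) (e 0) \<le> t + d"
    using dist_triangle[of "r t" "e 0" "r 0"] ray_dist[OF er(2), of t 0] st
    unfolding d_def by (simp add: dist_commute)
  have cosh_le: "cosh x \<le> exp y" if "0 \<le> x" "x \<le> y" for x y :: real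
  proof -
    have "exp x \<le> exp y" "exp (- x) \<le> exp y"
      using that by auto
    moreover have "(a + b) / 2 \<le> c" if "a \<le> c" "b \<le> c" for a b c :: real
      using that by simp
    ultimately show ?thesis
      unfolding cosh_field_def by blast
  qed
  have sinh_le: "sinh x \<le> exp x / 2" for x :: real
    unfolding sinh_field_def by simp
  have st': "cosh F * sinh s \<le> sinh (s - u) * cosh (dist (r t) (e 0)) + sinh u * cosh (dist (r t) (e s))"
    using stewart[OF ray_btw[OF er(1), of 0 u s], of "r t"] su u st ray_dist[OF er(1)]
    unfolding F_def by simp
  have "exp s \<ge> 2"
    using exp_ge_add_one_self[of s] su u by linarith
  then have "exp (- s) \<le> 1 / 2"
    by (simp add: exp_minus field_simps)
  have sh: "exp s / 4 \<le> sinh s"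
  proof -
    have "a / 4 \<le> (a - b) / 2" if "2 \<le> a" "b \<le> 1 / 2" for a b :: real
      using that by simp
    then show ?thesis
      unfolding sinh_field_def using \<open>exp s \<ge> 2\<close> \<open>exp (- s) \<le> 1 / 2\<close> by blast
  qed
  have ch: "exp F / 2 \<le> cosh F"
    unfolding cosh_field_def by simp
  have "exp F / 2 * (exp s / 4) \<le> cosh F * sinh s"
    using sh ch by (intro mult_mono) auto
  also have "\<dots> \<le> sinh (s - u) * cosh (dist (r t) (e 0)) + sinh u * cosh (dist (r t) (e s))"
    by (rule st')
  also have "\<dots> \<le> exp (s - u) / 2 * exp (t + d) + exp u / 2 * exp (s + t - K)"
    using F0 st(3) by (intro add_mono mult_mono sinh_le cosh_le) (auto simp: dist_commute)
  also have "\<dots> = (exp (s - u + t + d) + exp (u + s + t - K)) / 2"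
    by (simp add: algebra_simps add_divide_distrib flip: exp_add)
  also have "\<dots> \<le> exp (s - u + t + d)"
  proof -
    have "exp (u + s + t - K) \<le> exp (s - u + t + d)"
      unfolding K_def using d by simp
    then show ?thesis by simp
  qed
  also have "\<dots> = exp (t - u + d) * exp s"
    by (simp add: algebra_simps flip: exp_add)
  finally have "exp F \<le> 8 * exp (t - u + d)"
    by simp
  also have "\<dots> \<le> exp 3 * exp (t - u + d)"
  proof -
    have "exp (3::real) = exp 1 ^ 3"
      by (simp flip: exp_of_nat_mult)
    moreover have "exp (1::real) \<ge> 2"
      using exp_ge_add_one_self[of 1] by simp
    then have "exp (1::real) ^ 3 \<ge> 2 ^ 3"
      by (intro power_mono) auto
    ultimately have "exp (3::real) \<ge> 8"
      by simp
    then show ?thesis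
      by (intro mult_right_mono) auto
  qed
  also have "\<dots> = exp (t - u + (d + 3))"
    by (simp add: algebra_simps flip: exp_add)
  finally have F: "F \<le> t - u + (d + 3)"
    by simp
  show ?thesis
    unfolding d_def[symmetric]
  proof (rule dist_segment_le_fat)
    show "btw (r 0) (r u) (r t)"
      using ray_btw[OF er(2), of 0 u t] u tu by simp
    show "dist (r 0) (r t) \<ge> 1"
      using ray_dist[OF er(2), of 0 t] tu u by simp
    show "dist (e u) (r 0) \<le> dist (r 0) (r u) + (d + 3)"
      using dist_triangle[of "e u" "r 0" "e 0"] ray_dist[OF er(1), of u 0] ray_dist[OF er(2), of 0 u] u
      unfolding d_def by simp
    show "dist (e u) (r t) \<le> dist (r u) (r t) + (d + 3)"
      using F ray_dist[OF er(2), of u t] tu u unfolding F_def by (simp add: dist_commute)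
  qed (use d in auto)
qed

end

section \<open>Limits of geodesic segments\<close>

text \<open>A substitute for the theorem of Arzela and Ascoli: by Tychonoff's theorem a pointwise bounded
  sequence of curves has a cluster point for pointwise convergence, and for geodesics the isometry
  property survives pointwise.\<close>

lemma pointwise_cluster_point:
  fixes f :: "nat \<Rightarrow> 'b \<Rightarrow> 'a::metric_space"
  assumes K: "\<And>t. compact (K t)" "\<And>n t. f n t \<in> K t"
  obtains g where "\<And>F \<epsilon> N. finite F \<Longrightarrow> \<epsilon> > 0 \<Longrightarrow> \<exists>n\<ge>N. \<forall>t\<in>F. dist (f n t) (g t) < \<epsilon>"
proof -
  define P where "P = (\<Pi>\<^sub>E t\<in>UNIV. K t)"
  have "compactin (product_topology (\<lambda>_::'b. euclidean :: 'a topology) UNIV) P"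
    unfolding P_def by (subst compactin_PiE) (simp add: K)
  then have "compact P"
    by (simp add: euclidean_product_topology)
  moreover have "filtermap f sequentially \<le> principal P"
    unfolding le_principal eventually_filtermap P_def by (simp add: K PiE_def Pi_def)
  moreover have "filtermap f sequentially \<noteq> bot"
    by (simp add: filtermap_bot_iff)
  ultimately obtain g where g: "inf (nhds g) (filtermap f sequentially) \<noteq> bot"
    using compact_filter[THEN iffD1, of P, rule_format, of "filtermap f sequentially"]
    by (auto simp: le_principal)
  have "\<exists>n\<ge>N. \<forall>t\<in>F. dist (f n t) (g t) < \<epsilon>" if F: "finite F" "\<epsilon> > 0" for F \<epsilon> N
  proof (rule ccontr)
    assume neg: "\<not> ?thesis"
    define W where "W = (\<Inter>t\<in>F. {h. dist (h t) (g t) < \<epsilon>})"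
    have "open W"
      unfolding W_def
      by (intro open_INT ballI F open_Collect_less continuous_on_dist continuous_on_const
          continuous_on_product_coordinates)
    moreover have "g \<in> W"
      using F by (simp add: W_def)
    ultimately have "eventually (\<lambda>h. h \<in> W) (nhds g)"
      by (rule eventually_nhds_in_open)
    moreover have "eventually (\<lambda>h. h \<notin> W) (filtermap f sequentially)"
      unfolding eventually_filtermap eventually_sequentially W_def using neg by auto
    ultimately have "eventually (\<lambda>_. False) (inf (nhds g) (filtermap f sequentially))"
      unfolding eventually_inf by blast
    with g show False
      by (simp add: trivial_limit_def)
  qed
  then show thesis
    using that by blast
qed

context cat_minus1
begin

text \<open>The parameter on the segment from \<open>y\<close> to \<open>z\<close> is measured from the point at distance
  \<open>a\<close> from \<open>y\<close>; beyond the endpoints the parametrization is constant.\<close>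

lemma segment_param:
  fixes y z :: 'a
  assumes "0 \<le> a" "a \<le> dist y z"
  obtains \<sigma> where "\<And>s t. dist (\<sigma> s) (\<sigma> t) \<le> \<bar>s - t\<bar>"
    "\<And>s t. - a \<le> s \<Longrightarrow> s \<le> dist y z - a \<Longrightarrow> - a \<le> t \<Longrightarrow> t \<le> dist y z - a \<Longrightarrow> dist (\<sigma> s) (\<sigma> t) = \<bar>s - t\<bar>"
    "\<And>t. - a \<le> t \<Longrightarrow> t \<le> dist y z - a \<Longrightarrow> btw y (\<sigma> t) z \<and> dist y (\<sigma> t) = a + t"
proof -
  obtain c where c: "geodesic_from_to c y z"
    using segment_ex by blast
  have cd: "dist (c s) (c t) = \<bar>s - t\<bar>" if "0 \<le> s" "s \<le> dist y z" "0 \<le> t" "t \<le> dist y z" for s t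
    using c that unfolding geodesic_from_to_def geodesic_on_def by auto
  have ce: "c 0 = y" "c (dist y z) = z"
    using c unfolding geodesic_from_to_def by auto
  define clamp where "clamp t = max 0 (min (dist y z) (a + t))" for t
  have cl: "0 \<le> clamp t" "clamp t \<le> dist y z" "\<bar>clamp s - clamp t\<bar> \<le> \<bar>s - t\<bar>" for s t
    unfolding clamp_def by (auto simp: max_def min_def)
  have cl': "clamp t = a + t" if "- a \<le> t" "t \<le> dist y z - a" for t
    using that unfolding clamp_def by auto
  show thesis
  proof (rule that[of "\<lambda>t. c (clamp t)"])
    fix s t
    show "dist (c (clamp s)) (c (clamp t)) \<le> \<bar>s - t\<bar>"
      using cd cl by simp
  next
    fix s t assume "- a \<le> s" "s \<le> dist y z - a" "- a \<le> t" "t \<le> dist y z - a"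
    then have "clamp s = a + s" "clamp t = a + t"
      by (auto intro: cl')
    then show "dist (c (clamp s)) (c (clamp t)) = \<bar>s - t\<bar>"
      using cd[OF cl(1,2) cl(1,2), of s t] by simp
  next
    fix t assume t: "- a \<le> t" "t \<le> dist y z - a"
    have "dist (c 0) (c (clamp t)) = a + t" "dist (c (clamp t)) (c (dist y z)) = dist y z - (a + t)"
      using cd[of 0 "clamp t"] cd[of "clamp t" "dist y z"] cl[of t] cl'[OF t] t by auto
    then show "btw y (c (clamp t)) z \<and> dist y (c (clamp t)) = a + t"
      unfolding btw_def ce by simp
  qed
qed

text \<open>The segments from \<open>y n\<close> to \<open>z n\<close> pass within bounded distance of \<open>x\<close>, so they have a
  cluster point, which is a line. The approximating curves \<open>\<sigma> n\<close> are returned as well, since the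
  position of the line relative to other points is read off from them.\<close>

lemma limit_line:
  fixes y z :: "nat \<Rightarrow> 'a" and x :: 'a
  assumes ex: "\<And>n. exc (y n) x (z n) \<le> k" and dy: "\<And>n. real n \<le> dist (y n) x"
    and dz: "\<And>n. real n + k + 1 \<le> dist x (z n)"
  obtains f \<sigma> where "f \<in> GX"
    "\<And>n t. \<bar>t\<bar> \<le> real n \<Longrightarrow> btw (y n) (\<sigma> n t) (z n) \<and> dist (y n) (\<sigma> n t) = dist (y n) x + t"
    "\<And>F \<epsilon> N. finite F \<Longrightarrow> \<epsilon> > 0 \<Longrightarrow> \<exists>n\<ge>N. \<forall>t\<in>F. dist (\<sigma> n t) (f t) < \<epsilon>"
    "\<And>n s t. dist (\<sigma> n s) (\<sigma> n t) \<le> \<bar>s - t\<bar>"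
proof -
  have k: "k \<ge> 0"
    using ex[of 0] exc_nonneg order_trans by blast
  have len: "dist (y n) x + real n + 1 \<le> dist (y n) (z n)" for n
    using ex[of n] dz[of n] unfolding exc_def by simp
  have "\<exists>\<sigma>. (\<forall>s t. dist (\<sigma> s) (\<sigma> t) \<le> \<bar>s - t\<bar>) \<and>
    (\<forall>s t. - dist (y n) x \<le> s \<longrightarrow> s \<le> dist (y n) (z n) - dist (y n) x \<longrightarrow> - dist (y n) x \<le> t \<longrightarrow>
       t \<le> dist (y n) (z n) - dist (y n) x \<longrightarrow> dist (\<sigma> s) (\<sigma> t) = \<bar>s - t\<bar>) \<and>
    (\<forall>t. - dist (y n) x \<le> t \<longrightarrow> t \<le> dist (y n) (z n) - dist (y n) x \<longrightarrow>
       btw (y n) (\<sigma> t) (z n) \<and> dist (y n) (\<sigma> t) = dist (y n) x + t)" for n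
    by (rule segment_param[of "dist (y n) x" "y n" "z n"])
      (use len[of n] in \<open>simp_all, blast\<close>)
  then obtain \<sigma> where \<sigma>: "\<And>n s t. dist (\<sigma> n s) (\<sigma> n t) \<le> \<bar>s - t\<bar>"
    "\<And>n s t. - dist (y n) x \<le> s \<Longrightarrow> s \<le> dist (y n) (z n) - dist (y n) x \<Longrightarrow> - dist (y n) x \<le> t \<Longrightarrow>
       t \<le> dist (y n) (z n) - dist (y n) x \<Longrightarrow> dist (\<sigma> n s) (\<sigma> n t) = \<bar>s - t\<bar>"
    "\<And>n t. - dist (y n) x \<le> t \<Longrightarrow> t \<le> dist (y n) (z n) - dist (y n) x \<Longrightarrow>
       btw (y n) (\<sigma> n t) (z n) \<and> dist (y n) (\<sigma> n t) = dist (y n) x + t"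
    by metis
  have range: "- dist (y n) x \<le> t \<and> t \<le> dist (y n) (z n) - dist (y n) x" if "\<bar>t\<bar> \<le> real n" for n t
    using that dy[of n] len[of n] by linarith
  have "dist x (\<sigma> n 0) \<le> fat (2 * k)" for n
    using \<sigma>(3)[of n 0] range[of 0 n] len[of n] ex[of n] k
    by (intro dist_segment_le_fat_exc[of "y n" "\<sigma> n 0" "z n"]) (auto intro: order_trans[OF _ len])
  then have bd: "\<sigma> n t \<in> cball x (fat (2 * k) + \<bar>t\<bar>)" for n t
    using \<sigma>(1)[of n 0 t] dist_triangle[of x "\<sigma> n t" "\<sigma> n 0"] by (smt (verit, best) mem_cball)
  have cpt: "compact (cball x r)" for r
    using proper unfolding proper_space_def by blast
  obtain f where f: "\<And>F \<epsilon> N. finite F \<Longrightarrow> \<epsilon> > 0 \<Longrightarrow> \<exists>n\<ge>N. \<forall>t\<in>F. dist (\<sigma> n t) (f t) < \<epsilon>"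
    using pointwise_cluster_point[of "\<lambda>t. cball x (fat (2 * k) + \<bar>t\<bar>)" \<sigma>] cpt bd by blast
  have "f \<in> GX"
  proof (rule GX_I)
    fix s t
    have "\<bar>dist (f s) (f t) - \<bar>s - t\<bar>\<bar> \<le> 0 + \<epsilon>" if "\<epsilon> > 0" for \<epsilon>
    proof -
      obtain N :: nat where N: "max \<bar>s\<bar> \<bar>t\<bar> \<le> real N"
        using real_arch_simple by blast
      obtain n where n: "n \<ge> N" "dist (\<sigma> n s) (f s) < \<epsilon> / 2" "dist (\<sigma> n t) (f t) < \<epsilon> / 2"
        using f[of "{s, t}" "\<epsilon> / 2" N] \<open>\<epsilon> > 0\<close> by auto
      then have "\<bar>s\<bar> \<le> real n" "\<bar>t\<bar> \<le> real n"
        using N by auto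
      then have "dist (\<sigma> n s) (\<sigma> n t) = \<bar>s - t\<bar>"
        using \<sigma>(2)[of n s t] range by simp
      then show ?thesis
        using n dist_triangle[of "\<sigma> n s" "\<sigma> n t" "f s"] dist_triangle[of "f s" "\<sigma> n t" "f t"]
          dist_triangle[of "f s" "f t" "\<sigma> n s"] dist_triangle[of "\<sigma> n s" "f t" "\<sigma> n t"]
        by (simp add: dist_commute)
    qed
    then have "\<bar>dist (f s) (f t) - \<bar>s - t\<bar>\<bar> \<le> 0"
      by (rule field_le_epsilon)
    then show "dist (f s) (f t) = \<bar>s - t\<bar>"
      by simp
  qed
  then show thesis
    using that[of f \<sigma>] \<sigma>(1,3) f range by blast
qed

text \<open>The line is a cluster point of the segments from \<open>e n\<close> to \<open>r n\<close>. These satisfy the upper bounds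
  for both Busemann functions up to an error tending to zero, and the sum of the Busemann functions
  is nowhere smaller than \<open>horo e r\<close>.\<close>

lemma joining_line:
  fixes e r :: "real \<Rightarrow> 'a"
  assumes er: "e \<in> geodesic_rays" "r \<in> geodesic_rays" "sep e r"
  obtains f where "f \<in> GX" "\<And>t. busemann e (f t) = t" "\<And>t. busemann r (f t) = horo e r - t"
proof -
  define d where "d = dist (e 0) (r 0)"
  define k where "k = d - horo e r"
  have k: "exc (e s) (e 0) (r s) \<le> k" if "s \<ge> 0" for s
    using horo_le[OF er that that] ray_dist[OF er(1), of s 0] ray_dist[OF er(2), of 0 s] that
      dist_triangle[of "e 0" "r s" "r 0"]
    unfolding exc_def k_def d_def by simp
  obtain n0 :: nat where n0: "k + 1 + d \<le> real n0"
    using real_arch_simple by blast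
  have 1: "exc (e (real (n + n0))) (e 0) (r (real (n + n0))) \<le> k" for n
    by (rule k) simp
  have dn: "dist (e (real (n + n0))) (e 0) = real n + real n0" for n
    using ray_dist[OF er(1), of "real (n + n0)" 0] by simp
  then have 2: "real n \<le> dist (e (real (n + n0))) (e 0)" for n
    by simp
  have 3: "real n + k + 1 \<le> dist (e 0) (r (real (n + n0)))" for n
    using dist_triangle[of "r 0" "r (real (n + n0))" "e 0"] ray_dist[OF er(2), of 0 "real (n + n0)"] n0
    unfolding d_def by (simp add: dist_commute)
  obtain f \<sigma> where f: "f \<in> GX" and
    \<sigma>0: "\<And>n t. \<bar>t\<bar> \<le> real n \<Longrightarrow> btw (e (real (n + n0))) (\<sigma> n t) (r (real (n + n0))) \<and>
        dist (e (real (n + n0))) (\<sigma> n t) = dist (e (real (n + n0))) (e 0) + t" and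
    cl: "\<And>F \<epsilon> N. finite F \<Longrightarrow> \<epsilon> > 0 \<Longrightarrow> \<exists>n\<ge>N. \<forall>t\<in>F. dist (\<sigma> n t) (f t) < \<epsilon>"
    using limit_line[OF 1 2 3] by metis
  note \<sigma> = \<sigma>0[unfolded dn]
  have be: "busemann e (f t) \<le> t" for t
  proof (rule field_le_epsilon)
    fix \<epsilon> :: real assume \<epsilon>: "\<epsilon> > 0"
    obtain N :: nat where N: "\<bar>t\<bar> \<le> real N"
      using real_arch_simple by blast
    obtain n where n: "n \<ge> N" "dist (\<sigma> n t) (f t) < \<epsilon>"
      using cl[of "{t}" \<epsilon> N] \<epsilon> by auto
    then have "\<bar>t\<bar> \<le> real n"
      using N by simp
    then have "busemann e (\<sigma> n t) \<le> t"
      using busemann_le[OF er(1), of "real (n + n0)" "\<sigma> n t"] \<sigma>[of t n] by (simp add: dist_commute)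
    then show "busemann e (f t) \<le> t + \<epsilon>"
      using busemann_lipschitz[OF er(1), of "f t" "\<sigma> n t"] n by (simp add: dist_commute)
  qed
  have br: "busemann r (f t) \<le> horo e r - t" for t
  proof (rule field_le_epsilon)
    fix \<epsilon> :: real assume \<epsilon>: "\<epsilon> > 0"
    obtain S where S: "S \<ge> 0" "\<And>s t. s \<ge> S \<Longrightarrow> t \<ge> S \<Longrightarrow> dist (e s) (r t) - s - t \<le> horo e r + \<epsilon> / 2"
      using horo_approx[OF er, of "\<epsilon> / 2"] \<epsilon> by auto
    obtain N :: nat where N: "max S \<bar>t\<bar> \<le> real N"
      using real_arch_simple by blast
    obtain n where n: "n \<ge> N" "dist (\<sigma> n t) (f t) < \<epsilon> / 2"
      using cl[of "{t}" "\<epsilon> / 2" N] \<epsilon> by auto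
    then have tn: "\<bar>t\<bar> \<le> real n" "S \<le> real (n + n0)"
      using N by auto
    have "busemann r (\<sigma> n t) \<le> dist (\<sigma> n t) (r (real (n + n0))) - real (n + n0)"
      by (rule busemann_le[OF er(2)]) simp
    also have "\<dots> = dist (e (real (n + n0))) (r (real (n + n0))) - real (n + n0) - real (n + n0) - t"
      using \<sigma>[OF tn(1)] unfolding btw_def by simp
    also have "\<dots> \<le> horo e r + \<epsilon> / 2 - t"
      using S(2)[OF tn(2) tn(2)] by simp
    finally show "busemann r (f t) \<le> horo e r - t + \<epsilon>"
      using busemann_lipschitz[OF er(2), of "f t" "\<sigma> n t"] n by (simp add: dist_commute)
  qed
  have "busemann e (f t) = t \<and> busemann r (f t) = horo e r - t" for t
    using be[of t] br[of t] horo_le_busemann[OF er, of "f t"] by linarith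
  with f show thesis
    using that by blast
qed

text \<open>The joining line runs for \<open>horo e r\<close> units of time from the horosphere of \<open>e\<close> to that
  of \<open>r\<close>.\<close>

lemma joining_line_converges:
  fixes e r :: "real \<Rightarrow> 'a"
  assumes er: "e \<in> geodesic_rays" "r \<in> geodesic_rays" "sep e r"
  obtains f where "f \<in> GX"
    "\<And>\<epsilon>. \<epsilon> > 0 \<Longrightarrow> \<exists>T. \<forall>t\<ge>T. dist (f (- t)) (e t) \<le> \<epsilon> \<and> dist (f (horo e r + t)) (r t) \<le> \<epsilon>"
proof -
  obtain f where f: "f \<in> GX" "\<And>t. busemann e (f t) = t" "\<And>t. busemann r (f t) = horo e r - t"
    using joining_line[OF er] by blast
  have "\<exists>T. \<forall>t\<ge>T. dist (f (- t)) (e t) \<le> \<epsilon> \<and> dist (f (horo e r + t)) (r t) \<le> \<epsilon>" if \<epsilon>: "\<epsilon> > 0" for \<epsilon>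
  proof -
    have b1: "\<And>t. t \<ge> 0 \<Longrightarrow> busemann e (past f t) = - t"
      using f by (simp add: past_apply)
    have b2: "\<And>t. t \<ge> 0 \<Longrightarrow> busemann r (flow_GX (horo e r) f t) = - t"
      using f by (simp add: flow_GX_def)
    obtain T1 where "\<And>t. t \<ge> T1 \<Longrightarrow> dist (past f t) (e t) \<le> \<epsilon>"
      using busemann_gradient_ray_converges[OF er(1) line_ray[OF past_line[OF f(1)]] b1 \<epsilon>] by blast
    moreover obtain T2 where "\<And>t. t \<ge> T2 \<Longrightarrow> dist (flow_GX (horo e r) f t) (r t) \<le> \<epsilon>"
      using busemann_gradient_ray_converges[OF er(2) line_ray[OF flow_line[OF f(1)]] b2 \<epsilon>] by blast
    ultimately show ?thesis
      by (intro exI[of _ "max T1 T2"]) (auto simp: past_apply flow_GX_def add.commute)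
  qed
  with f(1) show thesis
    using that by blast
qed

end

section \<open>Generalized Busemann functions and the boundary\<close>

context cat_minus1
begin

text \<open>This links the generalized Busemann function, given by continuous extension to the
  compactification, with the Busemann functions of rays.\<close>

lemma ray_converges_in_cone_topology:
  fixes r :: "real \<Rightarrow> 'a"
  assumes r: "r \<in> geodesic_rays"
  shows "limitin cone_topology (\<lambda>t. Inl (r t)) (Inr (asymptotic `` {r})) at_top"
proof -
  let ?\<xi> = "asymptotic `` {r}"
  have vb: "?\<xi> \<in> visual_boundary"
    using r unfolding visual_boundary_def by (rule quotientI)
  have basic: "eventually (\<lambda>t. Inl (r t) \<in> cone_nbhd c R \<epsilon>) at_top"
    if c: "c \<in> geodesic_rays" "R > 0" "\<epsilon> > 0" "Inr ?\<xi> \<in> cone_nbhd c R \<epsilon>" for c R \<epsilon>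
  proof -
    obtain c' where c': "c' \<in> ?\<xi>" "c' 0 = c 0" "dist (c' R) (c R) < \<epsilon>"
      using c(4) unfolding cone_nbhd_def by auto
    then obtain B where ray: "c' \<in> geodesic_rays" and B: "\<And>t. t \<ge> 0 \<Longrightarrow> dist (r t) (c' t) \<le> B"
      unfolding asymptotic_def by auto
    have as: "asy r c'"
      unfolding asy_def
    proof (rule exI[of _ B], rule allI)
      fix N
      show "\<exists>s\<ge>N. \<exists>t\<ge>N. dist (r s) (c' t) \<le> B"
        using B[of "max N 0"] by (intro exI[of _ "max N 0"] conjI) auto
    qed
    define \<delta> where "\<delta> = \<epsilon> - dist (c' R) (c R)"
    have "\<delta> / 2 > 0"
      using c' unfolding \<delta>_def by simp
    then obtain k where k: "k > 0" "fat k \<le> \<delta> / 2"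
      using fat_small by blast
    have b: "busemann r (c' R) = busemann r (c 0) - R"
      using busemann_asymptotic[OF r ray as, of 0 R] c(2) c'(2) by simp
    have "k / 2 > 0"
      using k by simp
    then obtain T where T: "T \<ge> 0" "\<And>t. t \<ge> T \<Longrightarrow> dist (c' R) (r t) - t \<le> busemann r (c' R) + k / 2"
      using busemann_approx[OF r] by blast
    have "Inl (r t) \<in> cone_nbhd c R \<epsilon>" if t: "t \<ge> max T (R + dist (c 0) (r 0) + 1)" for t
    proof -
      have "dist (r 0) (r t) = t"
        using ray_dist[OF r, of 0 t] t T by simp
      then have far: "dist (c 0) (r t) \<ge> R + 1"
        using t dist_triangle[of "r 0" "r t" "c 0"] by (simp add: dist_commute)
      obtain \<sigma> where \<sigma>: "geodesic_from_to \<sigma> (c 0) (r t)"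
        using segment_ex by blast
      then have \<sigma>l: "\<And>s u. 0 \<le> s \<Longrightarrow> s \<le> dist (c 0) (r t) \<Longrightarrow> 0 \<le> u \<Longrightarrow> u \<le> dist (c 0) (r t) \<Longrightarrow>
            dist (\<sigma> s) (\<sigma> u) = \<bar>s - u\<bar>"
        and \<sigma>e: "\<sigma> 0 = c 0" "\<sigma> (dist (c 0) (r t)) = r t"
        unfolding geodesic_from_to_def geodesic_on_def by auto
      have \<sigma>d: "dist (\<sigma> 0) (\<sigma> R) = \<bar>0 - R\<bar>"
          "dist (\<sigma> R) (\<sigma> (dist (c 0) (r t))) = \<bar>R - dist (c 0) (r t)\<bar>"
        by (rule \<sigma>l; use far c(2) in simp)+
      have \<sigma>m: "btw (c 0) (\<sigma> R) (r t)" "dist (c 0) (\<sigma> R) = R"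
        using \<sigma>d far c(2) unfolding \<sigma>e btw_def by auto
      have d0: "dist (c 0) (c' R) = R"
        using ray_dist[OF ray, of 0 R] c(2) c'(2) by simp
      have "exc (c 0) (c' R) (r t) \<le> k / 2"
        using T(2)[of t] busemann_le[OF r, of t "c 0"] t T(1) b d0 unfolding exc_def by simp
      then have "dist (c' R) (\<sigma> R) \<le> fat (2 * (k / 2))"
        using far c(2) \<sigma>m d0 k by (intro dist_segment_le_fat_exc[OF \<sigma>m(1)]) auto
      then have "dist (\<sigma> R) (c R) < \<epsilon>"
        using k \<open>\<delta> / 2 > 0\<close> dist_triangle[of "\<sigma> R" "c R" "c' R"]
        by (simp add: \<delta>_def dist_commute)
      then show ?thesis
        using \<sigma> far unfolding cone_nbhd_def by auto
    qed
    then show ?thesis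
      unfolding eventually_at_top_linorder by blast
  qed
  have gen: "Inr ?\<xi> \<in> U \<longrightarrow> eventually (\<lambda>t. Inl (r t) \<in> U) at_top"
    if "generate_topology_on
     ({Inl ` U | U. open U} \<union> {cone_nbhd c r e | c r e. c \<in> geodesic_rays \<and> r > 0 \<and> e > 0}) U" for U
    using that
  proof induction
    case (Int a b)
    then show ?case
      by (auto intro: eventually_conj)
  next
    case (UN K)
    show ?case
    proof
      assume "Inr ?\<xi> \<in> \<Union> K"
      then obtain k where k: "k \<in> K" "Inr ?\<xi> \<in> k"
        by blast
      then have "eventually (\<lambda>t. Inl (r t) \<in> k) at_top"
        using UN.IH by blast
      then show "eventually (\<lambda>t. Inl (r t) \<in> \<Union> K) at_top"
        by (rule eventually_mono) (use k in blast)
    qed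
  next
    case (Basis s)
    then show ?case
      using basic by auto
  qed simp
  show ?thesis
    unfolding limitin_def topspace_cone_topology
    using gen vb by (auto simp: cone_topology_def openin_topology_generated_by_iff)
qed

lemma busemann_tendsto:
  assumes r: "r \<in> geodesic_rays"
  shows "((\<lambda>t. dist x (r t) - t) \<longlongrightarrow> busemann r x) at_top"
proof (rule tendstoI)
  fix \<epsilon> :: real assume "\<epsilon> > 0"
  then have "\<epsilon> / 2 > 0"
    by simp
  from busemann_approx[OF r this, of x] obtain T where
    T: "T \<ge> 0" "\<And>t. t \<ge> T \<Longrightarrow> dist x (r t) - t \<le> busemann r x + \<epsilon> / 2"
    by metis
  have "dist (dist x (r t) - t) (busemann r x) < \<epsilon>" if "t \<ge> T" for t
    using T(2)[OF that] busemann_le[OF r, of t x] that T(1) \<open>\<epsilon> / 2 > 0\<close> by (simp add: dist_real_def)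
  then show "eventually (\<lambda>t. dist (dist x (r t) - t) (busemann r x) < \<epsilon>) at_top"
    unfolding eventually_at_top_linorder by blast
qed

lemma generalized_busemann_ray:
  fixes \<alpha> :: "('a + (real \<Rightarrow> 'a) set) \<Rightarrow> 'a \<Rightarrow> 'a \<Rightarrow> real"
  assumes \<alpha>: "is_generalized_busemann \<alpha>" and r: "r \<in> geodesic_rays"
  shows "\<alpha> (Inr (asymptotic `` {r})) x x' = busemann r x' - busemann r x"
proof -
  let ?\<xi> = "asymptotic `` {r}"
  have cont: "continuous_map (prod_topology cone_topology (prod_topology euclidean euclidean)) euclideanreal
       (\<lambda>(\<eta>, x, x'). \<alpha> \<eta> x x')" and
    inl: "\<And>y x x'. \<alpha> (Inl y) x x' = dist x' y - dist x y"
    using \<alpha> unfolding is_generalized_busemann_def by auto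
  have "limitin (prod_topology cone_topology (prod_topology euclidean euclidean))
      (\<lambda>t. (Inl (r t), x, x')) (Inr ?\<xi>, x, x') at_top"
    using ray_converges_in_cone_topology[OF r] by (simp add: limitin_pairwise o_def)
  from continuous_map_limit[OF cont this]
  have "((\<lambda>t. \<alpha> (Inl (r t)) x x') \<longlongrightarrow> \<alpha> (Inr ?\<xi>) x x') at_top"
    by (simp add: o_def)
  moreover have "((\<lambda>t. \<alpha> (Inl (r t)) x x') \<longlongrightarrow> busemann r x' - busemann r x) at_top"
    using tendsto_diff[OF busemann_tendsto[OF r, of x'] busemann_tendsto[OF r, of x]]
    by (simp add: inl)
  ultimately show ?thesis
    by (rule tendsto_unique[rotated]) simp
qed

lemma visual_boundaryE:
  assumes "\<xi> \<in> visual_boundary"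
  obtains r where "r \<in> geodesic_rays" "\<xi> = asymptotic `` {r}"
  using assms unfolding visual_boundary_def by (auto elim: quotientE)

lemma third_end:
  fixes \<Gamma> :: "('a \<Rightarrow> 'a) set" and e r :: "real \<Rightarrow> 'a"
  assumes "non_elementary \<Gamma>" and er: "e \<in> geodesic_rays" "r \<in> geodesic_rays"
  obtains w where "w \<in> geodesic_rays" "sep w e" "sep w r"
proof -
  obtain x where x: "infinite (limit_set \<Gamma> x) \<or> card (limit_set \<Gamma> x) > 2"
    using assms(1) unfolding non_elementary_def by blast
  have "\<not> limit_set \<Gamma> x \<subseteq> {asymptotic `` {e}, asymptotic `` {r}}"
  proof
    assume sub: "limit_set \<Gamma> x \<subseteq> {asymptotic `` {e}, asymptotic `` {r}}"
    then have "finite (limit_set \<Gamma> x)"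
      using finite_subset by blast
    moreover have "card (limit_set \<Gamma> x) \<le> card {asymptotic `` {e}, asymptotic `` {r}}"
      using sub by (intro card_mono) auto
    moreover have "card {asymptotic `` {e}, asymptotic `` {r}} \<le> 2"
      by (simp add: card_insert_if)
    ultimately show False
      using x by linarith
  qed
  then obtain \<xi> where \<xi>: "\<xi> \<in> visual_boundary" "\<xi> \<noteq> asymptotic `` {e}" "\<xi> \<noteq> asymptotic `` {r}"
    unfolding limit_set_def by blast
  obtain w where w: "w \<in> geodesic_rays" "\<xi> = asymptotic `` {w}"
    using visual_boundaryE[OF \<xi>(1)] .
  have "sep w c" if c: "c \<in> geodesic_rays" "\<xi> \<noteq> asymptotic `` {c}" for c
  proof (rule ccontr)
    assume "\<not> sep w c"
    then have "(w, c) \<in> asymptotic"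
      using not_sep_bounded[OF w(1) c(1)] w(1) c(1) unfolding asymptotic_def by blast
    then have "asymptotic `` {w} = asymptotic `` {c}"
      using equiv_class_eq[OF equiv_asymptotic] by blast
    with w c show False by simp
  qed
  then show thesis
    using that w er \<xi> by blast
qed

end

section \<open>Recurrence\<close>

lemma isometry_groupD:
  assumes "isometry_group \<Gamma>" "\<gamma> \<in> \<Gamma>"
  shows "dist (\<gamma> x) (\<gamma> y) = dist x y" "inv \<gamma> \<in> \<Gamma>" "inv \<gamma> (\<gamma> x) = x" "\<gamma> (inv \<gamma> x) = x"
    "\<delta> \<in> \<Gamma> \<Longrightarrow> \<gamma> \<circ> \<delta> \<in> \<Gamma>" "\<gamma> ^^ n \<in> \<Gamma>"
proof -
  have b: "bij \<gamma>"
    using assms unfolding isometry_group_def by blast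
  show "dist (\<gamma> x) (\<gamma> y) = dist x y" "inv \<gamma> \<in> \<Gamma>" "\<delta> \<in> \<Gamma> \<Longrightarrow> \<gamma> \<circ> \<delta> \<in> \<Gamma>"
    using assms unfolding isometry_group_def by blast+
  show "inv \<gamma> (\<gamma> x) = x" "\<gamma> (inv \<gamma> x) = x"
    using b by (simp_all add: bij_is_inj bij_is_surj surj_f_inv_f)
  show "\<gamma> ^^ n \<in> \<Gamma>"
  proof (induction n)
    case 0
    then show ?case
      using assms unfolding isometry_group_def by (simp add: id_def[symmetric])
  next
    case (Suc n)
    then show ?case
      using assms unfolding isometry_group_def funpow.simps by blast
  qed
qed

lemma proj_GY_translate:
  assumes "isometry_group \<Gamma>" "\<gamma> \<in> \<Gamma>"
  shows "proj_GY \<Gamma> (\<gamma> \<circ> g) = proj_GY \<Gamma> g"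
proof -
  have "(\<lambda>\<delta>. \<delta> \<circ> (\<gamma> \<circ> g)) ` \<Gamma> \<subseteq> (\<lambda>\<delta>. \<delta> \<circ> g) ` \<Gamma>" if "\<gamma> \<in> \<Gamma>" for \<gamma> g
    using isometry_groupD(5)[OF assms(1) _ that] by (force simp: o_assoc)
  from this[of \<gamma> g] this[of "inv \<gamma>" "\<gamma> \<circ> g"]
  have "(\<lambda>\<delta>. \<delta> \<circ> (\<gamma> \<circ> g)) ` \<Gamma> \<subseteq> (\<lambda>\<delta>. \<delta> \<circ> g) ` \<Gamma>"
      "(\<lambda>\<delta>. \<delta> \<circ> (inv \<gamma> \<circ> (\<gamma> \<circ> g))) ` \<Gamma> \<subseteq> (\<lambda>\<delta>. \<delta> \<circ> (\<gamma> \<circ> g)) ` \<Gamma>"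
    using assms isometry_groupD(2) by blast+
  moreover have "inv \<gamma> \<circ> (\<gamma> \<circ> g) = g"
    using isometry_groupD(3)[OF assms] by (simp add: fun_eq_iff)
  ultimately show ?thesis
    unfolding proj_GY_def by auto
qed

lemma proj_GY_eqD:
  assumes "isometry_group \<Gamma>" "proj_GY \<Gamma> f = proj_GY \<Gamma> h"
  obtains \<gamma> where "\<gamma> \<in> \<Gamma>" "f = \<gamma> \<circ> h"
proof -
  have "id \<circ> f \<in> proj_GY \<Gamma> f"
    using assms(1) unfolding isometry_group_def proj_GY_def by blast
  then show thesis
    using that assms(2) unfolding proj_GY_def by auto
qed

text \<open>Keeping the distance to \<open>g\<close> below \<open>\<epsilon>\<close> by a margin \<open>\<delta>\<close> that is uniform on
  the interval makes the set visibly open.\<close>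

definition tube :: "(real \<Rightarrow> 'a::metric_space) \<Rightarrow> real \<Rightarrow> real \<Rightarrow> (real \<Rightarrow> 'a) set" where
  "tube g R \<epsilon> = {h \<in> GX. \<exists>\<delta>>0. \<forall>t\<in>{- R..R}. dist (h t) (g t) \<le> \<epsilon> - \<delta>}"

lemma openin_tube: "openin GX_topology (tube g R \<epsilon>)"
  unfolding openin_GX_topology
proof (intro conjI ballI)
  show "tube g R \<epsilon> \<subseteq> GX"
    unfolding tube_def by blast
  fix h assume "h \<in> tube g R \<epsilon>"
  then obtain \<delta> where h: "h \<in> GX" "\<delta> > 0" "\<And>t. t \<in> {- R..R} \<Longrightarrow> dist (h t) (g t) \<le> \<epsilon> - \<delta>"
    unfolding tube_def by blast
  have "f \<in> tube g R \<epsilon>" if f: "f \<in> GX" "\<forall>t\<in>{- R..R}. dist (f t) (h t) < \<delta> / 2" for f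
  proof -
    have "dist (f t) (g t) \<le> \<epsilon> - \<delta> / 2" if "t \<in> {- R..R}" for t
      using h(3)[OF that] f(2) that dist_triangle[of "f t" "g t" "h t"] by fastforce
    then show ?thesis
      using f(1) h(2) unfolding tube_def by (auto intro!: exI[of _ "\<delta> / 2"])
  qed
  then show "\<exists>K e. compact K \<and> 0 < e \<and> {f \<in> GX. \<forall>t\<in>K. dist (f t) (h t) < e} \<subseteq> tube g R \<epsilon>"
    using h(2) by (intro exI[of _ "{- R..R}"] exI[of _ "\<delta> / 2"]) auto
qed

lemma openin_proj_GY:
  assumes \<Gamma>: "isometry_group \<Gamma>" and V: "openin GX_topology V"
  shows "openin (GY_topology \<Gamma>) (proj_GY \<Gamma> ` V)"
  unfolding openin_GY_topology
proof
  have VG: "V \<subseteq> GX" and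
    Vn: "\<And>h. h \<in> V \<Longrightarrow> \<exists>K e. compact K \<and> e > 0 \<and> {f \<in> GX. \<forall>t\<in>K. dist (f t) (h t) < e} \<subseteq> V"
    using V unfolding openin_GX_topology by auto
  show "proj_GY \<Gamma> ` V \<subseteq> GY \<Gamma>"
    using VG unfolding GY_def by blast
  show "openin GX_topology {g \<in> GX. proj_GY \<Gamma> g \<in> proj_GY \<Gamma> ` V}"
    unfolding openin_GX_topology
  proof (intro conjI ballI)
    fix f assume "f \<in> {g \<in> GX. proj_GY \<Gamma> g \<in> proj_GY \<Gamma> ` V}"
    then obtain h where f: "f \<in> GX" and h: "h \<in> V" "proj_GY \<Gamma> f = proj_GY \<Gamma> h"
      by blast
    obtain \<gamma> where \<gamma>: "\<gamma> \<in> \<Gamma>" "f = \<gamma> \<circ> h"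
      using proj_GY_eqD[OF \<Gamma> h(2)] .
    obtain K e where K: "compact K" "e > 0" "{f \<in> GX. \<forall>t\<in>K. dist (f t) (h t) < e} \<subseteq> V"
      using Vn[OF h(1)] by blast
    have inv: "inv \<gamma> \<in> \<Gamma>"
      using isometry_groupD(2)[OF \<Gamma> \<gamma>(1)] .
    have "proj_GY \<Gamma> f' \<in> proj_GY \<Gamma> ` V" if f': "f' \<in> GX" "\<forall>t\<in>K. dist (f' t) (f t) < e" for f'
    proof -
      have "dist ((inv \<gamma> \<circ> f') t) (h t) < e" if "t \<in> K" for t
      proof -
        have "dist ((inv \<gamma> \<circ> f') t) (h t) = dist (f' t) (f t)"
          using isometry_groupD(1)[OF \<Gamma> \<gamma>(1), of "inv \<gamma> (f' t)" "h t"]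
            isometry_groupD(4)[OF \<Gamma> \<gamma>(1)] \<gamma>(2) by simp
        then show ?thesis
          using f'(2) that by simp
      qed
      moreover have "inv \<gamma> \<circ> f' \<in> GX"
        using isometry_line[OF f'(1)] isometry_groupD(1)[OF \<Gamma> inv] by blast
      ultimately have "inv \<gamma> \<circ> f' \<in> V"
        using K(3) by blast
      then show ?thesis
        using proj_GY_translate[OF \<Gamma> inv, of f'] by (metis imageI)
    qed
    then show "\<exists>K e. compact K \<and> 0 < e \<and> {h \<in> GX. \<forall>t\<in>K. dist (h t) (f t) < e}
        \<subseteq> {g \<in> GX. proj_GY \<Gamma> g \<in> proj_GY \<Gamma> ` V}"
      using K by blast
  qed blast
qed

text \<open>Non-wandering geodesics of the quotient, lifted to the space itself: \<open>g'\<close> starts near \<open>g\<close> and is near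
  the translate \<open>\<gamma> \<circ> g\<close> after a long time \<open>t\<close>.\<close>

lemma non_wandering_recurrence:
  fixes g :: "real \<Rightarrow> 'a::metric_space"
  assumes \<Gamma>: "isometry_group \<Gamma>" and nw: "non_wandering_set \<Gamma> = GY \<Gamma>"
    and g: "g \<in> GX" and \<epsilon>: "\<epsilon> > 0"
  obtains g' h' \<gamma> t where "g' \<in> GX" "h' \<in> GX" "\<gamma> \<in> \<Gamma>" "t \<ge> T0" "\<And>s. \<gamma> (h' s) = g' (s + t)"
    "\<And>s. \<bar>s\<bar> \<le> R \<Longrightarrow> dist (g' s) (g s) \<le> \<epsilon>" "\<And>s. \<bar>s\<bar> \<le> R \<Longrightarrow> dist (h' s) (g s) \<le> \<epsilon>"
proof -
  define U where "U = proj_GY \<Gamma> ` tube g R \<epsilon>"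
  have U: "openin (GY_topology \<Gamma>) U" "proj_GY \<Gamma> g \<in> U"
    unfolding U_def using openin_proj_GY[OF \<Gamma> openin_tube] g \<epsilon>
    by (auto intro!: imageI simp: tube_def exI[of _ \<epsilon>])
  have "proj_GY \<Gamma> g \<in> non_wandering_set \<Gamma>"
    using g unfolding nw GY_def by blast
  then obtain ys ts where ts: "filterlim ts at_top sequentially" and
    lim: "limitin (GY_topology \<Gamma>) ys (proj_GY \<Gamma> g) sequentially"
      "limitin (GY_topology \<Gamma>) (\<lambda>n. flow_GY \<Gamma> (ts n) (ys n)) (proj_GY \<Gamma> g) sequentially"
    unfolding non_wandering_set_def by blast
  have "eventually (\<lambda>n. T0 \<le> ts n \<and> ys n \<in> U \<and> flow_GY \<Gamma> (ts n) (ys n) \<in> U) sequentially"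
    using ts limitinD[OF lim(1) U] limitinD[OF lim(2) U] unfolding filterlim_at_top
    by (intro eventually_conj) auto
  then obtain n where n: "T0 \<le> ts n" "ys n \<in> U" "flow_GY \<Gamma> (ts n) (ys n) \<in> U"
    using eventually_happens'[OF trivial_limit_sequentially] by blast
  obtain g' where g': "g' \<in> tube g R \<epsilon>" "ys n = proj_GY \<Gamma> g'"
    using n(2) unfolding U_def by blast
  obtain h' where h': "h' \<in> tube g R \<epsilon>" "flow_GY \<Gamma> (ts n) (ys n) = proj_GY \<Gamma> h'"
    using n(3) unfolding U_def by blast
  have GX: "g' \<in> GX" "h' \<in> GX"
    using g' h' unfolding tube_def by auto
  have "proj_GY \<Gamma> (flow_GX (ts n) g') = proj_GY \<Gamma> h'"
    using flow_GY_proj[OF \<Gamma> GX(1)] g'(2) h'(2) by simp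
  then obtain \<gamma> where \<gamma>: "\<gamma> \<in> \<Gamma>" "flow_GX (ts n) g' = \<gamma> \<circ> h'"
    using proj_GY_eqD[OF \<Gamma>] by blast
  have "\<gamma> (h' s) = g' (s + ts n)" for s
    using fun_cong[OF \<gamma>(2), of s] by (simp add: flow_GX_def)
  moreover have "dist (f s) (g s) \<le> \<epsilon>" if f: "f \<in> tube g R \<epsilon>" and s: "\<bar>s\<bar> \<le> R" for f s
  proof -
    obtain \<delta> where "\<delta> > 0" "\<forall>t\<in>{- R..R}. dist (f t) (g t) \<le> \<epsilon> - \<delta>"
      using f unfolding tube_def by blast
    moreover have "s \<in> {- R..R}"
      using s by auto
    ultimately show ?thesis
      by fastforce
  qed
  ultimately show thesis
    using that[OF GX \<gamma>(1) n(1)] g'(1) h'(1) by blast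
qed

section \<open>Closing lemma\<close>

lemma exc_isometry:
  assumes "\<And>x y. dist (\<gamma> x) (\<gamma> y) = dist x y"
  shows "exc (\<gamma> x) (\<gamma> y) (\<gamma> z) = exc x y z"
  unfolding exc_def using assms by simp

context cat_minus1
begin

text \<open>The induction step for following the orbit of \<open>g 0\<close> under an isometry \<open>\<gamma>\<close> that carries the
  neighbourhood of \<open>g\<close> at time \<open>0\<close> to its neighbourhood at the large time \<open>t\<close>, along a line \<open>g'\<close>. An excess of at
  most 1 at \<open>g 0\<close> is carried by \<open>\<gamma>\<close> to one at \<open>g' t\<close>, and on the way back along \<open>g'\<close> to \<open>g 0\<close> it decays
  below \<open>\<theta>\<close>. So the error does not accumulate.\<close>

lemma shadowing_step:
  assumes \<theta>: "\<theta> > 0" "\<theta> \<le> 1"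
  obtains S0 where "S0 > 0"
    "\<And>S g g' h' \<gamma> t \<tau> (z::'a). S \<ge> S0 \<Longrightarrow> g \<in> GX \<Longrightarrow> g' \<in> GX \<Longrightarrow> h' \<in> GX \<Longrightarrow>
       (\<And>x y. dist (\<gamma> x) (\<gamma> y) = dist x y) \<Longrightarrow> t \<ge> 2 * S \<Longrightarrow> \<tau> \<le> 1 / 8 \<Longrightarrow>
       (\<And>s. \<bar>s\<bar> \<le> S \<Longrightarrow> dist (g' s) (g s) \<le> \<tau>) \<Longrightarrow> (\<And>s. \<bar>s\<bar> \<le> S \<Longrightarrow> dist (h' s) (g s) \<le> \<tau>) \<Longrightarrow>
       (\<And>s. \<gamma> (h' s) = g' (s + t)) \<Longrightarrow> exc z (g 0) (g (- S)) \<le> 1 \<Longrightarrow>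
       exc (\<gamma> z) (g S) (g (- S)) \<le> \<theta> + 4 * \<tau> \<and> dist z (g 0) + t - 4 \<le> dist (\<gamma> z) (g 0)"
proof -
  obtain R where R: "R > 0"
    "\<And>y p m q::'a. btw p m q \<Longrightarrow> exc y p m \<le> 2 \<Longrightarrow> dist p m \<ge> R \<Longrightarrow> exc y m q \<le> \<theta>"
    using exc_decay[of 2 \<theta>] \<theta>(1) by auto
  show thesis
  proof (rule that[of R])
    fix S g g' h' \<gamma> t \<tau> and z :: 'a
    assume S: "S \<ge> R" and GX: "g \<in> GX" "g' \<in> GX" "h' \<in> GX"
      and iso: "\<And>x y. dist (\<gamma> x) (\<gamma> y) = dist x y" and t: "t \<ge> 2 * S" and \<tau>: "\<tau> \<le> 1 / 8"
      and g': "\<And>s. \<bar>s\<bar> \<le> S \<Longrightarrow> dist (g' s) (g s) \<le> \<tau>"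
      and h': "\<And>s. \<bar>s\<bar> \<le> S \<Longrightarrow> dist (h' s) (g s) \<le> \<tau>"
      and gh: "\<And>s. \<gamma> (h' s) = g' (s + t)" and z: "exc z (g 0) (g (- S)) \<le> 1"
    have S0: "S > 0"
      using S R by simp
    have n0: "dist (\<gamma> (g 0)) (g' t) \<le> \<tau>" "dist (\<gamma> (g (- S))) (g' (t - S)) \<le> \<tau>"
      using h'[of 0] h'[of "- S"] S0 iso[of "g 0" "h' 0"] iso[of "g (- S)" "h' (- S)"]
        gh[of 0] gh[of "- S"] by (simp_all add: dist_commute)
    have "exc (\<gamma> z) (\<gamma> (g 0)) (\<gamma> (g (- S))) \<le> 1"
      using z exc_isometry[OF iso] by simp
    then have e1: "exc (\<gamma> z) (g' t) (g' (t - S)) \<le> 2"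
      using exc_perturb[of "\<gamma> z" "\<gamma> z" 0, OF _ n0] \<tau> by simp
    have "exc (\<gamma> z) (g' (t - S)) (g' (- S)) \<le> \<theta>"
      using e1 S S0 t line_btw[OF GX(2), of "- S" "t - S" t]
      by (intro R(2)[of "g' t"]) (auto simp: btw_sym line_dist[OF GX(2)])
    moreover have "btw (g' (t - S)) (g' S) (g' (- S))" "btw (g' (t - S)) (g' 0) (g' (- S))"
        "btw (g' t) (g' (t - S)) (g' 0)"
      using S0 t line_btw[OF GX(2), of "- S" S "t - S"] line_btw[OF GX(2), of "- S" 0 "t - S"]
        line_btw[OF GX(2), of 0 "t - S" t] by (auto simp: btw_sym)
    note spl = exc_split[OF this(1), of "\<gamma> z"] exc_split[OF this(2), of "\<gamma> z"]
      exc_split[OF this(3), of "\<gamma> z"]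
    ultimately have "exc (\<gamma> z) (g' S) (g' (- S)) \<le> \<theta>" and e3: "exc (\<gamma> z) (g' t) (g' 0) \<le> 3"
      using spl exc_nonneg[of "\<gamma> z" "g' (t - S)" "g' S"] exc_nonneg[of "\<gamma> z" "g' 0" "g' (- S)"]
        \<theta>(2) e1 by linarith+
    then have "exc (\<gamma> z) (g S) (g (- S)) \<le> \<theta> + 4 * \<tau>"
      using exc_perturb[of "\<gamma> z" "\<gamma> z" 0 "g' S" "g S" \<tau> "g' (- S)" "g (- S)" \<tau>] g'[of S] g'[of "- S"] S0
      by simp
    moreover have "dist z (g 0) + t - 4 \<le> dist (\<gamma> z) (g 0)"
    proof -
      have "dist z (g 0) \<le> dist (\<gamma> z) (g' t) + \<tau>"
        using iso[of z "g 0"] n0(1) dist_triangle[of "\<gamma> z" "\<gamma> (g 0)" "g' t"] by (simp add: dist_commute)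
      moreover have "dist (g' t) (g' 0) = t"
        using t S0 line_dist[OF GX(2)] by simp
      moreover have "dist (\<gamma> z) (g' 0) \<le> dist (\<gamma> z) (g 0) + \<tau>"
        using g'[of 0] S0 dist_triangle[of "\<gamma> z" "g' 0" "g 0"] by (simp add: dist_commute)
      ultimately show ?thesis
        using e3 \<tau> unfolding exc_def by simp
    qed
    ultimately show "exc (\<gamma> z) (g S) (g (- S)) \<le> \<theta> + 4 * \<tau> \<and> dist z (g 0) + t - 4 \<le> dist (\<gamma> z) (g 0)"
      by blast
  qed (use R in simp)
qed

text \<open>The segments from \<open>P (- n)\<close> to \<open>P n\<close> pass near all intermediate points of the orbit, hence so does a limit
  line \<open>f\<close>. Then \<open>\<gamma> \<circ> f\<close> passes near the same points, so it is a reparametrization of \<open>f\<close> by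
  \<open>line_unique\<close>.\<close>

lemma quasi_axis:
  fixes P :: "int \<Rightarrow> 'a"
  assumes iso: "\<And>x y. dist (\<gamma> x) (\<gamma> y) = dist x y"
    and P: "\<And>i. \<gamma> (P i) = P (i + 1)"
    and ex: "\<And>j k. j \<ge> 1 \<Longrightarrow> k \<ge> 1 \<Longrightarrow> exc (P (- j)) (P 0) (P k) \<le> 1"
    and grow: "\<And>i. 2 * \<bar>real_of_int i\<bar> \<le> dist (P 0) (P i)"
  obtains f \<omega> \<sigma> where "f \<in> GX" "\<omega> > 0" "\<And>s. \<gamma> (f s) = f (s + \<omega>)"
    "\<And>n t. \<bar>t\<bar> \<le> real n \<Longrightarrow> btw (P (- int (Suc n))) (\<sigma> n t) (P (int (Suc n))) \<and>
       dist (P (- int (Suc n))) (\<sigma> n t) = dist (P (- int (Suc n))) (P 0) + t"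
    "\<And>F \<epsilon> N. finite F \<Longrightarrow> \<epsilon> > 0 \<Longrightarrow> \<exists>n\<ge>N. \<forall>t\<in>F. dist (\<sigma> n t) (f t) < \<epsilon>"
proof -
  have inv: "dist (P (a + m)) (P (b + m)) = dist (P a) (P b)" for a b m
  proof (induction m rule: int_induct[of _ 0])
    case (step1 i)
    then show ?case
      using iso[of "P (a + i)" "P (b + i)"] unfolding P by (simp add: add.assoc)
  next
    case (step2 i)
    then show ?case
      using iso[of "P (a + (i - 1))" "P (b + (i - 1))"] unfolding P by (simp add: algebra_simps)
  qed simp
  have ex3: "exc (P a) (P b) (P c) \<le> 1" if "a < b" "b < c" for a b c
    using ex[of "b - a" "c - b"] that inv[of "a - b" b 0] inv[of 0 b "c - b"] inv[of "a - b" b "c - b"]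
    unfolding exc_def by simp
  define y z where "y n = P (- int (Suc n))" and "z n = P (int (Suc n))" for n
  have 1: "exc (y n) (P 0) (z n) \<le> 1" for n
    unfolding y_def z_def by (rule ex) auto
  have 2: "real n \<le> dist (y n) (P 0)" for n
    using grow[of "- int (Suc n)"] unfolding y_def by (simp add: dist_commute)
  have 3: "real n + 1 + 1 \<le> dist (P 0) (z n)" for n
    using grow[of "int (Suc n)"] unfolding z_def by simp
  obtain f \<sigma> where f: "f \<in> GX"
    and \<sigma>: "\<And>n t. \<bar>t\<bar> \<le> real n \<Longrightarrow> btw (y n) (\<sigma> n t) (z n) \<and> dist (y n) (\<sigma> n t) = dist (y n) (P 0) + t"
    and cl: "\<And>F \<epsilon> N. finite F \<Longrightarrow> \<epsilon> > 0 \<Longrightarrow> \<exists>n\<ge>N. \<forall>t\<in>F. dist (\<sigma> n t) (f t) < \<epsilon>"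
    and lip: "\<And>n s t. dist (\<sigma> n s) (\<sigma> n t) \<le> \<bar>s - t\<bar>"
    using limit_line[OF 1 2 3] by metis
  define C where "C = fat 2 + 2"
  \<comment> \<open>The sign tells on which side of \<open>P 0\<close> the line meets the orbit point; it gives the two
    ends of \<open>f\<close>, and in the end \<open>\<omega> > 0\<close>.\<close>
  have near: "\<exists>u. dist (P i) (f u) \<le> C \<and> \<bar>u - of_int (sgn i) * dist (P 0) (P i)\<bar> \<le> 2" for i
  proof -
    define D where "D = dist (P 0) (P i)"
    define F where "F = real_of_int ` {- \<lceil>D\<rceil>..\<lceil>D\<rceil>}"
    obtain N :: nat where N: "max D \<bar>real_of_int i\<bar> \<le> real N"
      using real_arch_simple by blast
    obtain n where n: "n \<ge> N" "\<And>t. t \<in> F \<Longrightarrow> dist (\<sigma> n t) (f t) < 1"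
      using cl[of F 1 N] unfolding F_def by auto
    have nD: "D \<le> real n" "\<bar>i\<bar> \<le> int n"
      using N n(1) by linarith+
    define v where "v = dist (y n) (P i) - dist (y n) (P 0)"
    have v: "\<bar>v\<bar> \<le> D"
      unfolding v_def D_def using dist_triangle[of "y n" "P i" "P 0"] dist_triangle[of "y n" "P 0" "P i"]
      by (simp add: dist_commute)
    have vs: "\<bar>v - of_int (sgn i) * D\<bar> \<le> 1"
    proof (cases i "0::int" rule: linorder_cases)
      case less
      have "exc (y n) (P i) (P 0) \<le> 1"
        unfolding y_def by (rule ex3) (use less nD in auto)
      then show ?thesis
        using less v unfolding exc_def v_def D_def by (simp add: dist_commute)
    next
      case equal
      then show ?thesis
        using v by (simp add: D_def)
    next
      case greater
      have "exc (y n) (P 0) (P i) \<le> 1"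
        unfolding y_def by (rule ex3) (use greater nD in auto)
      then show ?thesis
        using greater v unfolding exc_def v_def D_def by (simp add: dist_commute)
    qed
    have "exc (y n) (P i) (z n) \<le> 1"
      unfolding y_def z_def by (rule ex3) (use nD in auto)
    moreover have "dist (y n) (z n) \<ge> 1"
      using 1[of n] 2[of n] 3[of n] unfolding exc_def by simp
    moreover have \<sigma>v: "btw (y n) (\<sigma> n v) (z n)" "dist (y n) (\<sigma> n v) = dist (y n) (P 0) + v"
      using \<sigma>[of v n] v nD by auto
    ultimately have "dist (P i) (\<sigma> n v) \<le> fat (2 * 1)"
      by (intro dist_segment_le_fat_exc) (auto simp: v_def)
    moreover have "dist (\<sigma> n v) (\<sigma> n \<lfloor>v\<rfloor>) \<le> 1"
      using lip[of n v "of_int \<lfloor>v\<rfloor>"] by linarith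
    moreover have "of_int \<lfloor>v\<rfloor> \<in> F"
      unfolding F_def using v by (intro imageI) (simp add: le_floor_iff, linarith)
    then have "dist (\<sigma> n \<lfloor>v\<rfloor>) (f \<lfloor>v\<rfloor>) < 1"
      by (rule n(2))
    ultimately have "dist (P i) (f \<lfloor>v\<rfloor>) \<le> C"
      using dist_triangle[of "P i" "f \<lfloor>v\<rfloor>" "\<sigma> n v"] dist_triangle[of "\<sigma> n v" "f \<lfloor>v\<rfloor>" "\<sigma> n \<lfloor>v\<rfloor>"]
      unfolding C_def by simp
    moreover have "\<bar>of_int \<lfloor>v\<rfloor> - of_int (sgn i) * D\<bar> \<le> 2"
      using vs by linarith
    ultimately show ?thesis
      unfolding D_def by blast
  qed
  then obtain u where u: "\<And>i. dist (P i) (f (u i)) \<le> C"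
    "\<And>i. \<bar>u i - of_int (sgn i) * dist (P 0) (P i)\<bar> \<le> 2"
    by metis
  have u_pos: "2 * real_of_int i - 2 \<le> u i" if "i > 0" for i
    using u(2)[of i] grow[of i] that by simp
  have u_neg: "u i \<le> 2 * real_of_int i + 2" if "i < 0" for i
    using u(2)[of i] grow[of i] that by simp
  define f' where "f' = \<gamma> \<circ> f"
  have f': "f' \<in> GX"
    unfolding f'_def by (rule isometry_line[OF f iso])
  have ff': "dist (f (u (i + 1))) (f' (u i)) \<le> 2 * C" for i
  proof -
    have "dist (P (i + 1)) (f' (u i)) \<le> C"
      using u(1)[of i] iso[of "P i" "f (u i)"] unfolding P f'_def by simp
    then show ?thesis
      using u(1)[of "i + 1"] dist_triangle[of "f (u (i + 1))" "f' (u i)" "P (i + 1)"]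
      by (simp add: dist_commute)
  qed
  have "asy f f'"
    unfolding asy_def
  proof (rule exI[of _ "2 * C"], rule allI)
    fix N :: real
    define i where "i = max 1 \<lceil>N + 2\<rceil>"
    have "N + 2 \<le> of_int i" "i \<ge> 1"
      unfolding i_def by linarith+
    then show "\<exists>s\<ge>N. \<exists>t\<ge>N. dist (f s) (f' t) \<le> 2 * C"
      using u_pos[of i] u_pos[of "i + 1"] ff'[of i]
      by (intro exI[of _ "u (i + 1)"] conjI exI[of _ "u i"]) auto
  qed
  moreover have "asy (past f) (past f')"
    unfolding asy_def
  proof (rule exI[of _ "2 * C"], rule allI)
    fix N :: real
    define i where "i = max 2 \<lceil>N + 4\<rceil>"
    have "N + 4 \<le> of_int i" "i \<ge> 2"
      unfolding i_def by linarith+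
    then show "\<exists>s\<ge>N. \<exists>t\<ge>N. dist (past f s) (past f' t) \<le> 2 * C"
      using u_neg[of "- i"] u_neg[of "- i + 1"] ff'[of "- i"]
      by (intro exI[of _ "- u (- i + 1)"] conjI exI[of _ "- u (- i)"]) (auto simp: past_apply)
  qed
  ultimately obtain \<omega> where \<omega>: "\<And>t. f' t = f (t + \<omega>)"
    using line_unique[OF f f'] by blast
  have pow: "(\<gamma> ^^ i) (f 0) = f (real i * \<omega>)" for i
  proof (induction i)
    case (Suc i)
    then show ?case
      using \<omega>[of "real i * \<omega>"] unfolding f'_def by (simp add: algebra_simps)
  qed simp
  have powP: "(\<gamma> ^^ i) (P 0) = P (int i)" for i
    by (induction i) (simp_all add: P add.commute)
  have powd: "dist ((\<gamma> ^^ i) x) ((\<gamma> ^^ i) y) = dist x y" for i x y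
    by (induction i) (simp_all add: iso)
  have "\<omega> > 0"
  proof -
    obtain i :: nat where i: "dist (f 0) (P 0) + C + 3 \<le> real i"
      using real_arch_simple by blast
    have "C \<ge> 0"
      using fat_nonneg[of 2] unfolding C_def by simp
    then have i1: "i \<ge> 1"
      using i zero_le_dist[of "f 0" "P 0"] by linarith
    have "dist (f (real i * \<omega>)) (P (int i)) = dist (f 0) (P 0)"
      using powd[of i "f 0" "P 0"] unfolding pow powP .
    then have "\<bar>real i * \<omega> - u (int i)\<bar> \<le> dist (f 0) (P 0) + C"
      using u(1)[of "int i"] dist_triangle[of "f (real i * \<omega>)" "f (u (int i))" "P (int i)"]
      by (simp add: line_dist[OF f])
    then have "real i * \<omega> > 0"
      using u_pos[of "int i"] i i1 by simp
    then show ?thesis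
      using i1 by (simp add: zero_less_mult_iff)
  qed
  moreover have "\<gamma> (f s) = f (s + \<omega>)" for s
    using \<omega>[of s] unfolding f'_def by simp
  ultimately show thesis
    using that[OF f, of \<omega> \<sigma>] \<sigma> cl unfolding y_def z_def by blast
qed

end

text \<open>The hypotheses on the group in the form in which the proof uses them: the boundary has at least
  three points, and any two points lie on a common horosphere.\<close>

locale recurrent_group = cat_minus1 X for X :: "'a::metric_space itself" +
  fixes \<Gamma> :: "('a \<Rightarrow> 'a) set"
  assumes isom: "isometry_group \<Gamma>"
    and nonwandering: "non_wandering_set \<Gamma> = GY \<Gamma>"
    and ends: "\<And>e r :: real \<Rightarrow> 'a. e \<in> geodesic_rays \<Longrightarrow> r \<in> geodesic_rays \<Longrightarrow> \<exists>w\<in>geodesic_rays. sep w e \<and> sep w r"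
    and equidistant: "\<And>x x' :: 'a. \<exists>r\<in>geodesic_rays. busemann r x = busemann r x'"
begin

lemma iso: "\<gamma> \<in> \<Gamma> \<Longrightarrow> dist (\<gamma> x) (\<gamma> y) = dist x y"
  using isometry_groupD(1)[OF isom] .

text \<open>Recurrence yields an isometry \<open>\<gamma>\<close> that nearly translates \<open>g\<close> along a line \<open>g'\<close>. Its orbit through
  \<open>g 0\<close> is followed by \<open>shadowing_step\<close> in both directions, the backward direction being the forward
  direction for the reversed lines and the inverse of \<open>\<gamma>\<close>. The resulting axis is close to \<open>g\<close>
  because all excesses at points \<open>g r\<close>, \<open>\<bar>r\<bar> \<le> R\<close>, are small.\<close>

lemma closing:
  assumes g: "g \<in> GX" and \<epsilon>: "\<epsilon> > 0" and R: "R \<ge> 0"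
  obtains c \<gamma> \<omega> where "c \<in> GX" "\<gamma> \<in> \<Gamma>" "\<omega> > 0" "\<And>s. \<gamma> (c s) = c (s + \<omega>)"
    "\<And>s. \<bar>s\<bar> \<le> R \<Longrightarrow> dist (c s) (g s) \<le> \<epsilon>"
proof -
  obtain \<kappa> where \<kappa>: "\<kappa> > 0" "fat \<kappa> \<le> \<epsilon> / 2"
    using fat_small[of "\<epsilon> / 2"] \<epsilon> by auto
  define \<eta> where "\<eta> = min (\<kappa> / 2) 1"
  have \<eta>: "\<eta> > 0" "\<eta> \<le> 1" "2 * \<eta> \<le> \<kappa>"
    using \<kappa> unfolding \<eta>_def by auto
  obtain R1 where R1: "R1 > 0"
    "\<And>y p m q z::'a. btw p m q \<Longrightarrow> exc y p m \<le> 1 \<Longrightarrow> exc m q z \<le> 1 \<Longrightarrow>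
       dist p m \<ge> R1 \<Longrightarrow> dist m q \<ge> R1 \<Longrightarrow> exc y m z \<le> \<eta>"
    using exc_local_to_global[of 1 \<eta>] \<eta> by auto
  have "\<eta> / 2 > 0" "\<eta> / 2 \<le> 1"
    using \<eta> by auto
  from shadowing_step[OF this] obtain S0 where S0: "S0 > 0" and
    step: "\<And>S g g' h' \<gamma> t \<tau> (z::'a). S \<ge> S0 \<Longrightarrow> g \<in> GX \<Longrightarrow> g' \<in> GX \<Longrightarrow> h' \<in> GX \<Longrightarrow>
       (\<And>x y. dist (\<gamma> x) (\<gamma> y) = dist x y) \<Longrightarrow> t \<ge> 2 * S \<Longrightarrow> \<tau> \<le> 1 / 8 \<Longrightarrow>
       (\<And>s. \<bar>s\<bar> \<le> S \<Longrightarrow> dist (g' s) (g s) \<le> \<tau>) \<Longrightarrow> (\<And>s. \<bar>s\<bar> \<le> S \<Longrightarrow> dist (h' s) (g s) \<le> \<tau>) \<Longrightarrow>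
       (\<And>s. \<gamma> (h' s) = g' (s + t)) \<Longrightarrow> exc z (g 0) (g (- S)) \<le> 1 \<Longrightarrow>
       exc (\<gamma> z) (g S) (g (- S)) \<le> \<eta> / 2 + 4 * \<tau> \<and> dist z (g 0) + t - 4 \<le> dist (\<gamma> z) (g 0)"
    by metis
  define S where "S = R + R1 + S0"
  have S: "S > 0" "S \<ge> S0" "S \<ge> R + R1"
    using R R1 S0 unfolding S_def by auto
  define \<tau> where "\<tau> = \<eta> / 8"
  have \<tau>: "\<tau> > 0" "\<tau> \<le> 1 / 8"
    using \<eta> unfolding \<tau>_def by auto
  \<comment> \<open>The margin 6 makes each step of the orbit increase the distance from \<open>g 0\<close> by at least 2.\<close>
  obtain g' h' \<gamma> t where gh: "g' \<in> GX" "h' \<in> GX" "\<gamma> \<in> \<Gamma>" "t \<ge> 2 * S + 6" "\<And>s. \<gamma> (h' s) = g' (s + t)"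
    "\<And>s. \<bar>s\<bar> \<le> S \<Longrightarrow> dist (g' s) (g s) \<le> \<tau>" "\<And>s. \<bar>s\<bar> \<le> S \<Longrightarrow> dist (h' s) (g s) \<le> \<tau>"
    using non_wandering_recurrence[OF isom nonwandering g \<tau>(1)] by metis
  define \<delta> where "\<delta> = inv \<gamma>"
  have \<delta>: "\<delta> \<in> \<Gamma>" "\<And>x. \<delta> (\<gamma> x) = x" "\<And>x. \<gamma> (\<delta> x) = x"
    unfolding \<delta>_def using isometry_groupD(2,3,4)[OF isom gh(3)] by auto
  have fwd: "exc (\<gamma> z) (g S) (g (- S)) \<le> \<eta> \<and> dist z (g 0) + 2 \<le> dist (\<gamma> z) (g 0)"
    if "exc z (g 0) (g (- S)) \<le> 1" for z
    using step[OF S(2) g gh(1,2) iso[OF gh(3)] _ \<tau>(2) gh(6,7,5) that] gh(4) S(1) unfolding \<tau>_def by simp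
  have bwd: "exc (\<delta> z) (g (- S)) (g S) \<le> \<eta> \<and> dist z (g 0) + 2 \<le> dist (\<delta> z) (g 0)"
    if z: "exc z (g 0) (g S) \<le> 1" for z
  proof -
    have "\<delta> (past g' s) = past h' (s + t)" for s
      using gh(5)[of "- (s + t)"] \<delta>(2)[of "h' (- (s + t))"] by (simp add: past_apply)
    then have "exc (\<delta> z) (past g S) (past g (- S)) \<le> \<eta> / 2 + 4 * \<tau> \<and>
        dist z (past g 0) + t - 4 \<le> dist (\<delta> z) (past g 0)"
      using z gh(4) S(1)
      by (intro step[OF S(2) past_line[OF g] past_line[OF gh(2)] past_line[OF gh(1)] iso[OF \<delta>(1)] _ \<tau>(2)])
        (auto simp: past_apply gh(6,7))
    then show ?thesis
      using gh(4) S(1) unfolding \<tau>_def by (simp add: past_apply)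
  qed
  have spl: "exc z (g 0) (g (- S)) \<le> exc z (g S) (g (- S))" "exc z (g 0) (g S) \<le> exc z (g (- S)) (g S)" for z
    using exc_split[of "g S" "g 0" "g (- S)" z] exc_split[of "g (- S)" "g 0" "g S" z]
      line_btw[OF g, of "- S" 0 S] S(1) exc_nonneg[of z "g S" "g 0"] exc_nonneg[of z "g (- S)" "g 0"]
    by (simp_all add: btw_sym)
  have orb_f: "exc ((\<gamma> ^^ k) (g 0)) (g 0) (g (- S)) \<le> 1 \<and> 2 * real k \<le> dist ((\<gamma> ^^ k) (g 0)) (g 0)" for k
  proof (induction k)
    case 0
    then show ?case by (simp add: exc_def)
  next
    case (Suc k)
    then show ?case
      using fwd[of "(\<gamma> ^^ k) (g 0)"] spl(1)[of "(\<gamma> ^^ Suc k) (g 0)"] \<eta>(2) by simp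
  qed
  have orb_b: "exc ((\<delta> ^^ k) (g 0)) (g 0) (g S) \<le> 1 \<and> 2 * real k \<le> dist ((\<delta> ^^ k) (g 0)) (g 0)" for k
  proof (induction k)
    case 0
    then show ?case by (simp add: exc_def)
  next
    case (Suc k)
    then show ?case
      using bwd[of "(\<delta> ^^ k) (g 0)"] spl(2)[of "(\<delta> ^^ Suc k) (g 0)"] \<eta>(2) by simp
  qed
  define P where "P i = (if i \<ge> 0 then (\<gamma> ^^ nat i) (g 0) else (\<delta> ^^ nat (- i)) (g 0))" for i :: int
  have P0: "P 0 = g 0"
    unfolding P_def by simp
  have P: "\<gamma> (P i) = P (i + 1)" for i
  proof (cases "i \<ge> 0")
    case True
    then show ?thesis
      unfolding P_def by (simp add: nat_add_distrib)
  next
    case False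
    then obtain k where "nat (- i) = Suc k" "nat (- (i + 1)) = k"
      by (metis Suc_nat_eq_nat_zadd1 add.commute diff_add_cancel minus_add_distrib neg_0_le_iff_le not_less
          uminus_add_conv_diff zless_imp_add1_zle)
    with False show ?thesis
      unfolding P_def using \<delta>(3) by auto
  qed
  have ends_P: "exc (P k) (g S) (g (- S)) \<le> \<eta>" "exc (P (- k)) (g (- S)) (g S) \<le> \<eta>" if "k \<ge> 1" for k
  proof -
    obtain m where m: "nat k = Suc m"
      using \<open>k \<ge> 1\<close> by (cases "nat k") auto
    then have "P k = \<gamma> ((\<gamma> ^^ m) (g 0))" "P (- k) = \<delta> ((\<delta> ^^ m) (g 0))"
      using \<open>k \<ge> 1\<close> unfolding P_def by auto
    then show "exc (P k) (g S) (g (- S)) \<le> \<eta>" "exc (P (- k)) (g (- S)) (g S) \<le> \<eta>"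
      using fwd[of "(\<gamma> ^^ m) (g 0)"] bwd[of "(\<delta> ^^ m) (g 0)"] orb_f[of m] orb_b[of m] by simp_all
  qed
  have left: "exc (P (- k)) (g (- S)) (g r) \<le> \<eta>" if "k \<ge> 1" "\<bar>r\<bar> \<le> R" for k r
    using ends_P(2)[OF that(1)] exc_split[OF line_btw[OF g, of "- S" r S], of "P (- k)"] that(2) S R1(1)
      exc_nonneg[of "P (- k)" "g r" "g S"] by auto
  have right: "exc (P k) (g S) (g r) \<le> \<eta>" if "k \<ge> 1" "\<bar>r\<bar> \<le> R" for k r
    using ends_P(1)[OF that(1)] exc_split[of "g S" "g r" "g (- S)" "P k"] line_btw[OF g, of "- S" r S] that(2) S R1(1)
      exc_nonneg[of "P k" "g r" "g (- S)"] by (auto simp: btw_sym)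
  have mid: "exc (P (- j)) (g r) (P k) \<le> \<eta>" if jk: "j \<ge> 1" "k \<ge> 1" and r: "\<bar>r\<bar> \<le> R" for j k r
  proof (rule R1(2))
    show "btw (g (- S)) (g r) (g S)"
      using r S R1(1) by (intro line_btw[OF g]) auto
    show "exc (P (- j)) (g (- S)) (g r) \<le> 1" "exc (g r) (g S) (P k) \<le> 1"
      using left[OF jk(1) r] right[OF jk(2) r] \<eta>(2) by (simp_all add: exc_sym)
    show "dist (g (- S)) (g r) \<ge> R1" "dist (g r) (g S) \<ge> R1"
      using r S by (simp_all add: line_dist[OF g])
  qed
  have ex: "exc (P (- j)) (P 0) (P k) \<le> 1" if "j \<ge> 1" "k \<ge> 1" for j k
    using mid[OF that, of 0] R \<eta>(2) unfolding P0 by simp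
  have grow: "2 * \<bar>real_of_int i\<bar> \<le> dist (P 0) (P i)" for i
  proof (cases "i \<ge> 0")
    case True
    then show ?thesis
      using orb_f[of "nat i"] unfolding P0 unfolding P_def by (simp add: dist_commute)
  next
    case False
    then show ?thesis
      using orb_b[of "nat (- i)"] unfolding P0 unfolding P_def by (simp add: dist_commute)
  qed
  show thesis
  proof (rule quasi_axis[OF iso[OF gh(3)] P ex grow])
    fix f \<omega> \<sigma>
    assume f: "f \<in> GX" "\<omega> > 0" "\<And>s. \<gamma> (f s) = f (s + \<omega>)" and
    \<sigma>: "\<And>n t. \<bar>t\<bar> \<le> real n \<Longrightarrow> btw (P (- int (Suc n))) (\<sigma> n t) (P (int (Suc n))) \<and>
       dist (P (- int (Suc n))) (\<sigma> n t) = dist (P (- int (Suc n))) (P 0) + t" and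
    cl: "\<And>F \<epsilon> N. finite F \<Longrightarrow> \<epsilon> > 0 \<Longrightarrow> \<exists>n\<ge>N. \<forall>t\<in>F. dist (\<sigma> n t) (f t) < \<epsilon>"
    have "dist (f r) (g r) \<le> \<epsilon>" if r: "\<bar>r\<bar> \<le> R" for r
    proof -
      obtain N :: nat where N: "R \<le> real N"
        using real_arch_simple by blast
      obtain n where n: "n \<ge> N" "dist (\<sigma> n r) (f r) < \<epsilon> / 2"
        using cl[of "{r}" "\<epsilon> / 2" N] \<epsilon> by auto
      define y z where "y = P (- int (Suc n))" and "z = P (int (Suc n))"
      have "\<bar>r\<bar> \<le> real n"
        using n(1) N r by linarith
      note \<sigma>r = \<sigma>[OF this, folded y_def z_def]
      have 1: "exc y (g r) z \<le> \<kappa> / 2"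
        using mid[of "int (Suc n)" "int (Suc n)" r] r \<eta> unfolding y_def z_def by simp
      have 2: "exc y (g (- S)) (g r) \<le> \<eta>" "exc y (g (- S)) (g 0) \<le> \<eta>"
        unfolding y_def using left[of "int (Suc n)"] r R by auto
      have "dist y (\<sigma> n r) = dist y (g 0) + r" "dist (g (- S)) (g r) = S + r" "dist (g (- S)) (g 0) = S"
        using \<sigma>r r S R1(1) by (simp_all add: P0 line_dist[OF g])
      then have "\<bar>dist y (\<sigma> n r) - dist y (g r)\<bar> \<le> \<kappa> / 2"
        using 2 exc_nonneg[of y "g (- S)" "g r"] exc_nonneg[of y "g (- S)" "g 0"] \<eta>(3)
        unfolding exc_def by linarith
      moreover have "dist y z \<ge> 1"
        using \<sigma>r ex[of "int (Suc n)" "int (Suc n)"] grow[of "int (Suc n)"] grow[of "- int (Suc n)"]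
        unfolding y_def z_def exc_def by (simp add: dist_commute)
      ultimately have "dist (g r) (\<sigma> n r) \<le> fat (2 * (\<kappa> / 2))"
        using \<sigma>r 1 by (intro dist_segment_le_fat_exc) auto
      then show ?thesis
        using \<kappa> n(2) dist_triangle[of "f r" "g r" "\<sigma> n r"] by (simp add: dist_commute)
    qed
    with f gh(3) show thesis
      using that by blast
  qed
qed

end

section \<open>Continuity of horospherical distances along orbits\<close>

context cat_minus1
begin

text \<open>Here \<open>h\<close> is a ray whose end, seen from \<open>g u\<close>, lies beyond \<open>g (2 * u)\<close>. Both horospherical distances
  are measured at \<open>g u\<close>; the difference is the height of the horosphere of \<open>h\<close>, which does not
  depend on \<open>l\<close>.\<close>

lemma horo_near_line:
  fixes g l :: "real \<Rightarrow> 'a"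
  assumes g: "g \<in> GX" and l: "l \<in> geodesic_rays" "sep l g" and \<epsilon>: "\<epsilon> > 0"
  obtains U where "\<And>u h S. u \<ge> U \<Longrightarrow> h \<in> geodesic_rays \<Longrightarrow> S \<ge> 0 \<Longrightarrow>
      (\<And>t. t \<ge> S \<Longrightarrow> exc (g u) (g (2 * u)) (h t) \<le> k) \<Longrightarrow>
      sep l h \<and> \<bar>horo l h - (busemann h (g u) + u) - horo l g\<bar> \<le> \<epsilon>"
proof -
  define K where "K = max (max 0 k) (dist (l 0) (g 0) - horo l g)"
  have lg: "exc (l s) (g 0) (g u) \<le> K" if "s \<ge> 0" "u \<ge> 0" for s u
    using exc_ray_le[OF l(1) line_ray[OF g] l(2) that] unfolding K_def by simp
  have K: "K \<ge> 0" "k \<le> K"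
    unfolding K_def by auto
  have \<epsilon>2: "\<epsilon> / 2 > 0"
    using \<epsilon> by simp
  obtain R where R: "R > 0"
    "\<And>y p m q z::'a. btw p m q \<Longrightarrow> exc y p m \<le> K \<Longrightarrow> exc m q z \<le> K \<Longrightarrow>
       dist p m \<ge> R \<Longrightarrow> dist m q \<ge> R \<Longrightarrow> exc y m z \<le> \<epsilon> / 2"
    using exc_local_to_global[OF K(1) \<epsilon>2] by metis
  obtain R' where R': "R' > 0"
    "\<And>y p m q::'a. btw p m q \<Longrightarrow> exc y p m \<le> K \<Longrightarrow> dist p m \<ge> R' \<Longrightarrow> exc y m q \<le> \<epsilon> / 2"
    using exc_decay[OF K(1) \<epsilon>2] by metis
  have "sep l h \<and> \<bar>horo l h - (busemann h (g u) + u) - horo l g\<bar> \<le> \<epsilon>"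
    if u: "u \<ge> max R R'" and h: "h \<in> geodesic_rays" and S: "S \<ge> 0"
      and ex: "\<And>t. t \<ge> S \<Longrightarrow> exc (g u) (g (2 * u)) (h t) \<le> k" for u h S
  proof -
    have u0: "u \<ge> 0" "dist (g 0) (g u) = u" "dist (g u) (g (2 * u)) = u"
      using u R by (auto simp: line_dist[OF g])
    have 1: "exc (l s) (g u) (h t) \<le> \<epsilon> / 2" if "s \<ge> S" "t \<ge> S" for s t
    proof (rule R(2))
      show "btw (g 0) (g u) (g (2 * u))"
        using u0 by (intro line_btw[OF g]) auto
      show "exc (l s) (g 0) (g u) \<le> K"
        using that S u0 by (intro lg) auto
      show "exc (g u) (g (2 * u)) (h t) \<le> K"
        using ex[OF that(2)] K by simp
    qed (use u u0 in auto)
    note split_h = horo_split[OF l(1) h S 1]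
    have 2: "exc (l s) (g u) (g t) \<le> \<epsilon> / 2" if "s \<ge> u" "t \<ge> u" for s t
    proof (rule R'(2))
      show "btw (g 0) (g u) (g t)"
        using u0 that by (intro line_btw[OF g]) auto
      show "exc (l s) (g 0) (g u) \<le> K"
        using that u0 by (intro lg) auto
    qed (use u u0 in auto)
    note split_g = horo_split[OF l(1) line_ray[OF g] u0(1) 2, unfolded busemann_line[OF g]]
    show ?thesis
      using split_h split_g by auto
  qed
  then show thesis
    using that by blast
qed

end

context recurrent_group
begin

text \<open>Orbits of ends accumulate everywhere: a recurrent line \<open>g\<close> ending at \<open>r\<close> returns near
  itself after applying some \<open>\<delta>\<close>, and \<open>\<delta>\<close> then carries every end other than the origin
  of \<open>g\<close> close to \<open>r\<close>. The horosphere at the new end has no preferred height, whence the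
  common constant \<open>\<kappa>\<close>.\<close>

lemma approximate_end:
  fixes e r l1 l2 :: "real \<Rightarrow> 'a"
  assumes rays: "e \<in> geodesic_rays" "r \<in> geodesic_rays" "l1 \<in> geodesic_rays" "l2 \<in> geodesic_rays"
    and sep: "sep l1 r" "sep l2 r" and \<epsilon>: "\<epsilon> > 0"
  obtains \<delta> \<kappa> where "\<delta> \<in> \<Gamma>" "sep l1 (\<delta> \<circ> e)" "sep l2 (\<delta> \<circ> e)"
    "\<bar>horo l1 (\<delta> \<circ> e) - \<kappa> - horo l1 r\<bar> \<le> \<epsilon>" "\<bar>horo l2 (\<delta> \<circ> e) - \<kappa> - horo l2 r\<bar> \<le> \<epsilon>"
proof -
  obtain w where w: "w \<in> geodesic_rays" "sep w e" "sep w r"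
    using ends[OF rays(1,2)] by blast
  obtain f where f: "f \<in> GX"
    "\<And>\<epsilon>. \<epsilon> > 0 \<Longrightarrow> \<exists>T. \<forall>t\<ge>T. dist (f (- t)) (w t) \<le> \<epsilon> \<and> dist (f (horo w r + t)) (r t) \<le> \<epsilon>"
    using joining_line_converges[OF w(1) rays(2) w(3)] by metis
  define g where "g = flow_GX (horo w r) f"
  have g: "g \<in> GX"
    unfolding g_def using flow_line[OF f(1)] .
  have gr: "\<exists>T. \<forall>t\<ge>T. dist (r t) (g t) \<le> \<epsilon>" if "\<epsilon> > 0" for \<epsilon>
    using f(2)[OF that] unfolding g_def flow_GX_def by (auto simp: dist_commute add.commute)
  obtain T where T: "\<And>t. t \<ge> T \<Longrightarrow> dist (w t) (f (- t)) \<le> 1"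
    using f(2)[of 1] by (auto simp: dist_commute)
  have "dist (w t) (past g t) \<le> 1 + \<bar>horo w r\<bar>" if "t \<ge> T" for t
    using T[OF that] dist_triangle[of "w t" "past g t" "f (- t)"]
    by (simp add: g_def flow_GX_def past_apply line_dist[OF f(1)])
  then have sep_e: "sep e (past g)"
    using sep_asymptotic[OF w(1) rays(1) line_ray[OF past_line[OF g]] w(2)] sep_sym by blast
  have to_g: "sep l g \<and> horo l g = horo l r" if l: "l \<in> geodesic_rays" "sep l r" for l
  proof
    obtain T' where "\<And>t. t \<ge> T' \<Longrightarrow> dist (r t) (g t) \<le> 1"
      using gr[of 1] by auto
    then have s: "sep g l"
      using sep_asymptotic[OF rays(2) l(1) line_ray[OF g]] l(2) sep_sym by blast
    then show "sep l g"
      using sep_sym by blast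
    have gr': "\<exists>T. \<forall>t\<ge>T. dist (g t) (r t) \<le> \<epsilon>" if "\<epsilon> > 0" for \<epsilon>
      using gr[OF that] by (simp add: dist_commute)
    have "horo r l \<le> horo g l" "horo g l \<le> horo r l"
      using horo_asymptotic[OF rays(2) l(1) line_ray[OF g] _ gr]
        horo_asymptotic[OF line_ray[OF g] l(1) rays(2) s gr'] l(2) sep_sym by blast+
    then show "horo l g = horo l r"
      by (simp add: horo_sym)
  qed
  define k where "k = max 0 (dist (e 0) (g 0) - horo e (past g))"
  have k: "k \<ge> 0" "exc (e s) (g 0) (g (- v)) \<le> k" if "s \<ge> 0" "v \<ge> 0" for s v
    using exc_ray_le[OF rays(1) line_ray[OF past_line[OF g]] sep_e that]
    unfolding k_def by (auto simp: past_apply)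
  have k4: "k + 4 \<ge> 0"
    unfolding k_def by simp
  obtain U1 where U1: "\<And>u h S. u \<ge> U1 \<Longrightarrow> h \<in> geodesic_rays \<Longrightarrow> S \<ge> 0 \<Longrightarrow>
      (\<And>t. t \<ge> S \<Longrightarrow> exc (g u) (g (2 * u)) (h t) \<le> k + 9) \<Longrightarrow>
      sep l1 h \<and> \<bar>horo l1 h - (busemann h (g u) + u) - horo l1 g\<bar> \<le> \<epsilon>"
    using horo_near_line[OF g rays(3) conjunct1[OF to_g[OF rays(3) sep(1)]] \<epsilon>, of "k + 9"] by blast
  obtain U2 where U2: "\<And>u h S. u \<ge> U2 \<Longrightarrow> h \<in> geodesic_rays \<Longrightarrow> S \<ge> 0 \<Longrightarrow>
      (\<And>t. t \<ge> S \<Longrightarrow> exc (g u) (g (2 * u)) (h t) \<le> k + 9) \<Longrightarrow>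
      sep l2 h \<and> \<bar>horo l2 h - (busemann h (g u) + u) - horo l2 g\<bar> \<le> \<epsilon>"
    using horo_near_line[OF g rays(4) conjunct1[OF to_g[OF rays(4) sep(2)]] \<epsilon>, of "k + 9"] by blast
  obtain V where V: "V > 0"
    "\<And>y p m q::'a. btw p m q \<Longrightarrow> exc y p m \<le> k + 4 \<Longrightarrow> dist p m \<ge> V \<Longrightarrow> exc y m q \<le> 1"
    using exc_decay[OF k4 zero_less_one] by metis
  define u where "u = max 1 (max U1 U2)"
  have u: "u \<ge> 1" "u \<ge> U1" "u \<ge> U2"
    unfolding u_def by auto
  obtain g' h' \<delta> t where gh: "g' \<in> GX" "h' \<in> GX" "\<delta> \<in> \<Gamma>" "t \<ge> 2 * u + V" "\<And>s. \<delta> (h' s) = g' (s + t)"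
    "\<And>s. \<bar>s\<bar> \<le> 2 * u + V \<Longrightarrow> dist (g' s) (g s) \<le> 1" "\<And>s. \<bar>s\<bar> \<le> 2 * u + V \<Longrightarrow> dist (h' s) (g s) \<le> 1"
    using non_wandering_recurrence[OF isom nonwandering g zero_less_one] by metis
  \<comment> \<open>4 for passing from \<open>g\<close> to \<open>h'\<close>, 1 for continuing along \<open>h'\<close>, 4 for passing from \<open>g'\<close> back to \<open>g\<close>\<close>
  have ex: "exc (g u) (g (2 * u)) ((\<delta> \<circ> e) s) \<le> k + 9" if s: "s \<ge> 0" for s
  proof -
    have near: "dist (g 0) (h' 0) \<le> 1" "dist (g (- V)) (h' (- V)) \<le> 1"
        "dist (g' (2 * u)) (g (2 * u)) \<le> 1" "dist (g' u) (g u) \<le> 1"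
      using gh(7)[of 0] gh(7)[of "- V"] gh(6)[of "2 * u"] gh(6)[of u] u V(1) by (auto simp: dist_commute)
    have "exc (e s) (h' 0) (h' (- V)) \<le> k + 4"
      using exc_perturb[of "e s" "e s" 0, OF _ near(1,2)] k[of s V] s V(1) by simp
    moreover from this have "exc (e s) (h' (- V)) (h' (u - t)) \<le> 1"
      using gh(4) u V(1) line_btw[OF gh(2), of "u - t" "- V" 0]
      by (intro V(2)[of "h' 0"]) (auto simp: btw_sym line_dist[OF gh(2)])
    ultimately have "exc (e s) (h' 0) (h' (u - t)) \<le> k + 5"
      using exc_split[of "h' 0" "h' (- V)" "h' (u - t)" "e s"] line_btw[OF gh(2), of "u - t" "- V" 0]
        gh(4) u V(1) by (simp add: btw_sym)
    then have "exc (\<delta> (e s)) (g' t) (g' u) \<le> k + 5"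
      using exc_isometry[of \<delta> "e s" "h' 0" "h' (u - t)"] iso[OF gh(3)] gh(5)[of 0] gh(5)[of "u - t"] by simp
    then have "exc (\<delta> (e s)) (g' (2 * u)) (g' u) \<le> k + 5"
      using exc_split[of "g' t" "g' (2 * u)" "g' u" "\<delta> (e s)"] line_btw[OF gh(1), of u "2 * u" t]
        gh(4) u V(1) exc_nonneg[of "\<delta> (e s)" "g' t" "g' (2 * u)"] by (simp add: btw_sym)
    then have "exc (\<delta> (e s)) (g (2 * u)) (g u) \<le> k + 9"
      using exc_perturb[of "\<delta> (e s)" "\<delta> (e s)" 0, OF _ near(3,4)] by simp
    then show ?thesis
      by (simp add: exc_sym)
  qed
  have \<delta>e: "\<delta> \<circ> e \<in> geodesic_rays"
    using isometry_ray[OF rays(1) iso[OF gh(3)]] .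
  show thesis
    using that[OF gh(3), of "busemann (\<delta> \<circ> e) (g u) + u"]
      U1[of u "\<delta> \<circ> e" 0, OF u(2) \<delta>e order_refl ex] U2[of u "\<delta> \<circ> e" 0, OF u(3) \<delta>e order_refl ex]
      to_g[OF rays(3) sep(1)] to_g[OF rays(4) sep(2)] by simp
qed

text \<open>The ends that are equidistant from the two endpoints of a long segment of \<open>c\<close> project to \<open>c\<close> near the
  midpoint \<open>c (v / 2)\<close> of that segment, by convexity; and the projection of an end is half the
  difference of its horospherical distances from the two ends of \<open>c\<close>.\<close>

lemma end_over_point:
  fixes c :: "real \<Rightarrow> 'a"
  assumes c: "c \<in> GX" and \<epsilon>: "\<epsilon> > 0"
  obtains r where "r \<in> geodesic_rays" "sep (past c) r" "sep c r"
    "\<bar>horo (past c) r - horo c r - v\<bar> \<le> \<epsilon>"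
proof -
  obtain R where R: "R > 0"
    "\<And>y p m q::'a. btw p m q \<Longrightarrow> exc y p m \<le> 3 \<Longrightarrow> dist p m \<ge> R \<Longrightarrow> exc y m q \<le> \<epsilon>"
    using exc_decay[of 3 \<epsilon>] \<epsilon> by auto
  define t where "t = v / 2"
  define x x' where "x = c (t - R)" and "x' = c (t + R)"
  obtain r where r: "r \<in> geodesic_rays" "busemann r x = busemann r x'"
    using equidistant by blast
  define b where "b = busemann r x"
  have b: "busemann r x = b" "busemann r x' = b"
    using r unfolding b_def by auto
  obtain T1 where T1: "T1 \<ge> 0" "\<And>\<tau>. \<tau> \<ge> T1 \<Longrightarrow> dist x (r \<tau>) - \<tau> \<le> b + 1"
    using busemann_approx[OF r(1) zero_less_one, of x] b by metis
  obtain T2 where T2: "T2 \<ge> 0" "\<And>\<tau>. \<tau> \<ge> T2 \<Longrightarrow> dist x' (r \<tau>) - \<tau> \<le> b + 1"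
    using busemann_approx[OF r(1) zero_less_one, of x'] b by metis
  have xx: "btw x (c t) x'" "dist x x' = 2 * R" "dist (c t) x' = R" "dist x (c t) = R"
    unfolding x_def x'_def using R(1) by (auto intro!: line_btw[OF c] simp: line_dist[OF c])
  \<comment> \<open>\<open>2\<close> bounds \<open>ln 4\<close>, which comes from \<open>exp u / 2 \<le> cosh u\<close>, used twice; \<open>1\<close> is the error
    in the values of the Busemann function.\<close>
  have mid: "exc (r \<tau>) (c t) x \<le> 3 \<and> exc (r \<tau>) (c t) x' \<le> 3" if \<tau>: "\<tau> \<ge> max T1 T2" for \<tau>
  proof -
    define Q F where "Q = b + \<tau> + 1" and "F = dist (r \<tau>) (c t)"
    have A: "dist (r \<tau>) x \<le> Q" "dist (r \<tau>) x' \<le> Q" "b + \<tau> \<le> dist (r \<tau>) x" "b + \<tau> \<le> dist (r \<tau>) x'"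
      using T1(2)[of \<tau>] T2(2)[of \<tau>] busemann_le[OF r(1), of \<tau> x] busemann_le[OF r(1), of \<tau> x'] b \<tau> T1(1)
      unfolding Q_def by (auto simp: dist_commute)
    have ch: "cosh (dist (r \<tau>) x) \<le> cosh Q" "cosh (dist (r \<tau>) x') \<le> cosh Q"
      using A by (metis cosh_real_nonneg_le_iff order_trans zero_le_dist)+
    have Q0: "Q \<ge> 0"
      using A(1) zero_le_dist order_trans by blast
    have "cosh F * sinh (2 * R) \<le> sinh R * cosh (dist (r \<tau>) x) + sinh R * cosh (dist (r \<tau>) x')"
      using stewart[OF xx(1), of "r \<tau>"] unfolding xx F_def by simp
    also have "\<dots> \<le> sinh R * cosh Q + sinh R * cosh Q"
      using ch R(1) by (intro add_mono mult_left_mono) auto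
    finally have "sinh R * (2 * (cosh F * cosh R)) \<le> sinh R * (2 * cosh Q)"
      unfolding sinh_double by (simp add: algebra_simps)
    then have "2 * (cosh F * cosh R) \<le> 2 * cosh Q"
      using R(1) mult_le_cancel_left_pos[of "sinh R"] by simp
    then have "cosh F * cosh R \<le> cosh Q"
      by simp
    moreover have "exp F / 2 * (exp R / 2) \<le> cosh F * cosh R"
      unfolding cosh_field_def by (intro mult_mono) auto
    moreover have "cosh Q \<le> exp Q"
      unfolding cosh_field_def using Q0 exp_le_cancel_iff[of "- Q" Q]
      by (simp add: divide_le_eq del: exp_le_cancel_iff)
    ultimately have "exp F / 2 * (exp R / 2) \<le> exp Q"
      by linarith
    then have "exp (F + R) \<le> 4 * exp Q"
      by (simp add: exp_add)
    also have "\<dots> \<le> exp 2 * exp Q"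
    proof -
      have "exp (1::real) ^ 2 \<ge> 2 ^ 2"
        using exp_ge_add_one_self[of "1::real"] by (intro power_mono) auto
      then have "exp (2::real) \<ge> 4"
        by (simp flip: exp_of_nat_mult)
      then show ?thesis
        by (intro mult_right_mono) auto
    qed
    finally have "F + R \<le> Q + 2"
      by (simp flip: exp_add)
    then show ?thesis
      using A xx unfolding exc_def F_def Q_def by (auto simp: dist_commute)
  qed
  define S where "S = max (max T1 T2) (\<bar>t\<bar> + R)"
  have S: "S \<ge> 0" "S \<ge> max T1 T2" "S \<ge> \<bar>t\<bar> + R"
    using T1(1) unfolding S_def by auto
  have 1: "exc (c s) x' (r \<tau>) \<le> \<epsilon>" if "s \<ge> S" "\<tau> \<ge> S" for s \<tau>
  proof -
    have "btw (c t) x' (c s)"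
      unfolding x'_def using that S R(1) by (intro line_btw[OF c]) auto
    then have "exc (r \<tau>) x' (c s) \<le> \<epsilon>"
      using mid[of \<tau>] that S(2) xx by (intro R(2)) auto
    then show ?thesis by (simp add: exc_sym)
  qed
  have 2: "exc (past c s) x (r \<tau>) \<le> \<epsilon>" if "s \<ge> S" "\<tau> \<ge> S" for s \<tau>
  proof -
    have "btw (c t) x (past c s)"
      unfolding x_def past_apply using that S R(1) line_btw[OF c, of "- s" "t - R" t] by (auto simp: btw_sym)
    then have "exc (r \<tau>) x (past c s) \<le> \<epsilon>"
      using mid[of \<tau>] that S(2) xx by (intro R(2)) (auto simp: dist_commute)
    then show ?thesis by (simp add: exc_sym)
  qed
  have "busemann c x' = - (t + R)" "busemann (past c) x = t - R"
    unfolding x_def x'_def by (simp_all add: busemann_line[OF c] busemann_past[OF c])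
  then show thesis
    using that[OF r(1)] horo_split[OF line_ray[OF c] r(1) S(1) 1]
      horo_split[OF line_ray[OF past_line[OF c]] r(1) S(1) 2] b unfolding t_def by simp
qed

text \<open>The geodesic from the end of \<open>l\<close> to that of \<open>\<delta> \<circ> \<gamma> ^^ n \<circ> h\<close> first approaches the axis
  \<open>\<delta> \<circ> c\<close>, then follows it for the time \<open>n \<omega>\<close> and leaves it as the geodesic from the origin of \<open>c\<close> to
  the end of \<open>h\<close> leaves \<open>c\<close>. All three horospherical distances are measured at the midpoint of the common
  part.\<close>

lemma horo_along_axis:
  fixes c l h :: "real \<Rightarrow> 'a"
  assumes c: "c \<in> GX" "\<gamma> \<in> \<Gamma>" "\<omega> > 0" "\<And>s. \<gamma> (c s) = c (s + \<omega>)" and \<delta>: "\<delta> \<in> \<Gamma>"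
    and lh: "l \<in> geodesic_rays" "h \<in> geodesic_rays" and sep: "sep l (\<delta> \<circ> c)" "sep (past c) h"
    and \<epsilon>: "\<epsilon> > 0"
  obtains n where "sep l (\<delta> \<circ> \<gamma> ^^ n \<circ> h)"
    "\<bar>horo l (\<delta> \<circ> \<gamma> ^^ n \<circ> h) - (horo l (\<delta> \<circ> c) + horo (past c) h + real n * \<omega>)\<bar> \<le> \<epsilon>"
proof -
  define c1 where "c1 = \<delta> \<circ> c"
  have c1: "c1 \<in> GX"
    unfolding c1_def by (rule isometry_line[OF c(1) iso[OF \<delta>]])
  define k where "k = max 0 (max (dist (l 0) (c1 0) - horo l c1) (dist (h 0) (c 0) - horo h (past c)))"
  have k: "k \<ge> 0"
    unfolding k_def by simp
  have kl: "exc (l s) (c1 0) (c1 u) \<le> k" if "s \<ge> 0" "u \<ge> 0" for s u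
    using exc_ray_le[OF lh(1) line_ray[OF c1] _ that] sep(1) unfolding k_def c1_def by simp
  have kh: "exc (h t) (c 0) (c (- v)) \<le> k" if "t \<ge> 0" "v \<ge> 0" for t v
    using exc_ray_le[OF lh(2) line_ray[OF past_line[OF c(1)]] _ that] sep(2) sep_sym[of h "past c"]
    unfolding k_def by (simp add: past_apply)
  have \<epsilon>3: "\<epsilon> / 3 > 0"
    using \<epsilon> by simp
  obtain R where R: "R > 0"
    "\<And>y p m q z::'a. btw p m q \<Longrightarrow> exc y p m \<le> k \<Longrightarrow> exc m q z \<le> k \<Longrightarrow>
       dist p m \<ge> R \<Longrightarrow> dist m q \<ge> R \<Longrightarrow> exc y m z \<le> \<epsilon> / 3"
    using exc_local_to_global[OF k \<epsilon>3] by metis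
  obtain R' where R': "R' > 0"
    "\<And>y p m q::'a. btw p m q \<Longrightarrow> exc y p m \<le> k \<Longrightarrow> dist p m \<ge> R' \<Longrightarrow> exc y m q \<le> \<epsilon> / 3"
    using exc_decay[OF k \<epsilon>3] by metis
  obtain n :: nat where n: "2 * max R R' < real n * \<omega>"
    using reals_Archimedean3[OF c(3)] by blast
  define L where "L = real n * \<omega>"
  have L: "L / 2 \<ge> R" "L / 2 \<ge> R'" "L > 0"
    using n R(1) unfolding L_def by auto
  have pow: "(\<gamma> ^^ i) (c s) = c (s + real i * \<omega>)" for i s
    by (induction i) (simp_all add: c(4) algebra_simps)
  define \<beta> where "\<beta> = \<delta> \<circ> \<gamma> ^^ n"
  have \<beta>: "\<beta> \<in> \<Gamma>"
    unfolding \<beta>_def using isometry_groupD(5)[OF isom \<delta>] isometry_groupD(6)[OF isom c(2)] by blast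
  have \<beta>c: "\<beta> (c s) = c1 (s + L)" for s
    unfolding \<beta>_def c1_def L_def using pow by simp
  define hn q where "hn = \<beta> \<circ> h" and "q = \<beta> \<circ> past c"
  have hn: "hn \<in> geodesic_rays"
    unfolding hn_def by (rule isometry_ray[OF lh(2) iso[OF \<beta>]])
  have q: "q \<in> geodesic_rays" "q v = c1 (L - v)" for v
    unfolding q_def using isometry_ray[OF line_ray[OF past_line[OF c(1)]] iso[OF \<beta>]] \<beta>c
    by (auto simp: past_apply add.commute)
  have khn: "exc (hn t) (c1 L) (c1 (L - v)) \<le> k" if "t \<ge> 0" "v \<ge> 0" for t v
    using kh[OF that] exc_isometry[of \<beta> "h t" "c 0" "c (- v)"] iso[OF \<beta>] \<beta>c[of 0] \<beta>c[of "- v"]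
    unfolding hn_def by simp
  define m where "m = c1 (L / 2)"
  have dm: "dist (c1 0) m = L / 2" "dist m (c1 L) = L / 2" "dist (c1 L) m = L / 2"
    unfolding m_def using L(3) by (simp_all add: line_dist[OF c1])
  have 1: "exc (l s) m (hn t) \<le> \<epsilon> / 3" if "s \<ge> 0" "t \<ge> 0" for s t
  proof (rule R(2))
    show "btw (c1 0) m (c1 L)"
      unfolding m_def using L(3) by (intro line_btw[OF c1]) auto
    show "exc (l s) (c1 0) m \<le> k"
      unfolding m_def using kl that L(3) by simp
    show "exc m (c1 L) (hn t) \<le> k"
      using khn[OF that(2), of "L / 2"] L(3) unfolding m_def by (simp add: exc_sym)
  qed (use dm L in auto)
  have 2: "exc (l s) m (c1 u) \<le> \<epsilon> / 3" if "s \<ge> L / 2" "u \<ge> L / 2" for s u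
  proof (rule R'(2))
    show "btw (c1 0) m (c1 u)"
      unfolding m_def using L(3) that by (intro line_btw[OF c1]) auto
    show "exc (l s) (c1 0) m \<le> k"
      unfolding m_def using kl that L(3) by simp
  qed (use dm L in auto)
  have 3: "exc (q v) m (hn t) \<le> \<epsilon> / 3" if "v \<ge> L / 2" "t \<ge> L / 2" for v t
  proof -
    have "exc (hn t) m (q v) \<le> \<epsilon> / 3"
    proof (rule R'(2))
      show "btw (c1 L) m (q v)"
        unfolding m_def q using L(3) that line_btw[OF c1, of "L - v" "L / 2" L] by (simp add: btw_sym)
      show "exc (hn t) (c1 L) m \<le> k"
        unfolding m_def using khn[of t "L / 2"] that L(3) by simp
    qed (use dm L in auto)
    then show ?thesis by (simp add: exc_sym)
  qed
  have L2: "L / 2 \<ge> 0"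
    using L by simp
  have "q = past (flow_GX L c1)"
    by (rule ext) (simp add: q(2) past_apply flow_GX_def)
  then have bq: "busemann q m = - (L / 2)"
    using busemann_past[OF flow_line[OF c1], of L "- (L / 2)"] by (simp add: m_def flow_GX_def)
  have bc: "busemann c1 m = - (L / 2)"
    unfolding m_def by (rule busemann_line[OF c1])
  have hq: "horo q hn = horo (past c) h"
    unfolding q_def hn_def by (rule sep_isometry(2)[OF iso[OF \<beta>]])
  have "sep l hn \<and> \<bar>horo l hn - (horo l c1 + horo (past c) h + L)\<bar> \<le> \<epsilon>"
    using horo_split[OF lh(1) hn order_refl 1] horo_split[OF lh(1) line_ray[OF c1] L2 2]
      horo_split[OF q(1) hn L2 3] bq bc hq by auto
  then show thesis
    using that[of n] unfolding hn_def \<beta>_def c1_def L_def by blast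
qed

end

section \<open>Transit times between closed geodesics\<close>

context recurrent_group
begin

text \<open>Modulo \<open>\<omega>\<close>, the times from \<open>c\<close> to \<open>d\<close> along the geodesics of the quotient that wind around \<open>c\<close>
  in the past and around \<open>d\<close> in the future.\<close>

definition transit :: "(real \<Rightarrow> 'a) \<Rightarrow> real \<Rightarrow> (real \<Rightarrow> 'a) \<Rightarrow> real set" where
  "transit c \<omega> d =
     {horo (past c) (\<delta> \<circ> d) + real_of_int m * \<omega> | \<delta> m. \<delta> \<in> \<Gamma> \<and> sep (past c) (\<delta> \<circ> d)}"

lemma transitI: "\<delta> \<in> \<Gamma> \<Longrightarrow> sep (past c) (\<delta> \<circ> d) \<Longrightarrow>
    horo (past c) (\<delta> \<circ> d) + real_of_int m * \<omega> \<in> transit c \<omega> d"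
  unfolding transit_def by blast

lemma transit_add:
  assumes c: "c \<in> GX" "\<gamma> \<in> \<Gamma>" "\<omega> > 0" "\<And>s. \<gamma> (c s) = c (s + \<omega>)" and d: "d \<in> GX"
    and xy: "x \<in> transit c \<omega> c" "y \<in> transit c \<omega> d"
  shows "x + y \<in> closure (transit c \<omega> d)"
  unfolding closure_approachable
proof (intro allI impI)
  fix e :: real assume "e > 0"
  then have e: "e / 2 > 0"
    by simp
  obtain \<delta> m where x: "\<delta> \<in> \<Gamma>" "sep (past c) (\<delta> \<circ> c)" "x = horo (past c) (\<delta> \<circ> c) + real_of_int m * \<omega>"
    using xy(1) unfolding transit_def by blast
  obtain \<delta>' m' where y: "\<delta>' \<in> \<Gamma>" "sep (past c) (\<delta>' \<circ> d)" "y = horo (past c) (\<delta>' \<circ> d) + real_of_int m' * \<omega>"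
    using xy(2) unfolding transit_def by blast
  have h: "\<delta>' \<circ> d \<in> geodesic_rays"
    using isometry_ray[OF line_ray[OF d] iso[OF y(1)]] .
  obtain n where n: "sep (past c) (\<delta> \<circ> \<gamma> ^^ n \<circ> (\<delta>' \<circ> d))"
    "\<bar>horo (past c) (\<delta> \<circ> \<gamma> ^^ n \<circ> (\<delta>' \<circ> d))
        - (horo (past c) (\<delta> \<circ> c) + horo (past c) (\<delta>' \<circ> d) + real n * \<omega>)\<bar> \<le> e / 2"
    using horo_along_axis[OF c x(1) line_ray[OF past_line[OF c(1)]] h x(2) y(2) e] by blast
  define \<beta> where "\<beta> = \<delta> \<circ> \<gamma> ^^ n \<circ> \<delta>'"
  have \<beta>: "\<beta> \<in> \<Gamma>"
    unfolding \<beta>_def using isometry_groupD(5)[OF isom] isometry_groupD(6)[OF isom c(2)] x(1) y(1) by blast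
  have "horo (past c) (\<beta> \<circ> d) + real_of_int (m + m' - int n) * \<omega> \<in> transit c \<omega> d"
    using n(1) by (intro transitI[OF \<beta>]) (simp add: \<beta>_def comp_assoc)
  moreover have "\<bar>horo (past c) (\<beta> \<circ> d) + real_of_int (m + m' - int n) * \<omega> - (x + y)\<bar> \<le> e / 2"
    using n(2) unfolding x(3) y(3) \<beta>_def by (simp add: comp_assoc algebra_simps)
  ultimately show "\<exists>z\<in>transit c \<omega> d. dist z (x + y) < e"
    using \<open>e > 0\<close> by (intro bexI) (auto simp: dist_real_def)
qed

lemma closure_transit_add:
  assumes c: "c \<in> GX" "\<gamma> \<in> \<Gamma>" "\<omega> > 0" "\<And>s. \<gamma> (c s) = c (s + \<omega>)" and d: "d \<in> GX"
    and xy: "x \<in> closure (transit c \<omega> c)" "y \<in> closure (transit c \<omega> d)"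
  shows "x + y \<in> closure (transit c \<omega> d)"
proof -
  obtain xs where xs: "\<And>n. xs n \<in> transit c \<omega> c" "xs \<longlonglongrightarrow> x"
    using xy(1) unfolding closure_sequential by blast
  obtain ys where ys: "\<And>n. ys n \<in> transit c \<omega> d" "ys \<longlonglongrightarrow> y"
    using xy(2) unfolding closure_sequential by blast
  show ?thesis
  proof (rule closed_sequentially[OF closed_closure])
    show "xs n + ys n \<in> closure (transit c \<omega> d)" for n
      using transit_add[OF c d xs(1) ys(1)] by blast
    show "(\<lambda>n. xs n + ys n) \<longlonglongrightarrow> x + y"
      using xs(2) ys(2) by (rule tendsto_add)
  qed
qed

lemma period_in_transit:
  assumes c: "c \<in> GX"
  shows "real_of_int m * \<omega> \<in> transit c \<omega> c"
  using transitI[of id c c m \<omega>] isom sep_line[OF c] horo_line[OF c]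
  unfolding isometry_group_def by simp

text \<open>A closed subsemigroup of the circle \<open>\<real> / \<omega>\<int>\<close> is a group: some multiple \<open>k x\<close>, \<open>k > 0\<close>, is
  close to zero, and then \<open>(k - 1) x\<close> is close to \<open>- x\<close>.\<close>

lemma closure_transit_minus:
  assumes c: "c \<in> GX" "\<gamma> \<in> \<Gamma>" "\<omega> > 0" "\<And>s. \<gamma> (c s) = c (s + \<omega>)"
    and x: "x \<in> closure (transit c \<omega> c)"
  shows "- x \<in> closure (transit c \<omega> c)"
proof -
  let ?G = "closure (transit c \<omega> c)"
  note add = closure_transit_add[OF c c(1)]
  have per: "real_of_int m * \<omega> \<in> ?G" for m
    using period_in_transit[OF c(1)] closure_subset by blast
  have mult: "real k * x \<in> ?G" for k
  proof (induction k)
    case 0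
    then show ?case
      using per[of 0] by simp
  next
    case (Suc k)
    then show ?case
      using add[OF x Suc] by (simp add: algebra_simps)
  qed
  have "- x \<in> closure ?G"
    unfolding closure_approachable
  proof (intro allI impI)
    fix e :: real assume e: "e > 0"
    obtain N :: nat where N: "\<omega> / e < real N"
      using reals_Archimedean2 by blast
    moreover have "\<omega> / e > 0"
      using c(3) e by simp
    ultimately have N0: "N > 0"
      by (cases N) auto
    obtain h k where hk: "0 < k" "\<bar>of_int k * (x / \<omega>) - of_int h\<bar> < 1 / N"
      using Dirichlet_approx[OF N0, of "x / \<omega>"] by blast
    have "\<bar>of_int k * x - of_int h * \<omega>\<bar> = \<bar>of_int k * (x / \<omega>) - of_int h\<bar> * \<omega>"
      using c(3) by (simp add: abs_mult_pos field_simps)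
    also have "\<dots> < 1 / N * \<omega>"
      using hk(2) c(3) by (rule mult_strict_right_mono)
    also have "\<dots> < e"
      using N N0 e by (simp add: field_simps)
    finally have small: "\<bar>of_int k * x - of_int h * \<omega>\<bar> < e" .
    have "real (nat (k - 1)) * x + real_of_int (- h) * \<omega> \<in> ?G"
      by (rule add[OF mult per])
    moreover have "dist (real (nat (k - 1)) * x + real_of_int (- h) * \<omega>) (- x) < e"
      using small hk(1) by (simp add: dist_real_def of_nat_nat algebra_simps)
    ultimately show "\<exists>y\<in>?G. dist y (- x) < e"
      by blast
  qed
  then show ?thesis
    by simp
qed

text \<open>The cross ratio of the origin of \<open>c\<close> and its endpoint with ends \<open>r0\<close> over \<open>c (v / 2)\<close> and \<open>r1\<close>
  over \<open>c 0\<close> is about \<open>v\<close>. Three of these four ends are replaced in turn by translates of the ends of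
  \<open>c\<close>. The unknown heights \<open>\<kappa>\<close>, \<open>\<kappa>0\<close>, \<open>\<kappa>1\<close> of the new horospheres cancel in the cross ratio, which
  is then an alternating sum of transit times.\<close>

lemma closure_transit_self:
  assumes c: "c \<in> GX" "\<gamma> \<in> \<Gamma>" "\<omega> > 0" "\<And>s. \<gamma> (c s) = c (s + \<omega>)"
  shows "closure (transit c \<omega> c) = UNIV"
proof -
  let ?G = "closure (transit c \<omega> c)"
  note add = closure_transit_add[OF c c(1)]
  note minus = closure_transit_minus[OF c]
  have tG: "horo (past c) (\<delta> \<circ> c) \<in> ?G" if "\<delta> \<in> \<Gamma>" "sep (past c) (\<delta> \<circ> c)" for \<delta>
    using transitI[OF that, of 0 \<omega>] closure_subset by auto
  have "v \<in> closure ?G" for v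
    unfolding closure_approachable
  proof (intro allI impI)
    fix e :: real assume e: "e > 0"
    define \<epsilon> where "\<epsilon> = e / 9"
    have \<epsilon>: "\<epsilon> > 0"
      using e unfolding \<epsilon>_def by simp
    have rc: "c \<in> geodesic_rays" "past c \<in> geodesic_rays"
      using c(1) past_line line_ray by blast+
    obtain r0 where r0: "r0 \<in> geodesic_rays" "sep (past c) r0" "sep c r0"
      "\<bar>horo (past c) r0 - horo c r0 - v\<bar> \<le> \<epsilon>"
      using end_over_point[OF c(1) \<epsilon>] by blast
    obtain r1 where r1: "r1 \<in> geodesic_rays" "sep (past c) r1" "sep c r1"
      "\<bar>horo (past c) r1 - horo c r1 - 0\<bar> \<le> \<epsilon>"
      using end_over_point[OF c(1) \<epsilon>] by blast
    obtain \<delta> \<kappa> where \<delta>: "\<delta> \<in> \<Gamma>" "sep r0 (\<delta> \<circ> past c)" "sep r1 (\<delta> \<circ> past c)"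
      "\<bar>horo r0 (\<delta> \<circ> past c) - \<kappa> - horo r0 c\<bar> \<le> \<epsilon>" "\<bar>horo r1 (\<delta> \<circ> past c) - \<kappa> - horo r1 c\<bar> \<le> \<epsilon>"
      using approximate_end[OF rc(2,1) r0(1) r1(1) _ _ \<epsilon>] r0(3) r1(3) sep_sym by metis
    define p where "p = \<delta> \<circ> past c"
    have p: "p \<in> geodesic_rays" "sep p r0" "sep p r1"
      unfolding p_def using isometry_ray[OF rc(2) iso[OF \<delta>(1)]] \<delta>(2,3) sep_sym by auto
    obtain \<delta>0 \<kappa>0 where \<delta>0: "\<delta>0 \<in> \<Gamma>" "sep (past c) (\<delta>0 \<circ> c)" "sep p (\<delta>0 \<circ> c)"
      "\<bar>horo (past c) (\<delta>0 \<circ> c) - \<kappa>0 - horo (past c) r0\<bar> \<le> \<epsilon>" "\<bar>horo p (\<delta>0 \<circ> c) - \<kappa>0 - horo p r0\<bar> \<le> \<epsilon>"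
      using approximate_end[OF rc(1) r0(1) rc(2) p(1) r0(2) p(2) \<epsilon>] by metis
    obtain \<delta>1 \<kappa>1 where \<delta>1: "\<delta>1 \<in> \<Gamma>" "sep (past c) (\<delta>1 \<circ> c)" "sep p (\<delta>1 \<circ> c)"
      "\<bar>horo (past c) (\<delta>1 \<circ> c) - \<kappa>1 - horo (past c) r1\<bar> \<le> \<epsilon>" "\<bar>horo p (\<delta>1 \<circ> c) - \<kappa>1 - horo p r1\<bar> \<le> \<epsilon>"
      using approximate_end[OF rc(1) r1(1) rc(2) p(1) r1(2) p(3) \<epsilon>] by metis
    have pG: "horo p (\<beta> \<circ> c) \<in> ?G" if \<beta>: "\<beta> \<in> \<Gamma>" "sep p (\<beta> \<circ> c)" for \<beta>
    proof -
      have i: "inv \<delta> \<in> \<Gamma>"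
        using isometry_groupD(2)[OF isom \<delta>(1)] .
      have eq: "inv \<delta> \<circ> p = past c" "inv \<delta> \<circ> (\<beta> \<circ> c) = (inv \<delta> \<circ> \<beta>) \<circ> c"
        unfolding p_def using isometry_groupD(3)[OF isom \<delta>(1)] by (auto simp: fun_eq_iff)
      have "horo (past c) ((inv \<delta> \<circ> \<beta>) \<circ> c) = horo p (\<beta> \<circ> c)" "sep (past c) ((inv \<delta> \<circ> \<beta>) \<circ> c)"
        using sep_isometry[OF iso[OF i], of p "\<beta> \<circ> c"] \<beta>(2) unfolding eq by auto
      moreover have "inv \<delta> \<circ> \<beta> \<in> \<Gamma>"
        using isometry_groupD(5)[OF isom i \<beta>(1)] .
      ultimately show ?thesis
        using tG by metis
    qed
    define z where "z = (horo (past c) (\<delta>0 \<circ> c) + horo p (\<delta>1 \<circ> c))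
        + (- horo (past c) (\<delta>1 \<circ> c) + - horo p (\<delta>0 \<circ> c))"
    have "z \<in> ?G"
      unfolding z_def by (intro add minus tG pG \<delta>0 \<delta>1)
    moreover have "\<bar>z - v\<bar> \<le> 8 * \<epsilon>"
      using r0(4) r1(4) \<delta>(4,5) \<delta>0(4,5) \<delta>1(4,5)
      unfolding z_def horo_sym[of r0] horo_sym[of r1] p_def[symmetric] abs_le_iff by linarith
    then have "dist z v < e"
      unfolding \<epsilon>_def dist_real_def using e by simp
    ultimately show "\<exists>y\<in>?G. dist y v < e"
      by blast
  qed
  then show ?thesis
    by auto
qed

lemma closure_transit:
  assumes c: "c \<in> GX" "\<gamma> \<in> \<Gamma>" "\<omega> > 0" "\<And>s. \<gamma> (c s) = c (s + \<omega>)" and d: "d \<in> GX"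
  shows "closure (transit c \<omega> d) = UNIV"
proof -
  have rays: "c \<in> geodesic_rays" "past c \<in> geodesic_rays" "d \<in> geodesic_rays"
    using c(1) d past_line line_ray by blast+
  obtain \<delta> where \<delta>: "\<delta> \<in> \<Gamma>" "sep (past c) (\<delta> \<circ> d)"
    using approximate_end[OF rays(3,1,2,2) sep_line[OF c(1)] sep_line[OF c(1)] zero_less_one] by metis
  define y where "y = horo (past c) (\<delta> \<circ> d) + real_of_int 0 * \<omega>"
  have y: "y \<in> closure (transit c \<omega> d)"
    unfolding y_def using transitI[OF \<delta>] closure_subset by blast
  have "(v - y) + y \<in> closure (transit c \<omega> d)" for v
    by (rule closure_transit_add[OF c d _ y]) (simp add: closure_transit_self[OF c])
  then show ?thesis
    by auto
qed

section \<open>Heteroclinic geodesics and mixing\<close>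

lemma axis_power:
  assumes "\<And>s. \<gamma> (c s) = c (s + \<omega>)"
  shows "(\<gamma> ^^ n) (c s) = c (s + real n * \<omega>)"
  by (induction n) (simp_all add: assms algebra_simps)

text \<open>The line that joins the origin of \<open>c\<close> to the endpoint of \<open>\<delta> \<circ> d\<close> converges to
  both of them, so far in the past and in the future it stays near them with no drift in time. Moving
  it by powers of \<open>\<gamma>\<close> shifts the starting point.\<close>

lemma heteroclinic:
  assumes c: "c \<in> GX" "\<gamma> \<in> \<Gamma>" "\<omega> > 0" "\<And>s. \<gamma> (c s) = c (s + \<omega>)"
    and d: "d \<in> GX" "\<gamma>' \<in> \<Gamma>" "\<omega>' > 0" "\<And>s. \<gamma>' (d s) = d (s + \<omega>')"
    and x: "x \<in> transit c \<omega> d" and \<epsilon>: "\<epsilon> > 0"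
  shows "\<exists>N::nat. \<forall>p\<ge>N. \<forall>q\<ge>N. \<exists>f\<in>GX. \<exists>\<beta>\<in>\<Gamma>. \<forall>s. \<bar>s\<bar> \<le> R \<longrightarrow>
    dist (f s) (c s) \<le> \<epsilon> \<and> dist (f (s + (x + real p * \<omega> + real q * \<omega>'))) (\<beta> (d s)) \<le> \<epsilon>"
proof -
  obtain \<delta> m where \<delta>: "\<delta> \<in> \<Gamma>" "sep (past c) (\<delta> \<circ> d)"
    and x: "x = horo (past c) (\<delta> \<circ> d) + real_of_int m * \<omega>"
    using x unfolding transit_def by blast
  define D where "D = horo (past c) (\<delta> \<circ> d)"
  have \<delta>d: "\<delta> \<circ> d \<in> geodesic_rays"
    using isometry_ray[OF line_ray[OF d(1)] iso[OF \<delta>(1)]] .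
  obtain f where f: "f \<in> GX"
    and fT: "\<And>\<epsilon>. \<epsilon> > 0 \<Longrightarrow> \<exists>T. \<forall>t\<ge>T. dist (f (- t)) (past c t) \<le> \<epsilon> \<and> dist (f (D + t)) ((\<delta> \<circ> d) t) \<le> \<epsilon>"
    using joining_line_converges[OF line_ray[OF past_line[OF c(1)]] \<delta>d \<delta>(2)] unfolding D_def by metis
  obtain T where T: "\<And>t. t \<ge> T \<Longrightarrow> dist (f (- t)) (c (- t)) \<le> \<epsilon>" "\<And>t. t \<ge> T \<Longrightarrow> dist (f (D + t)) (\<delta> (d t)) \<le> \<epsilon>"
    using fT[OF \<epsilon>] by (auto simp: past_apply)
  obtain N1 :: nat where N1: "\<bar>T\<bar> + \<bar>R\<bar> < real N1 * \<omega>"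
    using reals_Archimedean3[OF c(3)] by blast
  obtain N2 :: nat where N2: "\<bar>T\<bar> + \<bar>R\<bar> < real N2 * \<omega>'"
    using reals_Archimedean3[OF d(3)] by blast
  define N where "N = N1 + N2 + nat \<bar>m\<bar>"
  show ?thesis
  proof (rule exI[of _ N], intro allI impI)
    fix p q :: nat assume pq: "p \<ge> N" "q \<ge> N"
    define n where "n = nat (int p + m)"
    have n: "int n = int p + m" "n \<ge> N1"
      using pq unfolding n_def N_def by auto
    have n\<omega>: "real n * \<omega> \<ge> \<bar>T\<bar> + \<bar>R\<bar>" and q\<omega>: "real q * \<omega>' \<ge> \<bar>T\<bar> + \<bar>R\<bar>"
    proof -
      have "real N1 * \<omega> \<le> real n * \<omega>" "real N2 * \<omega>' \<le> real q * \<omega>'"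
        using n(2) pq(2) c(3) d(3) unfolding N_def by (auto intro!: mult_right_mono)
      with N1 N2 show "real n * \<omega> \<ge> \<bar>T\<bar> + \<bar>R\<bar>" "real q * \<omega>' \<ge> \<bar>T\<bar> + \<bar>R\<bar>"
        by auto
    qed
    have time: "x + real p * \<omega> + real q * \<omega>' = D + real n * \<omega> + real q * \<omega>'"
    proof -
      have "real n = real p + real_of_int m"
        using n(1) by (metis of_int_add of_int_of_nat_eq)
      then show ?thesis
        unfolding x D_def by (simp add: algebra_simps)
    qed
    define \<beta> where "\<beta> = \<gamma> ^^ n \<circ> (\<delta> \<circ> \<gamma>' ^^ q)"
    have \<gamma>n: "\<gamma> ^^ n \<in> \<Gamma>"
      using isometry_groupD(6)[OF isom c(2)] .
    have \<beta>: "\<beta> \<in> \<Gamma>"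
      unfolding \<beta>_def using isometry_groupD(5)[OF isom] \<gamma>n \<delta>(1) isometry_groupD(6)[OF isom d(2)] by blast
    define f' where "f' = \<gamma> ^^ n \<circ> flow_GX (- (real n * \<omega>)) f"
    have f': "f' \<in> GX"
      unfolding f'_def by (rule isometry_line[OF flow_line[OF f] iso[OF \<gamma>n]])
    have "dist (f' s) (c s) \<le> \<epsilon> \<and> dist (f' (s + (x + real p * \<omega> + real q * \<omega>'))) (\<beta> (d s)) \<le> \<epsilon>"
      if s: "\<bar>s\<bar> \<le> R" for s
    proof
      have "dist (f' s) ((\<gamma> ^^ n) (c (s - real n * \<omega>))) \<le> \<epsilon>"
        using T(1)[of "real n * \<omega> - s"] s n\<omega> iso[OF \<gamma>n] unfolding f'_def flow_GX_def by simp
      then show "dist (f' s) (c s) \<le> \<epsilon>"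
        using axis_power[of \<gamma> c \<omega>, OF c(4), of n "s - real n * \<omega>"] by simp
      have "f' (s + (x + real p * \<omega> + real q * \<omega>')) = (\<gamma> ^^ n) (f (D + (s + real q * \<omega>')))"
        unfolding time f'_def flow_GX_def by (simp add: algebra_simps)
      moreover have "\<beta> (d s) = (\<gamma> ^^ n) (\<delta> (d (s + real q * \<omega>')))"
        unfolding \<beta>_def using axis_power[of \<gamma>' d \<omega>', OF d(4)] by simp
      ultimately show "dist (f' (s + (x + real p * \<omega> + real q * \<omega>'))) (\<beta> (d s)) \<le> \<epsilon>"
        using T(2)[of "s + real q * \<omega>'"] s q\<omega> iso[OF \<gamma>n] by simp
    qed
    then show "\<exists>f\<in>GX. \<exists>\<beta>\<in>\<Gamma>. \<forall>s. \<bar>s\<bar> \<le> R \<longrightarrow>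
        dist (f s) (c s) \<le> \<epsilon> \<and> dist (f (s + (x + real p * \<omega> + real q * \<omega>'))) (\<beta> (d s)) \<le> \<epsilon>"
      using f' \<beta> by blast
  qed
qed

text \<open>Finitely many transit times \<open>x j\<close> come close to every number modulo \<open>\<omega>\<close>; a single bound \<open>M\<close>
  for the number of turns serves all of them. The turns around \<open>d\<close> are kept fixed and those around \<open>c\<close>
  make up for the length of \<open>t\<close>.\<close>

lemma mixing_lines:
  assumes g: "g \<in> GX" "h \<in> GX" and \<epsilon>: "\<epsilon> > 0" and R: "R \<ge> 0"
  obtains t0 where "t0 > 0" "\<And>t. t \<ge> t0 \<Longrightarrow> \<exists>f\<in>GX. \<exists>\<beta>\<in>\<Gamma>. \<forall>s. \<bar>s\<bar> \<le> R \<longrightarrow>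
    dist (f s) (g s) < \<epsilon> \<and> dist (f (s + t)) (\<beta> (h s)) < \<epsilon>"
proof -
  define \<eta> where "\<eta> = \<epsilon> / 4"
  have \<eta>: "\<eta> > 0"
    using \<epsilon> unfolding \<eta>_def by simp
  obtain c \<gamma> \<omega> where c: "c \<in> GX" "\<gamma> \<in> \<Gamma>" "\<omega> > 0" "\<And>s. \<gamma> (c s) = c (s + \<omega>)"
    and cg: "\<And>s. \<bar>s\<bar> \<le> R \<Longrightarrow> dist (c s) (g s) \<le> \<eta>"
    using closing[OF g(1) \<eta> R] by metis
  obtain d \<gamma>' \<omega>' where d: "d \<in> GX" "\<gamma>' \<in> \<Gamma>" "\<omega>' > 0" "\<And>s. \<gamma>' (d s) = d (s + \<omega>')"
    and dh: "\<And>s. \<bar>s\<bar> \<le> R \<Longrightarrow> dist (d s) (h s) \<le> \<eta>"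
    using closing[OF g(2) \<eta> R] by metis
  have "\<exists>x\<in>transit c \<omega> d. dist x (real j * \<eta>) < \<eta>" for j :: nat
    using closure_transit[OF c d(1)] \<eta> by (metis UNIV_I closure_approachable)
  then obtain x where x: "\<And>j. x j \<in> transit c \<omega> d" "\<And>j :: nat. \<bar>x j - real j * \<eta>\<bar> < \<eta>"
    unfolding dist_real_def by metis
  have "\<forall>j. \<exists>N::nat. \<forall>p\<ge>N. \<forall>q\<ge>N. \<exists>f\<in>GX. \<exists>\<beta>\<in>\<Gamma>. \<forall>s. \<bar>s\<bar> \<le> R \<longrightarrow>
    dist (f s) (c s) \<le> \<eta> \<and> dist (f (s + (x j + real p * \<omega> + real q * \<omega>'))) (\<beta> (d s)) \<le> \<eta>"
    using heteroclinic[OF c d x(1) \<eta>] by blast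
  then obtain N :: "nat \<Rightarrow> nat" where N: "\<And>j p q. p \<ge> N j \<Longrightarrow> q \<ge> N j \<Longrightarrow> \<exists>f\<in>GX. \<exists>\<beta>\<in>\<Gamma>. \<forall>s. \<bar>s\<bar> \<le> R \<longrightarrow>
    dist (f s) (c s) \<le> \<eta> \<and> dist (f (s + (x j + real p * \<omega> + real q * \<omega>'))) (\<beta> (d s)) \<le> \<eta>"
    by metis
  define J where "J = nat \<lceil>\<omega> / \<eta>\<rceil>"
  define M where "M = Max (N ` {..J})"
  have M: "N j \<le> M" if "j \<le> J" for j
    unfolding M_def using that by (intro Max_ge) auto
  define t0 where "t0 = real (M + 1) * \<omega> + real M * \<omega>' + 1"
  have t0: "t0 > 0"
    unfolding t0_def using c(3) d(3) by (simp add: add_nonneg_pos)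
  have "\<exists>f\<in>GX. \<exists>\<beta>\<in>\<Gamma>. \<forall>s. \<bar>s\<bar> \<le> R \<longrightarrow> dist (f s) (g s) < \<epsilon> \<and> dist (f (s + t)) (\<beta> (h s)) < \<epsilon>"
    if t: "t \<ge> t0" for t
  proof -
    define v where "v = t - real M * \<omega>'"
    define p where "p = nat \<lfloor>v / \<omega>\<rfloor>"
    define \<rho> where "\<rho> = v - real p * \<omega>"
    have "v \<ge> real (M + 1) * \<omega>"
      using t unfolding t0_def v_def by simp
    then have vM: "v / \<omega> \<ge> real (M + 1)"
      using c(3) by (simp add: field_simps)
    then have "real p = of_int \<lfloor>v / \<omega>\<rfloor>" and pM: "p \<ge> M"
      unfolding p_def by (auto simp: le_nat_iff le_floor_iff)
    then have "real p \<le> v / \<omega>" "v / \<omega> < real p + 1"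
      by linarith+
    then have \<rho>: "0 \<le> \<rho>" "\<rho> < \<omega>"
      unfolding \<rho>_def using c(3) by (simp_all add: field_simps)
    define j where "j = nat \<lfloor>\<rho> / \<eta>\<rfloor>"
    have "real j = of_int \<lfloor>\<rho> / \<eta>\<rfloor>"
      unfolding j_def using \<rho> \<eta> by simp
    then have "real j \<le> \<rho> / \<eta>" "\<rho> / \<eta> < real j + 1"
      by linarith+
    then have j: "real j * \<eta> \<le> \<rho>" "\<rho> < real j * \<eta> + \<eta>"
      using \<eta> by (simp_all add: field_simps)
    have "j \<le> J"
    proof -
      have "\<rho> / \<eta> \<le> \<omega> / \<eta>"
        using \<rho> \<eta> by (simp add: divide_right_mono)
      then have "\<lfloor>\<rho> / \<eta>\<rfloor> \<le> \<lceil>\<omega> / \<eta>\<rceil>"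
        by linarith
      then show ?thesis
        unfolding j_def J_def by (rule nat_mono)
    qed
    define t' where "t' = x j + real p * \<omega> + real M * \<omega>'"
    have tt': "\<bar>t - t'\<bar> < 2 * \<eta>"
      using x(2)[of j] j unfolding t'_def \<rho>_def v_def by linarith
    obtain f \<beta> where f: "f \<in> GX" "\<beta> \<in> \<Gamma>"
      "\<And>s. \<bar>s\<bar> \<le> R \<Longrightarrow> dist (f s) (c s) \<le> \<eta> \<and> dist (f (s + t')) (\<beta> (d s)) \<le> \<eta>"
      using N[of j p M] M[OF \<open>j \<le> J\<close>] pM unfolding t'_def by (meson order_trans)
    have "dist (f s) (g s) < \<epsilon> \<and> dist (f (s + t)) (\<beta> (h s)) < \<epsilon>" if s: "\<bar>s\<bar> \<le> R" for s
    proof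
      show "dist (f s) (g s) < \<epsilon>"
        using f(3)[OF s] cg[OF s] dist_triangle[of "f s" "g s" "c s"] \<eta> unfolding \<eta>_def by simp
      have "dist (f (s + t)) (f (s + t')) < 2 * \<eta>"
        using tt' by (simp add: line_dist[OF f(1)])
      moreover have "dist (f (s + t')) (\<beta> (h s)) \<le> 2 * \<eta>"
        using f(3)[OF s] dh[OF s] iso[OF f(2), of "d s" "h s"]
          dist_triangle[of "f (s + t')" "\<beta> (h s)" "\<beta> (d s)"] by simp
      ultimately show "dist (f (s + t)) (\<beta> (h s)) < \<epsilon>"
        using dist_triangle[of "f (s + t)" "\<beta> (h s)" "f (s + t')"] unfolding \<eta>_def by simp
    qed
    then show ?thesis
      using f(1,2) by blast
  qed
  with t0 show thesis
    using that by blast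
qed

lemma open_GY_contains_tube:
  assumes A: "openin (GY_topology \<Gamma>) A" "A \<noteq> {}"
  obtains g R \<epsilon> where "g \<in> GX" "R \<ge> 0" "\<epsilon> > 0"
    "\<And>f. f \<in> GX \<Longrightarrow> (\<And>s. \<bar>s\<bar> \<le> R \<Longrightarrow> dist (f s) (g s) < \<epsilon>) \<Longrightarrow> proj_GY \<Gamma> f \<in> A"
proof -
  have AG: "A \<subseteq> GY \<Gamma>" and op: "openin GX_topology {g \<in> GX. proj_GY \<Gamma> g \<in> A}"
    using A(1) unfolding openin_GY_topology by auto
  obtain g where g: "g \<in> GX" "proj_GY \<Gamma> g \<in> A"
    using A(2) AG unfolding GY_def by blast
  then have "g \<in> {g \<in> GX. proj_GY \<Gamma> g \<in> A}"
    by simp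
  with op obtain K \<epsilon> where K: "compact K" "\<epsilon> > 0"
    "{h \<in> GX. \<forall>t\<in>K. dist (h t) (g t) < \<epsilon>} \<subseteq> {g \<in> GX. proj_GY \<Gamma> g \<in> A}"
    unfolding openin_GX_topology by blast
  obtain R where "\<And>t. t \<in> K \<Longrightarrow> \<bar>t\<bar> \<le> R"
    using compact_imp_bounded[OF K(1)] unfolding bounded_iff by auto
  then have "proj_GY \<Gamma> f \<in> A" if "f \<in> GX" "\<And>s. \<bar>s\<bar> \<le> max R 0 \<Longrightarrow> dist (f s) (g s) < \<epsilon>" for f
    using K(3) that by fastforce
  then show thesis
    using that[OF g(1) _ K(2), of "max R 0"] by simp
qed

lemma mixing_forward:
  assumes A: "openin (GY_topology \<Gamma>) A" "A \<noteq> {}" and B: "openin (GY_topology \<Gamma>) B" "B \<noteq> {}"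
  obtains t0 where "t0 > 0"
    "\<And>t. t \<ge> t0 \<Longrightarrow> \<exists>f\<in>GX. proj_GY \<Gamma> f \<in> A \<and> proj_GY \<Gamma> (flow_GX t f) \<in> B"
proof -
  obtain g R1 \<epsilon>1 where g: "g \<in> GX" "R1 \<ge> 0" "\<epsilon>1 > 0"
    "\<And>f. f \<in> GX \<Longrightarrow> (\<And>s. \<bar>s\<bar> \<le> R1 \<Longrightarrow> dist (f s) (g s) < \<epsilon>1) \<Longrightarrow> proj_GY \<Gamma> f \<in> A"
    using open_GY_contains_tube[OF A] by blast
  obtain h R2 \<epsilon>2 where h: "h \<in> GX" "R2 \<ge> 0" "\<epsilon>2 > 0"
    "\<And>f. f \<in> GX \<Longrightarrow> (\<And>s. \<bar>s\<bar> \<le> R2 \<Longrightarrow> dist (f s) (h s) < \<epsilon>2) \<Longrightarrow> proj_GY \<Gamma> f \<in> B"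
    using open_GY_contains_tube[OF B] by blast
  define R \<epsilon> where "R = max R1 R2" and "\<epsilon> = min \<epsilon>1 \<epsilon>2"
  have R\<epsilon>: "\<epsilon> > 0" "R \<ge> 0"
    using g h unfolding R_def \<epsilon>_def by auto
  obtain t0 where t0: "t0 > 0" "\<And>t. t \<ge> t0 \<Longrightarrow> \<exists>f\<in>GX. \<exists>\<beta>\<in>\<Gamma>. \<forall>s. \<bar>s\<bar> \<le> R \<longrightarrow>
      dist (f s) (g s) < \<epsilon> \<and> dist (f (s + t)) (\<beta> (h s)) < \<epsilon>"
    using mixing_lines[OF g(1) h(1) R\<epsilon>] by metis
  have "\<exists>f\<in>GX. proj_GY \<Gamma> f \<in> A \<and> proj_GY \<Gamma> (flow_GX t f) \<in> B" if "t \<ge> t0" for t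
  proof -
    obtain f \<beta> where f: "f \<in> GX" "\<beta> \<in> \<Gamma>"
      "\<And>s. \<bar>s\<bar> \<le> R \<Longrightarrow> dist (f s) (g s) < \<epsilon> \<and> dist (f (s + t)) (\<beta> (h s)) < \<epsilon>"
      using t0(2)[OF \<open>t \<ge> t0\<close>] by blast
    have i: "inv \<beta> \<in> \<Gamma>"
      using isometry_groupD(2)[OF isom f(2)] .
    have fB: "inv \<beta> \<circ> flow_GX t f \<in> GX"
      by (rule isometry_line[OF flow_line[OF f(1)] iso[OF i]])
    have "dist ((inv \<beta> \<circ> flow_GX t f) s) (h s) < \<epsilon>2" if "\<bar>s\<bar> \<le> R2" for s
      using f(3)[of s] that iso[OF f(2), of "inv \<beta> (f (s + t))" "h s"] isometry_groupD(4)[OF isom f(2)]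
      unfolding R_def \<epsilon>_def by (simp add: flow_GX_def)
    then have "proj_GY \<Gamma> (inv \<beta> \<circ> flow_GX t f) \<in> B"
      using h(4)[OF fB] by blast
    then have "proj_GY \<Gamma> (flow_GX t f) \<in> B"
      using proj_GY_translate[OF isom i] by metis
    moreover have "proj_GY \<Gamma> f \<in> A"
      using g(4)[OF f(1)] f(3) unfolding R_def \<epsilon>_def by simp
    ultimately show ?thesis
      using f(1) by blast
  qed
  with t0(1) show thesis
    using that by blast
qed

lemma topological_mixing: "topologically_mixing_flow \<Gamma>"
  unfolding topologically_mixing_flow_def
proof (intro allI impI)
  fix A B assume h: "openin (GY_topology \<Gamma>) A \<and> A \<noteq> {} \<and> openin (GY_topology \<Gamma>) B \<and> B \<noteq> {}"
  obtain t1 where t1: "t1 > 0"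
    "\<And>t. t \<ge> t1 \<Longrightarrow> \<exists>f\<in>GX. proj_GY \<Gamma> f \<in> A \<and> proj_GY \<Gamma> (flow_GX t f) \<in> B"
    using mixing_forward[of A B] h by blast
  obtain t2 where t2: "t2 > 0"
    "\<And>t. t \<ge> t2 \<Longrightarrow> \<exists>f\<in>GX. proj_GY \<Gamma> f \<in> B \<and> proj_GY \<Gamma> (flow_GX t f) \<in> A"
    using mixing_forward[of B A] h by blast
  have "flow_GY \<Gamma> t ` A \<inter> B \<noteq> {}" if t: "\<bar>t\<bar> \<ge> max t1 t2" for t
  proof (cases "t \<ge> 0")
    case True
    then obtain f where f: "f \<in> GX" "proj_GY \<Gamma> f \<in> A" "proj_GY \<Gamma> (flow_GX t f) \<in> B"
      using t1(2)[of t] t by auto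
    then show ?thesis
      using flow_GY_proj[OF isom f(1), of t] by (metis IntI empty_iff imageI)
  next
    case False
    then obtain f where f: "f \<in> GX" "proj_GY \<Gamma> f \<in> B" "proj_GY \<Gamma> (flow_GX (- t) f) \<in> A"
      using t2(2)[of "- t"] t by auto
    have "flow_GX t (flow_GX (- t) f) = f"
      by (simp add: flow_GX_def)
    then show ?thesis
      using flow_GY_proj[OF isom flow_line[OF f(1)], of t "- t"] f by (metis IntI empty_iff imageI)
  qed
  with t1(1) show "\<exists>t0>0. \<forall>t. t0 \<le> \<bar>t\<bar> \<longrightarrow> flow_GY \<Gamma> t ` A \<inter> B \<noteq> {}"
    by (intro exI[of _ "max t1 t2"]) auto
qed

end

theorem theorem1p2:
  fixes \<Gamma> :: "('a::metric_space \<Rightarrow> 'a) set"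
    and \<alpha> :: "('a + (real \<Rightarrow> 'a) set) \<Rightarrow> 'a \<Rightarrow> 'a \<Rightarrow> real"
  assumes "proper_space TYPE('a)"
    and "CAT_minus1_space TYPE('a)"
    and "discrete_isometry_group \<Gamma>"
    and "non_elementary \<Gamma>"
    and "is_generalized_busemann \<alpha>"
    and "\<forall>x x'. \<exists>\<xi>\<in>visual_boundary. \<alpha> (Inr \<xi>) x x' = 0"
    and "non_wandering_set \<Gamma> = GY \<Gamma>"
  shows "topologically_mixing_flow \<Gamma>"
proof -
  have \<Gamma>: "isometry_group \<Gamma>"
    using assms(3) unfolding discrete_isometry_group_def by blast
  interpret cat_minus1 "TYPE('a)"
    using assms(1,2) by unfold_locales
  interpret recurrent_group "TYPE('a)" \<Gamma>
  proof
    show "isometry_group \<Gamma>" "non_wandering_set \<Gamma> = GY \<Gamma>"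
      using \<Gamma> assms(7) by blast+
  next
    fix e r :: "real \<Rightarrow> 'a"
    assume "e \<in> geodesic_rays" "r \<in> geodesic_rays"
    from third_end[OF assms(4) this]
    show "\<exists>w\<in>geodesic_rays. sep w e \<and> sep w r"
      by blast
  next
    fix x x' :: 'a
    obtain \<xi> where \<xi>: "\<xi> \<in> visual_boundary" "\<alpha> (Inr \<xi>) x x' = 0"
      using assms(6) by blast
    obtain r where "r \<in> geodesic_rays" "\<xi> = asymptotic `` {r}"
      using visual_boundaryE[OF \<xi>(1)] .
    moreover from this have "busemann r x = busemann r x'"
      using generalized_busemann_ray[OF assms(5), of r x x'] \<xi>(2) by simp
    ultimately show "\<exists>r\<in>geodesic_rays. busemann r x = busemann r x'"
      by blast
  qed
  show ?thesis
    by (rule topological_mixing)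
qed

end
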